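(* Assume the setting of the context, with a perfect random instrument given by Kraus operators $V_{a;\omega}$, and suppose: (H1) $\theta$ is invertible (with measurable inverse), ergodic and $\mathbb P$-preserving; (H2) there is $\delta>0$ with $\sum_{n\ge1}\alpha_{\mathbb P}(n)^{\delta/(2+\delta)}<\infty$; (H3) there exist a dynamically stationary state $\mathfrak s$ and a deterministic sequence $(r_n)\subseteq[0,\infty)$ with $\sum_n r_n^{\delta/(2+\delta)}<\infty$ such that for every random initial state $\vartheta$ and $n\in\mathbb N$, $\mathbb E_{\mathbb P}\big[\|\Phi^{(n)}_\omega(\vartheta(\omega))-\mathfrak s(\theta^n\omega)\|_1\big]\le r_n$; (A) there is an orthonormal basis $(e_i)_{i=1}^d$ of $\mathbb C^d$ such that (A.1) for each $a\in\mathcal A$ there is a deterministic map $f_a:\{1,\dots,d\}\to\{1,\dots,d\}$ with, for $\mathbb P$-a.e. $\omega$ and all $i$, $V_{a;\omega}e_i\in\mathbb C e_{f_a(i)}$, and $\langle V_{a;\omega}e_i,V_{a;\omega}e_j\rangle=0$ whenever $i\ne j$; (A.2) there exist $L\in\mathbb N$, $\varepsilon>0$ and, for each $(i,j)$, an $\mathcal F$-measurable map $\omega\mapsto\kappa_{\omega;i,j}\in\mathcal P(\mathcal A^L\times\mathcal A^L)$ such that for $\mathbb P$-a.e. $\omega$ and all $i,j$, $\kappa_{\omega;i,j}$ is a coupling of $\mathbb Q_{\rho^{(i)};\omega}\circ A_{1:L}^{-1}$ and $\mathbb Q_{\rho^{(j)};\omega}\circ A_{1:L}^{-1}$ (where $\rho^{(i)}=|e_i\rangle\langle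 e_i|$) and $\kappa_{\omega;i,j}(\{(u,v):f_u(i)=f_v(j)\})\ge\varepsilon$, where $f_u:=f_{u_L}\circ\cdots\circ f_{u_1}$ for $u=(u_1,\dots,u_L)$. Then for every $m\in\mathbb N$, every $\mathbf b\in\mathcal A^m$ and every random initial state $\vartheta:\Omega\to\mathcal S_d$, under $\overline{\mathbb Q}_\vartheta$, $$\frac1{\sqrt n}\sum_{k=1}^n(\delta N_k^{\mathbf b}-\mu_{\mathbf b})\xrightarrow{\ d\ }\mathcal N(0,\Sigma_{\mathbf b}^2),$$ where $\mu_{\mathbf b}=\int_\Omega\mathbb Q_{\mathfrak s(\omega);\omega}(C_{\mathbf b})\,d\mathbb P(\omega)$ and $\Sigma_{\mathbf b}^2=\mathbb E_{\overline{\mathbb Q}_{\mathfrak s}}[(\delta N_1^{\mathbf b}-\mu_{\mathbf b})^2]+2\sum_{k\ge1}\mathbb E_{\overline{\mathbb Q}_{\mathfrak s}}[(\delta N_1^{\mathbf b}-\mu_{\mathbf b})(\delta N_{1+k}^{\mathbf b}-\mu_{\mathbf b})]$.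
   Context: Let $d\in\mathbb N$, $M_d$ the $d\times d$ complex matrices with trace norm $\|\cdot\|_1$, $\mathcal S_d$ the density matrices. Let $\mathcal A$ be finite, $(\mathcal A^{\mathbb N},\Sigma)$ the sequence space with product $\sigma$-algebra, coordinates $A_n(\bar a)=a_n$, and $A_{1:L}=(A_1,\dots,A_L)$. $(\Omega,\mathcal F,\mathbb P)$ is a probability space, $\theta:\Omega\to\Omega$ measurable. Perfect random instrument: for each $a\in\mathcal A$, $\omega\mapsto V_{a;\omega}\in M_d$ with $\mathcal T_{a;\omega}(X)=V_{a;\omega}XV_{a;\omega}^*$, $\omega\mapsto\mathcal T_{a;\omega}$ measurable, and $\sum_aV_{a;\omega}^*V_{a;\omega}=I$ $\mathbb P$-a.s.; $\mathcal V_\omega=(\mathcal T_{a;\omega})_a$, $\Phi_{k;\omega}=\sum_a\mathcal T_{a;\theta^k\omega}$, $\Phi^{(n)}_\omega=\Phi_{n;\omega}\circ\cdots\circ\Phi_{1;\omega}$. Quenched law $\mathbb Q_{\rho;\omega}$: the probability on $\Sigma$ with $\mathbb Q_{\rho;\omega}(A_1=a_1,\dots,A_n=a_n)=\operatorname{tr}[(\mathcal T_{a_n;\theta^n\omega}\circ\cdots\circ\mathcal T_{a_1;\theta\omega})(\rho)]$. A random initial state is a measurable $\vartheta:\Omega\to\mathcal S_d$, with annealed law $\overline{\mathbb Q}_\vartheta(d\omega,d\bar a)=\mathbb P(d\omega)\mathbb Q_{\vartheta(\omega);\omega}(d\bar a)$. $\mathfrak s$ is dynamically stationary if $\Phi^{(n)}_\omega(\mathfrak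 s(\omega))=\mathfrak s(\theta^n\omega)$ for all $n$, $\mathbb P$-a.s. For $\mathbf b=(b_1,\dots,b_m)$: $C_{\mathbf b}=\{\bar a:a_1=b_1,\dots,a_m=b_m\}$, $\delta N_k^{\mathbf b}(\bar a)=\mathbf 1\{a_k=b_1,\dots,a_{k+m-1}=b_m\}$. Mixing: $\mathcal F_k=\sigma(\omega\mapsto\mathcal V_{\theta^j\omega}:j\le k)$, $\mathcal F^k=\sigma(\omega\mapsto\mathcal V_{\theta^j\omega}:j\ge k)$, $\alpha_{\mathbb P}(n)=\sup_k\sup\{|\mathbb P(B\cap C)-\mathbb P(B)\mathbb P(C)|:B\in\mathcal F_k,C\in\mathcal F^{k+n}\}$. $\mathcal P(X)$ denotes probability measures on $X$; a coupling of $\mu,\nu$ is a probability on the product with marginals $\mu,\nu$. *)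

theory Defs
  imports "HOL-Probability.Probability"
begin

definition cinner :: "complex^'d \<Rightarrow> complex^'d \<Rightarrow> complex" where
  "cinner x y = (\<Sum>i\<in>UNIV. cnj (x $ i) * y $ i)"

definition cadj :: "complex^'d^'d \<Rightarrow> complex^'d^'d" where
  "cadj A = (\<chi> i j. cnj (A $ j $ i))"

definition psd :: "complex^'d^'d \<Rightarrow> bool" where
  "psd A \<longleftrightarrow> cadj A = A \<and> (\<forall>v. 0 \<le> Re (cinner v (A *v v)))"

definition density_matrix :: "complex^'d^'d \<Rightarrow> bool" where
  "density_matrix \<rho> \<longleftrightarrow> psd \<rho> \<and> trace \<rho> = 1"

definition trace_norm :: "complex^'d^'d \<Rightarrow> real" where
  "trace_norm X = Re (trace (THE R. psd R \<and> R ** R = cadj X ** X))"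

definition ket_bra :: "complex^'d \<Rightarrow> complex^'d^'d" where
  "ket_bra v = (\<chi> r c. v $ r * cnj (v $ c))"

definition Tmap :: "('a \<Rightarrow> 'w \<Rightarrow> complex^'d^'d) \<Rightarrow> 'a \<Rightarrow> 'w \<Rightarrow> complex^'d^'d \<Rightarrow> complex^'d^'d" where
  "Tmap V a \<omega> X = V a \<omega> ** X ** cadj (V a \<omega>)"

definition perfect_random_instrument ::
  "'w measure \<Rightarrow> ('a::finite \<Rightarrow> 'w \<Rightarrow> complex^'d^'d) \<Rightarrow> bool" where
  "perfect_random_instrument P V \<longleftrightarrow>
     (\<forall>a X. (\<lambda>\<omega>. Tmap V a \<omega> X) \<in> borel_measurable P) \<and>
     (AE \<omega> in P. (\<Sum>a\<in>UNIV. cadj (V a \<omega>) ** V a \<omega>) = mat 1)"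

definition Phi1 :: "('a::finite \<Rightarrow> 'w \<Rightarrow> complex^'d^'d) \<Rightarrow> ('w \<Rightarrow> 'w) \<Rightarrow> nat \<Rightarrow> 'w
    \<Rightarrow> complex^'d^'d \<Rightarrow> complex^'d^'d" where
  "Phi1 V \<theta> k \<omega> X = (\<Sum>a\<in>UNIV. Tmap V a ((\<theta> ^^ k) \<omega>) X)"

fun PhiN :: "('a::finite \<Rightarrow> 'w \<Rightarrow> complex^'d^'d) \<Rightarrow> ('w \<Rightarrow> 'w) \<Rightarrow> nat \<Rightarrow> 'w
    \<Rightarrow> complex^'d^'d \<Rightarrow> complex^'d^'d" where
  "PhiN V \<theta> 0 \<omega> X = X"
| "PhiN V \<theta> (Suc n) \<omega> X = Phi1 V \<theta> (Suc n) \<omega> (PhiN V \<theta> n \<omega> X)"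

fun evolve :: "('a \<Rightarrow> 'w \<Rightarrow> complex^'d^'d) \<Rightarrow> ('w \<Rightarrow> 'w) \<Rightarrow> 'w \<Rightarrow> nat \<Rightarrow> 'a list
    \<Rightarrow> complex^'d^'d \<Rightarrow> complex^'d^'d" where
  "evolve V \<theta> \<omega> k [] \<rho> = \<rho>"
| "evolve V \<theta> \<omega> k (a # as) \<rho> = evolve V \<theta> \<omega> (Suc k) as (Tmap V a ((\<theta> ^^ k) \<omega>) \<rho>)"

text \<open>Quenched cylinder probabilities:
  Q_{rho;w}(A_1 = a_1, ..., A_n = a_n) = tr[(T_{a_n;theta^n w} o ... o T_{a_1;theta w})(rho)].
  (A word of length n is a list; letter k (1-based) is as ! (k-1).)\<close>
definition qprob :: "('a \<Rightarrow> 'w \<Rightarrow> complex^'d^'d) \<Rightarrow> ('w \<Rightarrow> 'w) \<Rightarrow> complex^'d^'d \<Rightarrow> 'w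
    \<Rightarrow> 'a list \<Rightarrow> real" where
  "qprob V \<theta> \<rho> \<omega> as = Re (trace (evolve V \<theta> \<omega> 1 as \<rho>))"

definition random_state :: "'w measure \<Rightarrow> ('w \<Rightarrow> complex^'d^'d) \<Rightarrow> bool" where
  "random_state P \<tau> \<longleftrightarrow> \<tau> \<in> borel_measurable P \<and> (\<forall>\<omega>\<in>space P. density_matrix (\<tau> \<omega>))"

definition dyn_stationary :: "'w measure \<Rightarrow> ('a::finite \<Rightarrow> 'w \<Rightarrow> complex^'d^'d) \<Rightarrow> ('w \<Rightarrow> 'w)
    \<Rightarrow> ('w \<Rightarrow> complex^'d^'d) \<Rightarrow> bool" where
  "dyn_stationary P V \<theta> s \<longleftrightarrow> (\<forall>n. AE \<omega> in P. PhiN V \<theta> n \<omega> (s \<omega>) = s ((\<theta> ^^ n) \<omega>))"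

text \<open>Law of the first N outcomes A_{1:N} under the annealed law
  Qbar_vartheta(dw, da) = P(dw) Q_{vartheta(w);w}(da); a measure on words of length N.\<close>
definition annealed_marginal :: "'w measure \<Rightarrow> ('a \<Rightarrow> 'w \<Rightarrow> complex^'d^'d) \<Rightarrow> ('w \<Rightarrow> 'w)
    \<Rightarrow> ('w \<Rightarrow> complex^'d^'d) \<Rightarrow> nat \<Rightarrow> 'a list measure" where
  "annealed_marginal P V \<theta> \<tau> N =
     point_measure {as. length as = N} (\<lambda>as. ennreal (\<integral>\<omega>. qprob V \<theta> (\<tau> \<omega>) \<omega> as \<partial>P))"

text \<open>delta N_k^b (k >= 1) evaluated on (a prefix of) the outcome sequence.\<close>
definition dN :: "'a list \<Rightarrow> nat \<Rightarrow> 'a list \<Rightarrow> real" where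
  "dN b k as = (if take (length b) (drop (k - 1) as) = b then 1 else 0)"

definition measure_preserving_map :: "'w measure \<Rightarrow> ('w \<Rightarrow> 'w) \<Rightarrow> bool" where
  "measure_preserving_map P \<theta> \<longleftrightarrow> \<theta> \<in> P \<rightarrow>\<^sub>M P \<and>
     (\<forall>A\<in>sets P. emeasure P (\<theta> -` A \<inter> space P) = emeasure P A)"

definition ergodic_map :: "'w measure \<Rightarrow> ('w \<Rightarrow> 'w) \<Rightarrow> bool" where
  "ergodic_map P \<theta> \<longleftrightarrow>
     (\<forall>A\<in>sets P. \<theta> -` A \<inter> space P = A \<longrightarrow> measure P A = 0 \<or> measure P A = 1)"

definition thetaZ :: "'w measure \<Rightarrow> ('w \<Rightarrow> 'w) \<Rightarrow> int \<Rightarrow> 'w \<Rightarrow> 'w" where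
  "thetaZ P \<theta> j = (if 0 \<le> j then \<theta> ^^ nat j else (inv_into (space P) \<theta>) ^^ nat (- j))"

text \<open>F_k = sigma(w -> V_{theta^j w} : j <= k), F^k = sigma(w -> V_{theta^j w} : j >= k), where
  V_w = (T_{a;w})_a and each T_{a;w} is a linear map on M_d (generated by its evaluations).\<close>
definition F_past :: "'w measure \<Rightarrow> ('a \<Rightarrow> 'w \<Rightarrow> complex^'d^'d) \<Rightarrow> ('w \<Rightarrow> 'w) \<Rightarrow> int \<Rightarrow> 'w set set" where
  "F_past P V \<theta> k = sigma_sets (space P)
     {{\<omega>\<in>space P. Tmap V a (thetaZ P \<theta> j \<omega>) X \<in> B} | a X B j. j \<le> k \<and> B \<in> sets borel}"

definition F_future :: "'w measure \<Rightarrow> ('a \<Rightarrow> 'w \<Rightarrow> complex^'d^'d) \<Rightarrow> ('w \<Rightarrow> 'w) \<Rightarrow> int \<Rightarrow> 'w set set" where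
  "F_future P V \<theta> k = sigma_sets (space P)
     {{\<omega>\<in>space P. Tmap V a (thetaZ P \<theta> j \<omega>) X \<in> B} | a X B j. k \<le> j \<and> B \<in> sets borel}"

definition alpha_mix :: "'w measure \<Rightarrow> ('a \<Rightarrow> 'w \<Rightarrow> complex^'d^'d) \<Rightarrow> ('w \<Rightarrow> 'w) \<Rightarrow> nat \<Rightarrow> real" where
  "alpha_mix P V \<theta> n = Sup {\<bar>measure P (B \<inter> C) - measure P B * measure P C\<bar> | k B C.
      B \<in> F_past P V \<theta> k \<and> C \<in> F_future P V \<theta> (k + int n)}"

definition centered_gaussian :: "real \<Rightarrow> real measure" where
  "centered_gaussian v = (if v = 0 then return borel 0 else density lborel (normal_density 0 (sqrt v)))"

definition fword :: "('a \<Rightarrow> 'i \<Rightarrow> 'i) \<Rightarrow> 'a list \<Rightarrow> 'i \<Rightarrow> 'i" where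
  "fword f u i = foldl (\<lambda>x a. f a x) i u"


definition mu_b :: "'w measure \<Rightarrow> ('a \<Rightarrow> 'w \<Rightarrow> complex^'d^'d) \<Rightarrow> ('w \<Rightarrow> 'w)
    \<Rightarrow> ('w \<Rightarrow> complex^'d^'d) \<Rightarrow> 'a list \<Rightarrow> real" where
  "mu_b P V \<theta> s b = (\<integral>\<omega>. qprob V \<theta> (s \<omega>) \<omega> b \<partial>P)"

definition cov_b :: "'w measure \<Rightarrow> ('a \<Rightarrow> 'w \<Rightarrow> complex^'d^'d) \<Rightarrow> ('w \<Rightarrow> 'w)
    \<Rightarrow> ('w \<Rightarrow> complex^'d^'d) \<Rightarrow> 'a list \<Rightarrow> nat \<Rightarrow> real" where
  "cov_b P V \<theta> s b k = (\<integral>as. (dN b 1 as - mu_b P V \<theta> s b) * (dN b (1 + k) as - mu_b P V \<theta> s b)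
      \<partial>annealed_marginal P V \<theta> s (k + length b))"

definition Sigma2_b :: "'w measure \<Rightarrow> ('a \<Rightarrow> 'w \<Rightarrow> complex^'d^'d) \<Rightarrow> ('w \<Rightarrow> 'w)
    \<Rightarrow> ('w \<Rightarrow> complex^'d^'d) \<Rightarrow> 'a list \<Rightarrow> real" where
  "Sigma2_b P V \<theta> s b = cov_b P V \<theta> s b 0 + 2 * (\<Sum>k. cov_b P V \<theta> s b (Suc k))"

end

theory Submission
  imports Defs "HOL-Real_Asymp.Real_Asymp"
begin

text \<open>
  By (A.1) the maps \<open>X \<mapsto> V X V\<^sup>*\<close> send the diagonal in the basis \<open>e\<close> to the diagonal without using
  the off-diagonal entries, so the outcomes are those of a classical automaton in a random
  environment: in state \<open>i\<close> it emits \<open>a\<close> with probability \<open>\<parallel>V\<^sub>a e\<^sub>i\<parallel>\<^sup>2\<close> and moves to \<open>f\<^sub>a i\<close>. The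
  couplings of (A.2) make its state distribution contract by \<open>1 - \<epsilon>\<close> every \<open>L\<close> steps, uniformly in
  the environment. Forgetting the state inside a gap transfers the mixing of the environment to the
  outcomes: under the stationary law, the correlation across a gap \<open>g\<close> is of order
  \<open>\<alpha> (g/2) + (1 - \<epsilon>) ^ (g/2L)\<close>, which is summable. The central limit theorem then follows from
  Bernstein's block method, with blocks of length \<open>\<eta> \<surd>n\<close> and gaps of length \<open>\<eta>\<^sup>2 \<surd>n\<close>, where
  \<open>n \<rightarrow> \<infinity>\<close> first and \<open>\<eta> \<rightarrow> 0\<close> afterwards. Another initial state changes the characteristic functions
  negligibly, because finitely many initial letters do not matter.
\<close>

subsection \<open>Expectations over words\<close>

text \<open>Laws live on finite words: one weight function \<open>w\<close>, consistent under
  appending a letter, carries all marginals, and the first \<open>n\<close> windows of length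
  \<open>m\<close> read only \<open>n + m - 1\<close> letters. The obstacle is the stationary state.
  It is a measurable function of the whole environment, possibly of its future, so strong mixing
  says nothing about it. Shift invariance of the outcome law removes it: \<open>L * k\<close>
  letters are prepended, during which the start is forgotten and may be replaced by a fixed state.
  What then stands on either side of the gap depends only on separated stretches of the environment.
  The gap in turn does two jobs, separating these stretches and forgetting the state reached on its
  left, and so is divided into two halves. Of the resulting rate \<beta> the block method uses
  summability, which makes variances grow linearly, and \<open>n * \<beta> n\<close> tending to 0,
  which pays for the decouplings, about as many as the gaps are long. Third moments of blocks are
  estimated by length times second moment; the error this leaves is of order \<eta> and does not
  vanish with \<open>n\<close>, hence the second limit.\<close>

definition words :: "nat \<Rightarrow> 'a list set" where
  "words n = {u. length u = n}"

definition wexp :: "('a list \<Rightarrow> real) \<Rightarrow> nat \<Rightarrow> ('a list \<Rightarrow> 'b) \<Rightarrow> 'b::real_normed_vector" where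
  "wexp w n F = (\<Sum>u\<in>words n. w u *\<^sub>R F u)"

lemma words_iff [simp]: "u \<in> words n \<longleftrightarrow> length u = n"
  by (simp add: words_def)

lemma finite_words [simp]: "finite (words n :: 'a::finite list set)"
  using finite_lists_length_eq[of "UNIV :: 'a set" n] by (simp add: words_def)

lemma words_0 [simp]: "words 0 = {[]}"
  by (auto simp: words_def)

lemma sum_words_add:
  fixes g :: "'a::finite list \<Rightarrow> 'b::comm_monoid_add"
  shows "(\<Sum>u\<in>words (n + m). g u) = (\<Sum>u\<in>words n. \<Sum>v\<in>words m. g (u @ v))"
  unfolding sum.cartesian_product
  by (rule sum.reindex_bij_witness[of _ "\<lambda>(u, v). u @ v" "\<lambda>u. (take n u, drop n u)"]) auto

lemma sum_words_1:
  fixes g :: "'a::finite list \<Rightarrow> 'b::comm_monoid_add"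
  shows "(\<Sum>u\<in>words 1. g u) = (\<Sum>a\<in>UNIV. g [a])"
  by (rule sum.reindex_bij_witness[of _ "\<lambda>a. [a]" hd]) (auto simp: length_Suc_conv)

lemma sum_words_Suc:
  fixes g :: "'a::finite list \<Rightarrow> 'b::comm_monoid_add"
  shows "(\<Sum>u\<in>words (Suc n). g u) = (\<Sum>a\<in>UNIV. \<Sum>v\<in>words n. g (a # v))"
  using sum_words_add[of g 1 n] sum_words_1[of "\<lambda>u. \<Sum>v\<in>words n. g (u @ v)"] by simp

lemma sum_words_Suc_right:
  fixes g :: "'a::finite list \<Rightarrow> 'b::comm_monoid_add"
  shows "(\<Sum>u\<in>words (Suc n). g u) = (\<Sum>v\<in>words n. \<Sum>a\<in>UNIV. g (v @ [a]))"
  using sum_words_add[of g n 1] sum_words_1 by (simp add: sum_words_1[unfolded One_nat_def])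

lemma wexp_cong: "(\<And>u. length u = n \<Longrightarrow> F u = G u) \<Longrightarrow> wexp w n F = wexp w n G"
  by (simp add: wexp_def)

lemma wexp_add: "wexp w n (\<lambda>u. F u + G u) = wexp w n F + wexp w n G"
  by (simp add: wexp_def scaleR_add_right sum.distrib)

lemma wexp_diff: "wexp w n (\<lambda>u. F u - G u) = wexp w n F - wexp w n G"
  by (simp add: wexp_def scaleR_diff_right sum_subtractf)

lemma wexp_sum: "wexp w n (\<lambda>u. \<Sum>i\<in>I. F i u) = (\<Sum>i\<in>I. wexp w n (F i))"
  unfolding wexp_def scaleR_sum_right by (rule sum.swap)

lemma wexp_mult_left:
  fixes c :: "'b::real_normed_algebra"
  shows "wexp w n (\<lambda>u. c * F u) = c * wexp w n F"
  by (simp add: wexp_def sum_distrib_left)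

lemma wexp_mult_right:
  fixes c :: "'b::real_normed_algebra"
  shows "wexp w n (\<lambda>u. F u * c) = wexp w n F * c"
  by (simp add: wexp_def sum_distrib_right)

lemma wexp_of_real:
  "wexp w n (\<lambda>u. of_real (F u) :: 'b::real_normed_algebra_1) = of_real (wexp w n F)"
  by (simp add: wexp_def scaleR_conv_of_real)

text \<open>Kolmogorov consistency: \<open>w\<close> gives the cylinder probabilities of a process,
  and together with \<open>w_Nil\<close> it makes the weights of each length sum to 1.\<close>

locale word_law =
  fixes w :: "'a::finite list \<Rightarrow> real"
  assumes w_nonneg: "0 \<le> w u"
    and w_Nil: "w [] = 1"
    and w_snoc: "(\<Sum>a\<in>UNIV. w (u @ [a])) = w u"
begin

lemma w_append: "(\<Sum>v\<in>words k. w (u @ v)) = w u"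
proof (induction k)
  case (Suc k)
  have "(\<Sum>v\<in>words (Suc k). w (u @ v)) = (\<Sum>v\<in>words k. \<Sum>a\<in>UNIV. w ((u @ v) @ [a]))"
    by (simp add: sum_words_Suc_right)
  then show ?case by (simp only: w_snoc Suc)
qed simp

lemma wexp_take: "wexp w (n + k) (\<lambda>u. F (take n u)) = wexp w n F"
proof -
  have "wexp w (n + k) (\<lambda>u. F (take n u)) = (\<Sum>u\<in>words n. (\<Sum>v\<in>words k. w (u @ v)) *\<^sub>R F u)"
    unfolding wexp_def sum_words_add scaleR_sum_left by (intro sum.cong) auto
  then show ?thesis by (simp add: w_append wexp_def)
qed

lemma wexp_const [simp]: "wexp w n (\<lambda>_. c) = c"
  using wexp_take[of 0 n "\<lambda>_. c"] by (simp add: wexp_def w_Nil)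

lemma wexp_mono: "(\<And>u. length u = n \<Longrightarrow> F u \<le> G u) \<Longrightarrow> wexp w n F \<le> (wexp w n G :: real)"
  unfolding wexp_def by (intro sum_mono) (auto intro: mult_left_mono w_nonneg)

lemma norm_wexp_le:
  "(\<And>u. length u = n \<Longrightarrow> norm (F u) \<le> G u) \<Longrightarrow> norm (wexp w n F) \<le> wexp w n G"
  unfolding wexp_def
  by (rule order_trans[OF norm_sum sum_mono]) (auto intro: mult_left_mono simp: w_nonneg)

lemma norm_wexp_le_const:
  "(\<And>u. length u = n \<Longrightarrow> norm (F u) \<le> c) \<Longrightarrow> norm (wexp w n F) \<le> c"
  using norm_wexp_le[of n F "\<lambda>_. c"] by simp

text \<open>Jensen's inequality, obtained from the nonnegative variance of
  \<open>\<bar>R u\<bar>\<close>.\<close>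

lemma wexp_abs_le_sqrt: "wexp w n (\<lambda>u. \<bar>R u\<bar>) \<le> sqrt (wexp w n (\<lambda>u. (R u)\<^sup>2))"
proof -
  define m where "m = wexp w n (\<lambda>u. \<bar>R u\<bar>)"
  have "0 \<le> wexp w n (\<lambda>u. (\<bar>R u\<bar> - m)\<^sup>2)"
    using wexp_mono[of n "\<lambda>_. 0" "\<lambda>u. (\<bar>R u\<bar> - m)\<^sup>2"] by simp
  also have "\<dots> = wexp w n (\<lambda>u. (R u)\<^sup>2 - 2 * m * \<bar>R u\<bar> + m\<^sup>2)"
    by (rule wexp_cong) (simp add: power2_eq_square algebra_simps)
  also have "\<dots> = wexp w n (\<lambda>u. (R u)\<^sup>2) - m\<^sup>2"
    by (simp add: wexp_add wexp_diff wexp_mult_left m_def[symmetric] power2_eq_square)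
  finally show ?thesis unfolding m_def by (intro real_le_rsqrt) simp
qed

end

text \<open>Summing out the first letter, instead of the last, expresses shift invariance of the
  process.\<close>

locale stationary_word_law = word_law +
  assumes w_Cons: "(\<Sum>a\<in>UNIV. w (a # u)) = w u"
begin

lemma w_prepend: "(\<Sum>v\<in>words k. w (v @ u)) = w u"
proof (induction k arbitrary: u)
  case (Suc k)
  have "(\<Sum>v\<in>words (Suc k). w (v @ u)) = (\<Sum>a\<in>UNIV. \<Sum>v\<in>words k. w (v @ a # u))"
    by (simp add: sum_words_Suc_right) (rule sum.swap)
  then show ?case by (simp only: w_Cons Suc)
qed simp

lemma wexp_drop: "wexp w (k + n) (\<lambda>u. F (drop k u)) = wexp w n F"
proof -
  have "wexp w (k + n) (\<lambda>u. F (drop k u)) = (\<Sum>u\<in>words n. (\<Sum>v\<in>words k. w (v @ u)) *\<^sub>R F u)"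
    unfolding wexp_def sum_words_add scaleR_sum_left
    by (subst sum.swap) (intro sum.cong, auto)
  then show ?thesis by (simp add: w_prepend wexp_def)
qed

end

text \<open>The observables are complex because the method is applied to exponentials. Their lengths
  \<open>n\<close> and \<open>l\<close> are unrestricted: only the gap \<open>g\<close> enters the
  bound.\<close>

locale mixing_word_law = stationary_word_law +
  fixes \<beta> :: "nat \<Rightarrow> real"
  assumes mixing: "\<And>n g l F G. (\<And>u. norm (F u) \<le> 1) \<Longrightarrow> (\<And>u. norm (G u) \<le> 1) \<Longrightarrow>
      norm (wexp w (n + g + l) (\<lambda>u. F (take n u) * G (drop (n + g) u)) - wexp w n F * wexp w l G :: complex)
        \<le> \<beta> g"
    and \<beta>_summable: "summable \<beta>"
    and \<beta>_small: "(\<lambda>n. real n * \<beta> n) \<longlonglongrightarrow> 0"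
begin

lemma \<beta>_nonneg: "0 \<le> \<beta> g"
  using mixing[of "\<lambda>_. 0" "\<lambda>_. 0" 0 g 0] by simp

end

section \<open>Covariances and variances of window sums\<close>

locale window_observable = mixing_word_law w \<beta> for w :: "'a::finite list \<Rightarrow> real" and \<beta> +
  fixes \<psi> :: "'a list \<Rightarrow> real" and m :: nat
  assumes \<psi>_bound: "\<bar>\<psi> u\<bar> \<le> 1"
    and \<psi>_centered: "wexp w m \<psi> = 0"
    and m_pos: "0 < m"
begin

definition X :: "nat \<Rightarrow> 'a list \<Rightarrow> real" where
  "X k u = \<psi> (take m (drop k u))"

definition c :: "nat \<Rightarrow> real" where
  "c k = wexp w (k + m) (\<lambda>u. X 0 u * X k u)"

text \<open>The constant of the linear variance bound; the factor 2 accounts for the two sides of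
  the diagonal of the covariance matrix.\<close>

definition K :: real where
  "K = 2 * (\<Sum>k. \<bar>c k\<bar>)"

text \<open>The variance of a block of \<open>p\<close> windows. The word has one letter more than
  the windows occupy, which is harmless by consistency.\<close>

definition v :: "nat \<Rightarrow> real" where
  "v p = wexp w (p + m) (\<lambda>u. (\<Sum>i<p. X i u)\<^sup>2)"

lemma X_bound: "\<bar>X k u\<bar> \<le> 1"
  by (simp add: X_def \<psi>_bound)

lemma X_drop: "X k (drop j u) = X (j + k) u"
  by (simp add: X_def add.commute)

lemma X_take: "k + m \<le> M \<Longrightarrow> X k (take M u) = X k u"
  by (simp add: X_def drop_take min_def)

lemma wexp_X: "k + m \<le> N \<Longrightarrow> wexp w N (X k) = 0"
proof -
  assume "k + m \<le> N"
  then obtain j where N: "N = k + (m + j)" by (metis add.assoc le_iff_add)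
  have "wexp w N (X k) = wexp w N (\<lambda>u. X 0 (drop k u))" by (simp add: X_drop)
  also have "\<dots> = wexp w (m + j) (\<lambda>u. \<psi> (take m u))"
    unfolding N wexp_drop by (simp add: X_def[abs_def])
  finally show ?thesis by (simp add: wexp_take \<psi>_centered)
qed

lemma wexp_XX:
  assumes "j + k + m \<le> N"
  shows "wexp w N (\<lambda>u. X j u * X (j + k) u) = c k"
proof -
  obtain i where N: "N = j + ((k + m) + i)" using assms by (metis add.assoc le_iff_add)
  have "wexp w N (\<lambda>u. X j u * X (j + k) u) = wexp w N (\<lambda>u. X 0 (drop j u) * X k (drop j u))"
    by (simp add: X_drop)
  also have "\<dots> = wexp w ((k + m) + i) (\<lambda>u. X 0 u * X k u)"
    unfolding N by (rule wexp_drop)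
  also have "\<dots> = wexp w ((k + m) + i) (\<lambda>u. X 0 (take (k + m) u) * X k (take (k + m) u))"
    by (simp add: X_take)
  also have "\<dots> = wexp w (k + m) (\<lambda>u. X 0 u * X k u)" by (rule wexp_take)
  finally show ?thesis by (simp add: c_def)
qed

text \<open>Windows whose starts differ by \<open>m + k\<close> leave \<open>k\<close> letters
  between them, and centering removes the product of the means.\<close>

lemma c_decay: "\<bar>c (m + k)\<bar> \<le> \<beta> k"
proof -
  have "norm (wexp w (m + k + m) (\<lambda>u. of_real (\<psi> (take m u)) * of_real (\<psi> (drop (m + k) u)))
      - wexp w m (\<lambda>u. of_real (\<psi> u)) * wexp w m (\<lambda>u. of_real (\<psi> u)) :: complex) \<le> \<beta> k"
    using mixing[where F = "\<lambda>u. of_real (\<psi> u)" and G = "\<lambda>u. of_real (\<psi> u)"] \<psi>_bound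
    by simp
  also have "wexp w (m + k + m) (\<lambda>u. of_real (\<psi> (take m u)) * of_real (\<psi> (drop (m + k) u)))
     = (of_real (c (m + k)) :: complex)"
    unfolding c_def X_def wexp_of_real[symmetric] by (rule wexp_cong) simp
  finally show ?thesis by (simp add: wexp_of_real \<psi>_centered)
qed

lemma c_summable: "summable (\<lambda>k. \<bar>c k\<bar>)"
proof -
  have "summable (\<lambda>k. \<bar>c (k + m)\<bar>)"
    by (rule summable_comparison_test[OF _ \<beta>_summable]) (use c_decay in \<open>auto simp: add.commute\<close>)
  then show ?thesis by (subst summable_iff_shift[symmetric, of _ m])
qed

lemma sum_c_le: "finite I \<Longrightarrow> inj_on h I \<Longrightarrow> (\<Sum>j\<in>I. \<bar>c (h j)\<bar>) \<le> (\<Sum>k. \<bar>c k\<bar>)"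
  using sum_le_suminf[OF c_summable, of "h ` I"] by (simp add: sum.reindex)

text \<open>Each row of the covariance matrix has sum at most \<open>K\<close>. The index set is
  arbitrary because the bound is needed for the scattered windows left outside the blocks, as well
  as for whole blocks.\<close>

lemma second_moment_le:
  assumes I: "finite I" "\<And>i. i \<in> I \<Longrightarrow> i + m \<le> N"
  shows "wexp w N (\<lambda>u. (\<Sum>i\<in>I. X i u)\<^sup>2) \<le> K * card I"
proof -
  have "wexp w N (\<lambda>u. (\<Sum>i\<in>I. X i u)\<^sup>2) = (\<Sum>i\<in>I. \<Sum>j\<in>I. wexp w N (\<lambda>u. X i u * X j u))"
    by (simp add: power2_eq_square sum_product wexp_sum)
  also have "\<dots> \<le> (\<Sum>i\<in>I. K)"
  proof (rule sum_mono)
    fix i assume i: "i \<in> I"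
    have "(\<Sum>j\<in>I. wexp w N (\<lambda>u. X i u * X j u)) \<le> (\<Sum>j\<in>I. if i \<le> j then \<bar>c (j - i)\<bar> else \<bar>c (i - j)\<bar>)"
    proof (rule sum_mono)
      fix j assume j: "j \<in> I"
      show "wexp w N (\<lambda>u. X i u * X j u) \<le> (if i \<le> j then \<bar>c (j - i)\<bar> else \<bar>c (i - j)\<bar>)"
        using wexp_XX[of i "j - i" N] wexp_XX[of j "i - j" N] I(2)[OF i] I(2)[OF j]
        by (auto simp: mult.commute)
    qed
    also have "\<dots> = (\<Sum>j\<in>{j\<in>I. i \<le> j}. \<bar>c (j - i)\<bar>) + (\<Sum>j\<in>{j\<in>I. \<not> i \<le> j}. \<bar>c (i - j)\<bar>)"
      unfolding sum.If_cases[OF I(1)] by (intro arg_cong2[where f = "(+)"] sum.cong) auto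
    also have "\<dots> \<le> (\<Sum>k. \<bar>c k\<bar>) + (\<Sum>k. \<bar>c k\<bar>)"
      using I(1) by (intro add_mono sum_c_le) (auto simp: inj_on_def)
    finally show "(\<Sum>j\<in>I. wexp w N (\<lambda>u. X i u * X j u)) \<le> K" by (simp add: K_def)
  qed
  finally show ?thesis by (simp add: mult.commute)
qed

lemma v_le: "v p \<le> K * p"
  unfolding v_def using second_moment_le[of "{..<p}" "p + m"] by simp

lemma v_nonneg: "0 \<le> v p"
  unfolding v_def using wexp_mono[of "p + m" "\<lambda>_. 0"] by simp

text \<open>The increments are partial sums of the series for the limiting variance, so
  \<open>v p / p\<close> becomes a Cesaro mean of a convergent sequence.\<close>

lemma v_Suc: "v (Suc p) = v p + (c 0 + 2 * (\<Sum>k<p. c (Suc k)))"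
proof -
  have "v (Suc p) = wexp w (Suc p + m) (\<lambda>u. (\<Sum>i<p. X i u)\<^sup>2 + (X p u * X p u + 2 * (\<Sum>i<p. X i u * X p u)))"
    unfolding v_def by (rule wexp_cong) (simp add: power2_eq_square algebra_simps sum_distrib_left)
  also have "\<dots> = wexp w (Suc p + m) (\<lambda>u. (\<Sum>i<p. X i u)\<^sup>2)
      + (c 0 + 2 * (\<Sum>i<p. wexp w (Suc p + m) (\<lambda>u. X i u * X p u)))"
    using wexp_XX[of p 0 "Suc p + m"] by (simp add: wexp_add wexp_mult_left wexp_sum)
  also have "wexp w (Suc p + m) (\<lambda>u. (\<Sum>i<p. X i u)\<^sup>2) = wexp w ((p + m) + 1) (\<lambda>u. (\<Sum>i<p. X i (take (p + m) u))\<^sup>2)"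
    by (simp add: X_take)
  also have "\<dots> = v p" unfolding v_def by (rule wexp_take)
  also have "(\<Sum>i<p. wexp w (Suc p + m) (\<lambda>u. X i u * X p u)) = (\<Sum>i<p. c (p - i))"
  proof (intro sum.cong refl)
    fix i assume "i \<in> {..<p}"
    then show "wexp w (Suc p + m) (\<lambda>u. X i u * X p u) = c (p - i)"
      using wexp_XX[of i "p - i" "Suc p + m"] by simp
  qed
  also have "\<dots> = (\<Sum>k<p. c (Suc k))"
    by (subst sum.nat_diff_reindex[symmetric]) (auto intro!: sum.cong simp: Suc_diff_Suc)
  finally show ?thesis .
qed

definition sigma2 :: real where
  "sigma2 = c 0 + 2 * (\<Sum>k. c (Suc k))"

lemma summable_c_Suc: "summable (\<lambda>k. c (Suc k))"
  by (rule summable_rabs_cancel) (simp add: c_summable summable_Suc_iff[of "\<lambda>k. \<bar>c k\<bar>"])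

end

subsection \<open>Central limit theorem for mixing word laws\<close>

lemma cesaro_mean:
  fixes a :: "nat \<Rightarrow> real"
  assumes "a \<longlonglongrightarrow> l"
  shows "(\<lambda>n. (\<Sum>i<n. a i) / real n) \<longlonglongrightarrow> l"
proof (rule LIMSEQ_I)
  fix e :: real assume e: "0 < e"
  obtain N where N: "\<And>i. i \<ge> N \<Longrightarrow> \<bar>a i - l\<bar> < e / 2"
    using LIMSEQ_D[OF assms, of "e / 2"] e by auto
  define C where "C = (\<Sum>i<N. \<bar>a i - l\<bar>)"
  obtain M :: nat where M: "2 * C / e < real M" using reals_Archimedean2 by blast
  show "\<exists>no. \<forall>n\<ge>no. norm ((\<Sum>i<n. a i) / real n - l) < e"
  proof (intro exI allI impI)
    fix n assume n: "max (Suc N) M \<le> n"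
    have "\<bar>\<Sum>i<n. a i - l\<bar> \<le> (\<Sum>i<n. \<bar>a i - l\<bar>)" by (rule sum_abs)
    also have "\<dots> = C + (\<Sum>i=N..<n. \<bar>a i - l\<bar>)"
      unfolding C_def using n by (simp add: lessThan_atLeast0 sum.atLeastLessThan_concat)
    also have "(\<Sum>i=N..<n. \<bar>a i - l\<bar>) \<le> (\<Sum>i=N..<n. e / 2)"
      by (intro sum_mono) (use N in \<open>force simp: less_imp_le\<close>)
    also have "(\<Sum>i=N..<n. e / 2) \<le> real n * (e / 2)" using e by (simp add: mult_right_mono)
    also have "C < real n * (e / 2)"
    proof -
      have "2 * C / e < real n" using M n by linarith
      then show ?thesis using e by (simp add: field_simps)
    qed
    finally have "\<bar>\<Sum>i<n. a i - l\<bar> < e * real n" by (simp add: mult.commute)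
    moreover have "(\<Sum>i<n. a i) / real n - l = (\<Sum>i<n. a i - l) / real n"
      using n by (simp add: sum_subtractf field_simps)
    ultimately show "norm ((\<Sum>i<n. a i) / real n - l) < e"
      using n by (simp add: abs_divide pos_divide_less_eq)
  qed
qed

lemma norm_iexp_diff_le: "norm (iexp x - iexp y) \<le> \<bar>x - y\<bar>"
proof -
  have "iexp x - iexp y = iexp y * (iexp (x - y) - 1)"
    by (simp add: algebra_simps flip: exp_add)
  then show ?thesis using iexp_approx1[of "x - y" 0] by (simp add: norm_mult)
qed

lemma abs_exp_minus_le:
  fixes x :: real
  assumes "0 \<le> x"
  shows "\<bar>1 - x - exp (- x)\<bar> \<le> x\<^sup>2"
proof -
  have "1 - x \<le> exp (- x)" using exp_ge_add_one_self[of "- x"] by simp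
  moreover have "exp (- x) \<le> 1 / (1 + x)"
    using exp_ge_add_one_self[of x] assms by (simp add: exp_minus field_simps)
  moreover have "1 / (1 + x) \<le> 1 - x + x\<^sup>2"
    using assms by (simp add: field_simps power2_eq_square)
  ultimately show ?thesis by linarith
qed

section \<open>Characteristic functions of blocks\<close>

context window_observable
begin

text \<open>The characteristic function, at frequency \<xi>, of the sum over one block of
  \<open>p\<close> windows.\<close>

definition z :: "nat \<Rightarrow> real \<Rightarrow> complex" where
  "z p \<xi> = wexp w (p + m) (\<lambda>u. iexp (\<xi> * (\<Sum>i<p. X i u)))"

lemma v_average: "(\<lambda>p. v p / real p) \<longlonglongrightarrow> sigma2"
proof -
  have "v p = (\<Sum>j<p. c 0 + 2 * (\<Sum>k<j. c (Suc k)))" for p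
    by (induction p) (simp_all add: v_Suc, simp add: v_def)
  moreover have "(\<lambda>j. c 0 + 2 * (\<Sum>k<j. c (Suc k))) \<longlonglongrightarrow> sigma2"
    unfolding sigma2_def by (intro tendsto_intros summable_LIMSEQ summable_c_Suc)
  ultimately show ?thesis using cesaro_mean by presburger
qed

lemma sigma2_nonneg: "0 \<le> sigma2"
  by (rule LIMSEQ_le_const[OF v_average]) (simp add: v_nonneg)

lemma norm_z_le: "norm (z p \<xi>) \<le> 1"
  unfolding z_def by (rule norm_wexp_le_const) simp

text \<open>Taylor expansion to second order, whose linear term has mean 0. Since a block sum is at
  most \<open>p\<close> in absolute value, its third absolute moment is at most \<open>p\<close>
  times its variance, hence at most \<open>K * p\<^sup>2\<close>; no moment estimate beyond the
  second is used.\<close>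

lemma block_expansion:
  "norm (z p \<xi> - of_real (1 - \<xi>\<^sup>2 * v p / 2)) \<le> \<bar>\<xi>\<bar> ^ 3 * (real p)\<^sup>2 * K / 6"
proof -
  define T where "T u = (\<Sum>i<p. X i u)" for u
  have T_le: "\<bar>T u\<bar> \<le> real p" for u
  proof -
    have "\<bar>T u\<bar> \<le> (\<Sum>i<p. \<bar>X i u\<bar>)" unfolding T_def by (rule sum_abs)
    also have "\<dots> \<le> (\<Sum>i<p. 1)" by (intro sum_mono X_bound)
    finally show ?thesis by simp
  qed
  have T0: "wexp w (p + m) T = 0"
    unfolding T_def wexp_sum by (simp add: wexp_X)
  define A :: "'a list \<Rightarrow> complex" where
    "A u = 1 + of_real (T u) * (\<i> * of_real \<xi>) - of_real ((T u)\<^sup>2) * of_real (\<xi>\<^sup>2 / 2)" for u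
  have "wexp w (p + m) A = of_real (1 - \<xi>\<^sup>2 * v p / 2)"
    unfolding A_def wexp_diff wexp_add wexp_mult_right wexp_of_real wexp_const T0
    by (simp add: v_def T_def[abs_def])
  then have "z p \<xi> - of_real (1 - \<xi>\<^sup>2 * v p / 2) = wexp w (p + m) (\<lambda>u. iexp (\<xi> * T u) - A u)"
    by (simp add: wexp_diff z_def T_def)
  also have "norm \<dots> \<le> wexp w (p + m) (\<lambda>u. (T u)\<^sup>2 * (\<bar>\<xi>\<bar> ^ 3 * real p / 6))"
  proof (rule norm_wexp_le)
    fix u :: "'a list"
    have "(\<Sum>k\<le>2. (\<i> * complex_of_real (\<xi> * T u)) ^ k / fact k) = A u"
      by (simp add: A_def numeral_2_eq_2 power_mult_distrib)
    then have "norm (iexp (\<xi> * T u) - A u) \<le> \<bar>\<xi> * T u\<bar> ^ 3 / 6"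
      using iexp_approx1[of "\<xi> * T u" 2] by (simp add: numeral_3_eq_3 fact_numeral)
    also have "\<bar>\<xi> * T u\<bar> ^ 3 = (T u)\<^sup>2 * (\<bar>\<xi>\<bar> ^ 3 * \<bar>T u\<bar>)"
    proof -
      have "\<bar>T u\<bar> ^ 3 = (T u)\<^sup>2 * \<bar>T u\<bar>"
        using power2_abs[of "T u"] by (simp add: power2_eq_square power3_eq_cube)
      then show ?thesis by (simp add: abs_mult power_mult_distrib)
    qed
    also have "\<dots> / 6 \<le> (T u)\<^sup>2 * (\<bar>\<xi>\<bar> ^ 3 * real p) / 6"
      using T_le by (intro divide_right_mono mult_left_mono) auto
    finally show "norm (iexp (\<xi> * T u) - A u) \<le> (T u)\<^sup>2 * (\<bar>\<xi>\<bar> ^ 3 * real p / 6)" by simp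
  qed
  also have "\<dots> = v p * (\<bar>\<xi>\<bar> ^ 3 * real p / 6)"
    unfolding wexp_mult_right by (simp only: v_def T_def)
  also have "\<dots> \<le> (K * real p) * (\<bar>\<xi>\<bar> ^ 3 * real p / 6)"
    by (intro mult_right_mono v_le) auto
  finally show ?thesis by (simp add: power2_eq_square ac_simps)
qed

text \<open>A unit of \<open>B\<close> letters is a gap followed by a block, so each new block is
  separated by \<open>g\<close> letters from everything before it. All factors have modulus at most
  1, hence the errors of the successive decouplings merely add up.\<close>

lemma block_decoupling:
  fixes g p :: nat
  defines "B \<equiv> g + (p + m)"
  shows "norm (wexp w (j * B) (\<lambda>u. iexp (\<xi> * (\<Sum>j'<j. \<Sum>i<p. X (j' * B + g + i) u))) - z p \<xi> ^ j)
    \<le> real j * \<beta> g"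
proof (induction j)
  case 0
  show ?case by (simp add: wexp_def w_Nil)
next
  case (Suc j)
  define F where "F u = iexp (\<xi> * (\<Sum>j'<j. \<Sum>i<p. X (j' * B + g + i) u))" for u
  define G where "G u = iexp (\<xi> * (\<Sum>i<p. X i u))" for u
  have F_take: "F (take (j * B) u) = F u" for u
  proof -
    have "X (j' * B + g + i) (take (j * B) u) = X (j' * B + g + i) u" if "j' < j" "i < p" for j' i
    proof (rule X_take)
      have "Suc j' * B \<le> j * B" using that by (intro mult_right_mono) auto
      then show "j' * B + g + i + m \<le> j * B" using that by (simp add: B_def)
    qed
    then show ?thesis by (simp add: F_def)
  qed
  have FG: "F u * G (drop (j * B + g) u) =
      iexp (\<xi> * (\<Sum>j'<Suc j. \<Sum>i<p. X (j' * B + g + i) u))" for u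
    by (simp add: F_def G_def X_drop distrib_left exp_add)
  have "Suc j * B = j * B + g + (p + m)" by (simp add: B_def)
  then have "wexp w (Suc j * B) (\<lambda>u. iexp (\<xi> * (\<Sum>j'<Suc j. \<Sum>i<p. X (j' * B + g + i) u)))
     = wexp w (j * B + g + (p + m)) (\<lambda>u. F (take (j * B) u) * G (drop (j * B + g) u))"
    by (simp only: F_take FG)
  moreover have "norm (wexp w (j * B + g + (p + m)) (\<lambda>u. F (take (j * B) u) * G (drop (j * B + g) u))
      - wexp w (j * B) F * wexp w (p + m) G) \<le> \<beta> g"
    by (rule mixing) (simp_all add: F_def G_def)
  moreover have "wexp w (p + m) G = z p \<xi>"
    by (simp only: G_def[abs_def] z_def)
  moreover have "norm (wexp w (j * B) F * z p \<xi> - z p \<xi> ^ Suc j) \<le> real j * \<beta> g"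
  proof -
    have "norm ((wexp w (j * B) F - z p \<xi> ^ j) * z p \<xi>) \<le> (real j * \<beta> g) * 1"
      unfolding norm_mult using Suc.IH norm_z_le
      by (intro mult_mono) (auto simp: F_def[abs_def] \<beta>_nonneg simp del: of_real_sum)
    then show ?thesis by (simp add: algebra_simps)
  qed
  ultimately show ?case
    using norm_triangle_ineq[of "wexp w (Suc j * B) (\<lambda>u. iexp (\<xi> * (\<Sum>j'<Suc j. \<Sum>i<p. X (j' * B + g + i) u)))
      - wexp w (j * B) F * z p \<xi>" "wexp w (j * B) F * z p \<xi> - z p \<xi> ^ Suc j"]
    by (simp add: distrib_right)
qed

text \<open>The \<open>n - k * p\<close> windows that do not start in a block are discarded. This
  costs their mean absolute sum, which is controlled by the second moment.\<close>

lemma bernstein_blocks: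
  fixes g p :: nat
  assumes "k * (g + (p + m)) \<le> n"
  shows "norm (wexp w (n + m - 1) (\<lambda>u. iexp (\<xi> * (\<Sum>i<n. X i u))) - z p \<xi> ^ k)
    \<le> \<bar>\<xi>\<bar> * sqrt (K * (real n - real (k * p))) + real k * \<beta> g"
proof -
  define B where "B = g + (p + m)"
  define N where "N = n + m - 1"
  define h where "h = (\<lambda>(j, i). j * B + g + i)"
  define J where "J = h ` ({..<k} \<times> {..<p})"
  have h_less: "j * B + g + i + m \<le> k * B" if "j < k" "i < p" for j i
  proof -
    have "Suc j * B \<le> k * B" using that by (intro mult_right_mono) auto
    then show ?thesis using that by (simp add: B_def)
  qed
  have kB: "k * B \<le> n" using assms by (simp add: B_def)
  have "inj_on h ({..<k} \<times> {..<p})"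
  proof (rule inj_onI, clarify)
    fix j i j' i' assume *: "h (j, i) = h (j', i')" "i < p" "i' < p"
    \<comment> \<open>The offset inside a unit is below \<open>B\<close>, so division by
      \<open>B\<close> recovers the number of the block.\<close>
    have "g + i < B" "g + i' < B" using * m_pos by (auto simp: B_def)
    then have "h (j, i) div B = j" "h (j', i') div B = j'" by (simp_all add: h_def add.assoc)
    then have "j = j'" using * by simp
    then show "j = j' \<and> i = i'" using *(1) by (simp add: h_def)
  qed
  then have card_J: "card J = k * p" and
    sum_J: "(\<Sum>i\<in>J. X i u) = (\<Sum>j<k. \<Sum>i<p. X (j * B + g + i) u)" for u
    by (auto simp: J_def card_image card_cartesian_product sum.reindex sum.cartesian_product h_def case_prod_unfold)
  have J_sub: "J \<subseteq> {..<n}"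
  proof
    fix x assume "x \<in> J"
    then obtain j i where "j < k" "i < p" "x = j * B + g + i" by (auto simp: J_def h_def)
    then show "x \<in> {..<n}" using h_less[of j i] kB m_pos by simp
  qed
  define I where "I = {..<n} - J"
  have card_I: "real (card I) = real n - real (k * p)"
    using J_sub card_mono[OF _ J_sub] unfolding I_def
    by (simp add: card_Diff_subset finite_subset[OF J_sub] card_J of_nat_diff)
  have split: "(\<Sum>i<n. X i u) - (\<Sum>i\<in>J. X i u) = (\<Sum>i\<in>I. X i u)" for u
    unfolding I_def using J_sub by (simp add: sum_diff)
  define F where "F u = iexp (\<xi> * (\<Sum>i\<in>J. X i u))" for u
  have "wexp w N F = wexp w (k * B + (N - k * B)) (\<lambda>u. F (take (k * B) u))"
  proof -
    have "F (take (k * B) u) = F u" for u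
      unfolding F_def sum_J by (intro arg_cong[where f = exp] arg_cong2[where f = "(*)"] refl
          arg_cong[where f = of_real] sum.cong X_take h_less) auto
    moreover have "k * B + (N - k * B) = N" using kB m_pos by (simp add: N_def)
    ultimately show ?thesis by simp
  qed
  also have "\<dots> = wexp w (k * B) F" by (rule wexp_take)
  finally have 1: "norm (wexp w N F - z p \<xi> ^ k) \<le> real k * \<beta> g"
    using block_decoupling[of k g p \<xi>] by (simp add: F_def[abs_def] sum_J B_def)
  have "norm (wexp w N (\<lambda>u. iexp (\<xi> * (\<Sum>i<n. X i u))) - wexp w N F)
      \<le> wexp w N (\<lambda>u. \<bar>\<xi>\<bar> * \<bar>\<Sum>i\<in>I. X i u\<bar>)"
    unfolding wexp_diff[symmetric]
  proof (rule norm_wexp_le)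
    fix u :: "'a list"
    show "norm (iexp (\<xi> * (\<Sum>i<n. X i u)) - F u) \<le> \<bar>\<xi>\<bar> * \<bar>\<Sum>i\<in>I. X i u\<bar>"
      unfolding F_def using norm_iexp_diff_le[of "\<xi> * (\<Sum>i<n. X i u)" "\<xi> * (\<Sum>i\<in>J. X i u)"]
      by (simp add: abs_mult split flip: right_diff_distrib)
  qed
  also have "\<dots> \<le> \<bar>\<xi>\<bar> * sqrt (wexp w N (\<lambda>u. (\<Sum>i\<in>I. X i u)\<^sup>2))"
    unfolding wexp_mult_left by (intro mult_left_mono wexp_abs_le_sqrt) auto
  also have "\<dots> \<le> \<bar>\<xi>\<bar> * sqrt (K * card I)"
    by (intro mult_left_mono real_sqrt_le_mono second_moment_le) (auto simp: I_def N_def)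
  finally have 2: "norm (wexp w N (\<lambda>u. iexp (\<xi> * (\<Sum>i<n. X i u))) - wexp w N F)
      \<le> \<bar>\<xi>\<bar> * sqrt (K * (real n - real (k * p)))"
    by (simp only: card_I)
  show ?thesis
    using norm_triangle_ineq[of "wexp w N (\<lambda>u. iexp (\<xi> * (\<Sum>i<n. X i u))) - wexp w N F"
        "wexp w N F - z p \<xi> ^ k"] 1 2
    by (simp add: N_def)
qed

text \<open>The numbers \<open>z p \<xi>\<close> and \<open>exp (- y)\<close> both lie in the closed
  unit disc, so their \<open>k\<close>-th powers differ by at most \<open>k\<close> times their
  difference. The latter is split at \<open>1 - y\<close>, the common approximation of the
  two.\<close>

lemma char_bound:
  fixes \<xi> :: real and p :: nat
  assumes "k * (g + (p + m)) \<le> n"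
  defines "y \<equiv> \<xi>\<^sup>2 * v p / 2"
  shows "norm (wexp w (n + m - 1) (\<lambda>u. iexp (\<xi> * (\<Sum>i<n. X i u))) - of_real (exp (- (k * y))))
    \<le> \<bar>\<xi>\<bar> * sqrt (K * (real n - real (k * p))) + real k * \<beta> g
      + real k * (\<bar>\<xi>\<bar> ^ 3 * (real p)\<^sup>2 * K / 6 + y\<^sup>2)"
proof -
  have y: "0 \<le> y" by (simp add: y_def v_nonneg)
  have "norm (z p \<xi> - of_real (exp (- y))) \<le> norm (z p \<xi> - of_real (1 - y)) + norm (of_real (1 - y) - of_real (exp (- y)) :: complex)"
    using norm_triangle_ineq[of "z p \<xi> - of_real (1 - y)" "of_real (1 - y) - of_real (exp (- y))"] by simp
  also have "\<dots> \<le> \<bar>\<xi>\<bar> ^ 3 * (real p)\<^sup>2 * K / 6 + y\<^sup>2"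
    using block_expansion[of p \<xi>] abs_exp_minus_le[OF y]
    by (intro add_mono) (simp_all add: y_def flip: of_real_diff del: of_real_exp)
  finally have 1: "norm (z p \<xi> - of_real (exp (- y))) \<le> \<bar>\<xi>\<bar> ^ 3 * (real p)\<^sup>2 * K / 6 + y\<^sup>2" .
  have "norm (z p \<xi> ^ k - of_real (exp (- y)) ^ k) \<le> real k * norm (z p \<xi> - of_real (exp (- y)))"
    using y norm_z_le by (intro norm_power_diff) (auto simp del: of_real_exp)
  also have "\<dots> \<le> real k * (\<bar>\<xi>\<bar> ^ 3 * (real p)\<^sup>2 * K / 6 + y\<^sup>2)"
    using 1 by (intro mult_left_mono) auto
  also have "of_real (exp (- y)) ^ k = (of_real (exp (- (k * y))) :: complex)"
    by (simp add: exp_of_nat_mult[symmetric] del: of_real_exp flip: of_real_power)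
  finally show ?thesis
    using bernstein_blocks[OF assms(1), of \<xi>]
      norm_triangle_ineq[of "wexp w (n + m - 1) (\<lambda>u. iexp (\<xi> * (\<Sum>i<n. X i u))) - z p \<xi> ^ k"
        "z p \<xi> ^ k - of_real (exp (- (k * y)))"]
    by simp
qed

lemma block_limits:
  fixes \<eta> :: real
  assumes \<eta>: "0 < \<eta>"
  defines "p \<equiv> \<lambda>n. nat \<lfloor>\<eta> * sqrt (real n)\<rfloor>"
    and "g \<equiv> \<lambda>n. nat \<lfloor>\<eta>\<^sup>2 * sqrt (real n)\<rfloor>"
  defines "k \<equiv> \<lambda>n. n div (g n + (p n + m))"
  shows "(\<lambda>n. real (p n) / sqrt (real n)) \<longlonglongrightarrow> \<eta>"
    and "(\<lambda>n. real (k n) / sqrt (real n)) \<longlonglongrightarrow> 1 / (\<eta> + \<eta>\<^sup>2)"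
    and "(\<lambda>n. real (k n) * \<beta> (g n)) \<longlonglongrightarrow> 0"
    and "filterlim p at_top sequentially"
    and "filterlim k at_top sequentially"
proof -
  have floor: "(\<lambda>n. real (nat \<lfloor>x * sqrt (real n)\<rfloor>) / sqrt (real n)) \<longlonglongrightarrow> x" if "0 < x" for x :: real
    using that by real_asymp
  show p: "(\<lambda>n. real (p n) / sqrt (real n)) \<longlonglongrightarrow> \<eta>"
    unfolding p_def by (rule floor[OF \<eta>])
  have g: "(\<lambda>n. real (g n) / sqrt (real n)) \<longlonglongrightarrow> \<eta>\<^sup>2"
    unfolding g_def by (rule floor) (use \<eta> in simp)
  define B where "B n = g n + (p n + m)" for n
  have m: "(\<lambda>n. real m / sqrt (real n)) \<longlonglongrightarrow> 0" by real_asymp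
  have B: "(\<lambda>n. real (B n) / sqrt (real n)) \<longlonglongrightarrow> \<eta> + \<eta>\<^sup>2"
    using tendsto_add[OF g tendsto_add[OF p m]] by (simp add: B_def add_divide_distrib add_ac)
  have root: "(\<lambda>n. 1 / sqrt (real n)) \<longlonglongrightarrow> 0" by real_asymp
  have "(\<lambda>n. (real (B n) / sqrt (real n)) * (1 / sqrt (real n))) \<longlonglongrightarrow> (\<eta> + \<eta>\<^sup>2) * 0"
    by (intro tendsto_mult B root)
  then have Bn: "(\<lambda>n. real (B n) / real n) \<longlonglongrightarrow> 0" by simp
  \<comment> \<open>The units cover all but a remainder of fewer than \<open>B n\<close> letters,
    and \<open>B n\<close> is of order \<open>sqrt n\<close>.\<close>
  have kB: "(\<lambda>n. real (k n * B n) / real n) \<longlonglongrightarrow> 1"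
  proof (rule tendsto_sandwich[of "\<lambda>n. 1 - real (B n) / real n" _ _ "\<lambda>_. 1"])
    have "real (k n * B n) + real (B n) \<ge> real n" for n
    proof -
      have "0 < B n" using m_pos by (simp add: B_def)
      have "n = k n * B n + n mod B n" unfolding k_def B_def by (simp only: div_mult_mod_eq)
      moreover have "n mod B n \<le> B n" using \<open>0 < B n\<close> by (simp add: less_imp_le)
      ultimately show ?thesis by (metis add_left_mono of_nat_add of_nat_mono)
    qed
    then have "1 \<le> (real (k n * B n) + real (B n)) / real n" if "0 < n" for n
      using that by (simp only: le_divide_eq) simp
    then show "\<forall>\<^sub>F n in sequentially. 1 - real (B n) / real n \<le> real (k n * B n) / real n"
      by (intro eventually_mono[OF eventually_gt_at_top[of 0]])
        (simp only: add_divide_distrib diff_le_eq)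
    have "k n * B n \<le> n" for n by (simp add: k_def B_def)
    then show "\<forall>\<^sub>F n in sequentially. real (k n * B n) / real n \<le> 1"
      by (intro eventually_mono[OF eventually_gt_at_top[of 0]]) (simp flip: of_nat_mult)
    show "(\<lambda>n. 1 - real (B n) / real n) \<longlonglongrightarrow> 1"
      using tendsto_diff[OF tendsto_const Bn] by simp
  qed simp
  have pos: "\<eta> + \<eta>\<^sup>2 \<noteq> 0" using \<eta> by (smt (verit) zero_less_power)
  have quot: "(\<lambda>n. (real (k n * B n) / real n) / (real (B n) / sqrt (real n))) \<longlonglongrightarrow> 1 / (\<eta> + \<eta>\<^sup>2)"
    by (intro tendsto_divide kB B pos)
  have quot_eq: "(real (k n * B n) / real n) / (real (B n) / sqrt (real n)) = real (k n) / sqrt (real n)" if "0 < n" for n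
  proof -
    have "0 < B n" using m_pos by (simp add: B_def)
    then show ?thesis using that
      by (simp add: divide_simps)
  qed
  show k: "(\<lambda>n. real (k n) / sqrt (real n)) \<longlonglongrightarrow> 1 / (\<eta> + \<eta>\<^sup>2)"
    by (rule Lim_transform_eventually[OF quot eventually_mono[OF eventually_gt_at_top[of 0] quot_eq]])
  have sqrt_top: "filterlim (\<lambda>n. sqrt (real n)) at_top sequentially" by real_asymp
  have top: "filterlim q at_top sequentially"
    if "(\<lambda>n. real (q n) / sqrt (real n)) \<longlonglongrightarrow> l" "0 < l" for q :: "nat \<Rightarrow> nat" and l
  proof -
    have *: "filterlim (\<lambda>n. real (q n) / sqrt (real n) * sqrt (real n)) at_top sequentially"
      by (rule filterlim_tendsto_pos_mult_at_top[OF that sqrt_top])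
    have "\<forall>\<^sub>F n in sequentially. real (q n) / sqrt (real n) * sqrt (real n) = real (q n)"
      by (rule eventually_mono[OF eventually_gt_at_top[of 0]]) simp
    from filterlim_cong[OF refl refl this] * have "filterlim (\<lambda>n. real (q n)) at_top sequentially"
      by (rule iffD1)
    then show ?thesis by (simp add: filterlim_sequentially_iff_filterlim_real)
  qed
  show "filterlim p at_top sequentially" by (rule top[OF p \<eta>])
  show "filterlim k at_top sequentially" using \<eta> by (intro top[OF k]) (simp add: add_pos_pos)
  have g_top: "filterlim g at_top sequentially" using \<eta> by (intro top[OF g]) simp
  \<comment> \<open>The number of blocks and the gap length are of the same order
    \<open>sqrt n\<close>. Writing \<open>k * \<beta> g\<close> in this way makes
    \<open>\<beta>_small\<close> applicable along \<open>g\<close>.\<close>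
  have "(\<lambda>n. (real (k n) / sqrt (real n)) * (real (g n) * \<beta> (g n)) / (real (g n) / sqrt (real n)))
      \<longlonglongrightarrow> (1 / (\<eta> + \<eta>\<^sup>2)) * 0 / \<eta>\<^sup>2"
    using \<eta> by (intro tendsto_divide tendsto_mult k g filterlim_compose[OF \<beta>_small g_top]) simp
  then have "(\<lambda>n. (real (k n) / sqrt (real n)) * (real (g n) * \<beta> (g n)) / (real (g n) / sqrt (real n)))
      \<longlonglongrightarrow> 0" by simp
  then show "(\<lambda>n. real (k n) * \<beta> (g n)) \<longlonglongrightarrow> 0"
  proof (rule Lim_transform_eventually)
    have "\<forall>\<^sub>F n in sequentially. 0 < g n \<and> 0 < n"
      by (intro eventually_conj eventually_gt_at_top eventually_compose_filterlim[OF _ g_top])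
    then show "\<forall>\<^sub>F n in sequentially. (real (k n) / sqrt (real n)) * (real (g n) * \<beta> (g n)) / (real (g n) / sqrt (real n))
        = real (k n) * \<beta> (g n)"
      by (rule eventually_mono) simp
  qed
qed

end

context window_observable
begin

theorem char_tendsto:
  "(\<lambda>n. wexp w (n + m - 1) (\<lambda>u. iexp (t / sqrt (real n) * (\<Sum>i<n. X i u))))
    \<longlonglongrightarrow> of_real (exp (- (t\<^sup>2 * sigma2 / 2)))"
  (is "?\<phi> \<longlonglongrightarrow> of_real ?E")
proof (rule LIMSEQ_I)
  fix e :: real assume e: "0 < e"
  \<comment> \<open>\<open>D\<close> is the limit of the total error as \<open>n\<close> grows with
    \<eta> fixed: \<open>r\<close> is the limiting fraction of windows inside blocks,
    \<open>q\<close> the limit of \<open>k * p\<^sup>2 / n powr (3/2)\<close>, and the two zeros are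
    the limits of \<open>k * \<beta> g\<close> and \<open>k * y\<^sup>2\<close>. As \<eta> tends to
    0, \<open>r\<close> tends to 1 and \<open>q\<close> to 0, where \<open>D\<close>
    vanishes.\<close>
  define D where "D r q = \<bar>t\<bar> * sqrt (K * (1 - r)) + 0 + (\<bar>t\<bar> ^ 3 * K / 6 * q + 0)
      + \<bar>exp (- (t\<^sup>2 / 2 * r * sigma2)) - ?E\<bar>" for r q :: real
  have D: "((\<lambda>\<eta>. D (r \<eta>) (q \<eta>)) \<longlongrightarrow> D 1 0) F" if "(r \<longlongrightarrow> 1) F" "(q \<longlongrightarrow> 0) F"
    for r q :: "real \<Rightarrow> real" and F
    unfolding D_def by (intro tendsto_intros that)
  have "((\<lambda>\<eta>. D (1 / (\<eta> + \<eta>\<^sup>2) * \<eta>) (1 / (\<eta> + \<eta>\<^sup>2) * \<eta>\<^sup>2)) \<longlongrightarrow> D 1 0) (at_right 0)"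
    by (rule D; real_asymp)
  moreover have "D 1 0 < e" using e by (simp add: D_def)
  ultimately have "\<forall>\<^sub>F \<eta> in at_right 0. D (1 / (\<eta> + \<eta>\<^sup>2) * \<eta>) (1 / (\<eta> + \<eta>\<^sup>2) * \<eta>\<^sup>2) < e"
    by (rule order_tendstoD(2))
  from eventually_happens'[OF trivial_limit_at_right_real eventually_conj[OF eventually_at_right_less this]]
  obtain \<eta> :: real where \<eta>: "0 < \<eta>" "D (1 / (\<eta> + \<eta>\<^sup>2) * \<eta>) (1 / (\<eta> + \<eta>\<^sup>2) * \<eta>\<^sup>2) < e"
    by blast
  define p g k where "p n = nat \<lfloor>\<eta> * sqrt (real n)\<rfloor>" and "g n = nat \<lfloor>\<eta>\<^sup>2 * sqrt (real n)\<rfloor>"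
    and "k n = n div (g n + (p n + m))" for n
  note lims = block_limits[OF \<eta>(1), folded p_def g_def, folded k_def]
  define a where "a n = real (k n) / sqrt (real n)" for n
  define b where "b n = real (p n) / sqrt (real n)" for n
  have a: "a \<longlonglongrightarrow> 1 / (\<eta> + \<eta>\<^sup>2)" and b: "b \<longlonglongrightarrow> \<eta>"
    using lims(1,2) by (simp_all add: a_def[abs_def] b_def[abs_def])
  define y where "y n = (t / sqrt (real n))\<^sup>2 * v (p n) / 2" for n
  have ky: "(\<lambda>n. real (k n) * y n) \<longlonglongrightarrow> t\<^sup>2 / 2 * (1 / (\<eta> + \<eta>\<^sup>2) * \<eta>) * sigma2"
  proof -
    have "(\<lambda>n. t\<^sup>2 / 2 * (a n * b n) * (v (p n) / real (p n))) \<longlonglongrightarrow> t\<^sup>2 / 2 * (1 / (\<eta> + \<eta>\<^sup>2) * \<eta>) * sigma2"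
      by (intro tendsto_intros a b filterlim_compose[OF v_average lims(4)])
    then show ?thesis
    proof (rule Lim_transform_eventually)
      have "\<forall>\<^sub>F n in sequentially. 0 < p n \<and> 0 < n"
        by (intro eventually_conj eventually_gt_at_top eventually_compose_filterlim[OF _ lims(4)])
      then show "\<forall>\<^sub>F n in sequentially. t\<^sup>2 / 2 * (a n * b n) * (v (p n) / real (p n)) = real (k n) * y n"
        by (rule eventually_mono) (simp add: a_def b_def y_def power_divide mult_ac)
    qed
  qed
  have ky2: "(\<lambda>n. real (k n) * (y n)\<^sup>2) \<longlonglongrightarrow> 0"
  proof -
    have "(\<lambda>n. 1 / real (k n)) \<longlonglongrightarrow> 0"
      by (rule filterlim_compose[OF lim_1_over_n lims(5)])
    then have "(\<lambda>n. (real (k n) * y n)\<^sup>2 * (1 / real (k n))) \<longlonglongrightarrow> (t\<^sup>2 / 2 * (1 / (\<eta> + \<eta>\<^sup>2) * \<eta>) * sigma2)\<^sup>2 * 0"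
      by (intro tendsto_intros ky)
    moreover have "(real (k n) * y n)\<^sup>2 * (1 / real (k n)) = real (k n) * (y n)\<^sup>2" for n
      by (simp add: power2_eq_square)
    ultimately show ?thesis by simp
  qed
  define bound where "bound n = \<bar>t\<bar> * sqrt (K * (1 - a n * b n)) + real (k n) * \<beta> (g n)
      + (\<bar>t\<bar> ^ 3 * K / 6 * (a n * (b n)\<^sup>2) + real (k n) * (y n)\<^sup>2)
      + \<bar>exp (- (real (k n) * y n)) - ?E\<bar>" for n
  have "bound \<longlonglongrightarrow> D (1 / (\<eta> + \<eta>\<^sup>2) * \<eta>) (1 / (\<eta> + \<eta>\<^sup>2) * \<eta>\<^sup>2)"
    unfolding bound_def[abs_def] D_def
    by (intro tendsto_add tendsto_intros a b ky ky2 lims(3))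
  then have small: "\<forall>\<^sub>F n in sequentially. bound n < e" using \<eta>(2) by (rule order_tendstoD(2))
  have est: "norm (?\<phi> n - of_real ?E) \<le> bound n" if n: "0 < n" for n
  proof -
    have "k n * (g n + (p n + m)) \<le> n" by (simp add: k_def)
    from char_bound[OF this, of "t / sqrt (real n)", folded y_def]
    have "norm (?\<phi> n - of_real (exp (- (real (k n) * y n))))
      \<le> \<bar>t / sqrt (real n)\<bar> * sqrt (K * (real n - real (k n * p n))) + real (k n) * \<beta> (g n)
        + real (k n) * (\<bar>t / sqrt (real n)\<bar> ^ 3 * (real (p n))\<^sup>2 * K / 6 + (y n)\<^sup>2)" .
    also have "\<bar>t / sqrt (real n)\<bar> * sqrt (K * (real n - real (k n * p n))) = \<bar>t\<bar> * sqrt (K * (1 - a n * b n))"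
    proof -
      have "real n * (1 - a n * b n) = real n - real (k n * p n)"
        using n by (simp add: a_def b_def algebra_simps)
      then have "sqrt (K * (real n - real (k n * p n))) = sqrt (K * (1 - a n * b n)) * sqrt (real n)"
        by (simp add: mult_ac flip: real_sqrt_mult)
      then show ?thesis using n by (simp add: abs_divide)
    qed
    also have "real (k n) * (\<bar>t / sqrt (real n)\<bar> ^ 3 * (real (p n))\<^sup>2 * K / 6 + (y n)\<^sup>2)
       = \<bar>t\<bar> ^ 3 * K / 6 * (a n * (b n)\<^sup>2) + real (k n) * (y n)\<^sup>2"
      using n by (simp add: a_def b_def abs_divide power_divide power3_eq_cube power2_eq_square algebra_simps)
    finally have "norm (?\<phi> n - of_real (exp (- (real (k n) * y n)))) + norm (of_real (exp (- (real (k n) * y n))) - of_real ?E :: complex) \<le> bound n"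
      unfolding bound_def by (simp flip: of_real_diff del: of_real_exp)
    then show ?thesis
      using norm_triangle_ineq[of "?\<phi> n - of_real (exp (- (real (k n) * y n)))" "of_real (exp (- (real (k n) * y n))) - of_real ?E"]
      by simp
  qed
  have "\<forall>\<^sub>F n in sequentially. norm (?\<phi> n - of_real ?E) < e"
    by (rule eventually_mono[OF eventually_conj[OF small eventually_gt_at_top[of 0]]])
      (blast intro: le_less_trans est)
  then show "\<exists>no. \<forall>n\<ge>no. norm (?\<phi> n - of_real ?E) < e"
    by (simp add: eventually_sequentially)
qed

end

subsection \<open>Covariance under strong mixing\<close>

text \<open>The sum is the integer part of \<open>N * x\<close>, divided by
  \<open>N\<close>.\<close>

lemma sum_indicator_floor:
  fixes x :: real
  assumes "0 \<le> x" "x \<le> 1" "0 < N"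
  shows "(\<Sum>j=1..N. of_bool (real j / real N \<le> x) / real N) \<le> x"
    and "x \<le> (\<Sum>j=1..N. of_bool (real j / real N \<le> x) / real N) + 1 / real N"
proof -
  define M where "M = nat \<lfloor>real N * x\<rfloor>"
  have M: "real M \<le> real N * x" "real N * x < real M + 1"
    using assms unfolding M_def by (auto simp: of_nat_nat)
  have "real N * x \<le> real N" using assms by (simp add: mult_left_le)
  then have "M \<le> N" using M by linarith
  have "real j / real N \<le> x \<longleftrightarrow> j \<le> M" for j :: nat
  proof -
    have "real j / real N \<le> x \<longleftrightarrow> real j \<le> real N * x" using assms by (simp add: field_simps)
    also have "\<dots> \<longleftrightarrow> j \<le> M" using M by linarith
    finally show ?thesis .
  qed
  then have "(\<Sum>j=1..N. of_bool (real j / real N \<le> x) / real N) = (\<Sum>j=1..N. if j \<le> M then 1 / real N else 0)"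
    by (intro sum.cong) auto
  also have "\<dots> = (\<Sum>j\<in>{1..N} \<inter> {j. j \<le> M}. 1 / real N)"
    by (simp add: sum.If_cases)
  also have "{1..N} \<inter> {j. j \<le> M} = {1..M}" using \<open>M \<le> N\<close> by auto
  finally have eq: "(\<Sum>j=1..N. of_bool (real j / real N \<le> x) / real N) = real M / real N" by simp
  show "(\<Sum>j=1..N. of_bool (real j / real N \<le> x) / real N) \<le> x"
    unfolding eq using M assms by (simp add: field_simps)
  show "x \<le> (\<Sum>j=1..N. of_bool (real j / real N \<le> x) / real N) + 1 / real N"
    unfolding eq using M assms by (simp add: field_simps)
qed

context prob_space
begin

lemma integrable_bounded01:
  fixes X :: "'a \<Rightarrow> real"
  assumes "X \<in> borel_measurable M" "AE x in M. 0 \<le> X x \<and> X x \<le> 1"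
  shows "integrable M X"
  by (rule integrable_const_bound[of _ 1]) (use assms in auto)

text \<open>Approximate each variable by the average of the indicators of its upper level sets
  at the levels \<^term>\<open>j / N\<close>; for these averages the bound is immediate from bilinearity.\<close>

lemma covariance_le_mixing:
  fixes X Y :: "'a \<Rightarrow> real"
  assumes X: "X \<in> borel_measurable M" "\<And>x. 0 \<le> X x \<and> X x \<le> 1"
    and Y: "Y \<in> borel_measurable M" "\<And>x. 0 \<le> Y x \<and> Y x \<le> 1"
    and levels: "\<And>a b. \<bar>measure M ({x\<in>space M. a \<le> X x} \<inter> {x\<in>space M. b \<le> Y x})
        - measure M {x\<in>space M. a \<le> X x} * measure M {x\<in>space M. b \<le> Y x}\<bar> \<le> \<alpha>"
  shows "\<bar>(\<integral>x. X x * Y x \<partial>M) - (\<integral>x. X x \<partial>M) * (\<integral>x. Y x \<partial>M)\<bar> \<le> \<alpha>"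
proof -
  note [measurable] = X(1) Y(1)
  define A B where "A a = {x\<in>space M. a \<le> X x}" and "B b = {x\<in>space M. b \<le> Y x}" for a b :: real
  have [measurable]: "A a \<in> sets M" "B b \<in> sets M" for a b by (simp_all add: A_def B_def)
  \<comment> \<open>The discretisation changes the mean of the product by at most
    \<open>2 / N\<close>, and the product of the means by another \<open>2 / N\<close>.\<close>
  have bound: "\<bar>(\<integral>x. X x * Y x \<partial>M) - (\<integral>x. X x \<partial>M) * (\<integral>x. Y x \<partial>M)\<bar> \<le> \<alpha> + 4 / real N" if N: "0 < N" for N :: nat
  proof -
    define U where "U x = (\<Sum>j=1..N. indicator (A (real j / real N)) x / real N :: real)" for x
    define W where "W x = (\<Sum>j=1..N. indicator (B (real j / real N)) x / real N :: real)" for x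
    have UX: "U x \<le> X x" "X x \<le> U x + 1 / real N" if "x \<in> space M" for x
      using sum_indicator_floor[of "X x" N] X(2)[of x] N that
      by (auto simp: U_def A_def indicator_def of_bool_def)
    have WY: "W x \<le> Y x" "Y x \<le> W x + 1 / real N" if "x \<in> space M" for x
      using sum_indicator_floor[of "Y x" N] Y(2)[of x] N that
      by (auto simp: W_def B_def indicator_def of_bool_def)
    have U0: "0 \<le> U x" and W0: "0 \<le> W x" for x
      by (auto simp: U_def W_def intro!: sum_nonneg)
    have [measurable]: "U \<in> borel_measurable M" "W \<in> borel_measurable M"
      unfolding U_def[abs_def] W_def[abs_def] by measurable
    have U1: "U x \<le> 1" and W1: "W x \<le> 1" if "x \<in> space M" for x
      using UX[OF that] WY[OF that] X(2)[of x] Y(2)[of x] by auto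
    have int: "integrable M X" "integrable M Y" "integrable M U" "integrable M W"
      using X(2) Y(2) U0 U1 W0 W1 by (auto intro!: integrable_bounded01)
    have int2: "integrable M (\<lambda>x. X x * Y x)" "integrable M (\<lambda>x. U x * W x)"
      using X(2) Y(2) U0 U1 W0 W1 by (auto intro!: integrable_bounded01 mult_le_one)
    have ind: "integrable M (\<lambda>x. indicator S x / d :: real)"
        "(\<integral>x. indicator S x / d \<partial>M) = measure M S / d" if "S \<in> sets M" for S and d :: real
      using that by (auto intro!: Bochner_Integration.integrable_divide integrable_real_indicator simp: less_top[symmetric])
    have EU: "(\<integral>x. U x \<partial>M) = (\<Sum>j=1..N. measure M (A (real j / real N)) / real N)"
      and EW: "(\<integral>x. W x \<partial>M) = (\<Sum>j=1..N. measure M (B (real j / real N)) / real N)"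
      by (simp_all add: U_def W_def ind Bochner_Integration.integral_sum)
    have "U x * W x = (\<Sum>i=1..N. \<Sum>j=1..N. indicator (A (real i / real N) \<inter> B (real j / real N)) x / (real N * real N))" for x
      by (simp add: U_def W_def sum_product indicator_inter_arith)
    then have EUW: "(\<integral>x. U x * W x \<partial>M) = (\<Sum>i=1..N. \<Sum>j=1..N.
        measure M (A (real i / real N) \<inter> B (real j / real N)) / (real N * real N))"
      by (simp add: ind Bochner_Integration.integral_sum)
    have "\<bar>(\<integral>x. U x * W x \<partial>M) - (\<integral>x. U x \<partial>M) * (\<integral>x. W x \<partial>M)\<bar>
      = \<bar>\<Sum>i=1..N. \<Sum>j=1..N. (measure M (A (real i / real N) \<inter> B (real j / real N))
          - measure M (A (real i / real N)) * measure M (B (real j / real N))) / (real N * real N)\<bar>"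
      unfolding EU EW EUW sum_product by (simp add: sum_subtractf diff_divide_distrib)
    also have "\<dots> \<le> (\<Sum>i=1..N. \<Sum>j=1..N. \<alpha> / (real N * real N))"
      using levels by (intro order_trans[OF sum_abs] sum_mono)
        (auto simp: A_def B_def abs_divide intro!: divide_right_mono)
    also have "\<dots> = \<alpha>" using N by simp
    finally have 1: "\<bar>(\<integral>x. U x * W x \<partial>M) - (\<integral>x. U x \<partial>M) * (\<integral>x. W x \<partial>M)\<bar> \<le> \<alpha>" .
    have EX: "(\<integral>x. U x \<partial>M) \<le> (\<integral>x. X x \<partial>M)" "(\<integral>x. X x \<partial>M) \<le> (\<integral>x. U x \<partial>M) + 1 / real N"
      using integral_mono[of M U X] integral_mono[of M X "\<lambda>x. U x + 1 / real N"] int UX by (auto simp: prob_space)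
    have EY: "(\<integral>x. W x \<partial>M) \<le> (\<integral>x. Y x \<partial>M)" "(\<integral>x. Y x \<partial>M) \<le> (\<integral>x. W x \<partial>M) + 1 / real N"
      using integral_mono[of M W Y] integral_mono[of M Y "\<lambda>x. W x + 1 / real N"] int WY by (auto simp: prob_space)
    have diff: "0 \<le> a * b - u * w \<and> a * b - u * w \<le> 2 / real N"
      if "0 \<le> u" "u \<le> a" "a \<le> u + 1 / real N" "a \<le> 1" "0 \<le> w" "w \<le> b" "b \<le> w + 1 / real N" "b \<le> 1" for a b u w :: real
    proof
      show "0 \<le> a * b - u * w" using that mult_mono[of u a w b] by simp
      have "a * b - u * w = (a - u) * b + u * (b - w)" by (simp add: algebra_simps)
      also have "\<dots> \<le> (1 / real N) * 1 + 1 * (1 / real N)"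
        using that by (intro add_mono mult_mono) auto
      finally show "a * b - u * w \<le> 2 / real N" by simp
    qed
    have "0 \<le> (\<integral>x. X x * Y x \<partial>M) - (\<integral>x. U x * W x \<partial>M)"
      using integral_mono[OF int2(2,1)] diff[OF U0 UX _ W0 WY] X(2) Y(2) by force
    moreover have "(\<integral>x. X x * Y x \<partial>M) \<le> (\<integral>x. U x * W x + 2 / real N \<partial>M)"
    proof (rule integral_mono[OF int2(1)])
      show "integrable M (\<lambda>x. U x * W x + 2 / real N)" using int2 by simp
      show "X x * Y x \<le> U x * W x + 2 / real N" if "x \<in> space M" for x
        using diff[OF U0 UX[OF that] _ W0 WY[OF that]] X(2)[of x] Y(2)[of x] by simp
    qed
    moreover have "(\<integral>x. U x * W x + 2 / real N \<partial>M) = (\<integral>x. U x * W x \<partial>M) + 2 / real N"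
      using int2 by (simp add: prob_space)
    moreover have "0 \<le> (\<integral>x. U x \<partial>M)" "0 \<le> (\<integral>x. W x \<partial>M)"
      using U0 W0 by (simp_all add: integral_nonneg)
    moreover have "(\<integral>x. X x \<partial>M) \<le> 1" "(\<integral>x. Y x \<partial>M) \<le> 1"
      using integral_mono[of M X "\<lambda>_. 1"] integral_mono[of M Y "\<lambda>_. 1"] int X(2) Y(2) by (auto simp: prob_space)
    ultimately show ?thesis
      using 1 diff[of "\<integral>x. U x \<partial>M" "\<integral>x. X x \<partial>M" "\<integral>x. W x \<partial>M" "\<integral>x. Y x \<partial>M"] EX EY by auto
  qed
  have "(\<lambda>N. \<alpha> + 4 / real N) \<longlonglongrightarrow> \<alpha> + 0"
    by (intro tendsto_intros lim_const_over_n)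
  then show ?thesis
    by (intro LIMSEQ_le_const[of "\<lambda>N. \<alpha> + 4 / real N"]) (auto intro!: exI[of _ 1] bound)
qed

end

subsection \<open>Automata in a random environment\<close>

text \<open>The first letter is read in the environment \<open>\<theta> \<omega>\<close>, not in
  \<omega>, in accordance with \<open>qprob\<close>, whose evolution starts at time 1.\<close>

fun qc :: "('a \<Rightarrow> 'w \<Rightarrow> 'd \<Rightarrow> real) \<Rightarrow> ('a \<Rightarrow> 'd \<Rightarrow> 'd) \<Rightarrow> ('w \<Rightarrow> 'w) \<Rightarrow> 'w \<Rightarrow> 'd \<Rightarrow> 'a list \<Rightarrow> real" where
  "qc p f \<theta> \<omega> i [] = 1"
| "qc p f \<theta> \<omega> i (a # u) = p a (\<theta> \<omega>) i * qc p f \<theta> (\<theta> \<omega>) (f a i) u"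

lemma fword_Nil [simp]: "fword f [] i = i"
  and fword_Cons [simp]: "fword f (a # u) i = fword f u (f a i)"
  and fword_append: "fword f (u @ v) i = fword f v (fword f u i)"
  by (simp_all add: fword_def)

lemma qc_append:
  "qc p f \<theta> \<omega> i (u @ v) = qc p f \<theta> \<omega> i u * qc p f \<theta> ((\<theta> ^^ length u) \<omega>) (fword f u i) v"
  by (induction u arbitrary: \<omega> i) (simp_all add: funpow_swap1)

lemma qc_measurable:
  assumes "\<And>j a i. k < j \<Longrightarrow> j \<le> k + length u \<Longrightarrow> (\<lambda>\<omega>. p a ((\<theta> ^^ j) \<omega>) i) \<in> borel_measurable N"
  shows "(\<lambda>\<omega>. qc p f \<theta> ((\<theta> ^^ k) \<omega>) i u) \<in> borel_measurable N"
  using assms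
proof (induction u arbitrary: i k)
  case (Cons a u)
  have "(\<lambda>\<omega>. p a ((\<theta> ^^ Suc k) \<omega>) i * qc p f \<theta> ((\<theta> ^^ Suc k) \<omega>) (f a i) u) \<in> borel_measurable N"
    by (intro borel_measurable_times Cons.IH Cons.prems) auto
  then show ?case by simp
qed simp

lemma measurable_funpow:
  assumes "\<theta> \<in> M \<rightarrow>\<^sub>M M"
  shows "\<theta> ^^ k \<in> M \<rightarrow>\<^sub>M M"
proof (induction k)
  case (Suc k)
  show ?case using measurable_comp[OF Suc assms] by (simp add: comp_def)
qed (simp add: id_def)

lemma distr_funpow:
  assumes "\<theta> \<in> M \<rightarrow>\<^sub>M M" "distr M M \<theta> = M"
  shows "distr M M (\<theta> ^^ k) = M"
proof (induction k)
  case (Suc k)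
  have "distr M M (\<theta> ^^ Suc k) = distr (distr M M (\<theta> ^^ k)) M \<theta>"
    by (subst distr_distr) (simp_all add: assms measurable_funpow)
  then show ?case by (simp add: Suc assms comp_def)
qed (simp add: id_def)

text \<open>A finite automaton with transitions \<^term>\<open>f\<close> reads random letters: in state \<^term>\<open>i\<close>,
  and in the environment \<^term>\<open>\<theta> \<omega>\<close>, the letter \<^term>\<open>a\<close> has probability \<^term>\<open>p a (\<theta> \<omega>) i\<close>.
  The \<open>\<sigma>\<close>-algebras of \<open>Past k\<close> and \<open>Fut k\<close> carry the environments up to and from time \<open>k\<close>.\<close>

locale random_automaton = prob_space P for P :: "'w measure" +
  fixes \<theta> :: "'w \<Rightarrow> 'w"
    and p :: "'a::finite \<Rightarrow> 'w \<Rightarrow> 'd::finite \<Rightarrow> real"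
    and f :: "'a \<Rightarrow> 'd \<Rightarrow> 'd"
    and L :: nat and \<epsilon> :: real
    and Past Fut :: "nat \<Rightarrow> 'w measure"
    and \<alpha> :: "nat \<Rightarrow> real"
  assumes \<theta>_measurable: "\<theta> \<in> P \<rightarrow>\<^sub>M P"
    and \<theta>_preserving: "distr P P \<theta> = P"
    and p_measurable: "(\<lambda>\<omega>. p a \<omega> i) \<in> borel_measurable P"
    and p_nonneg: "0 \<le> p a \<omega> i"
    and p_sum: "AE \<omega> in P. \<forall>i. (\<Sum>a\<in>UNIV. p a \<omega> i) = 1"
    and L_pos: "0 < L" and \<epsilon>_pos: "0 < \<epsilon>" and \<epsilon>_le_1: "\<epsilon> \<le> 1"
    and contracting: "AE \<omega> in P. \<forall>i j h D. (\<forall>x y. \<bar>h x - h y\<bar> \<le> D) \<longrightarrow>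
        \<bar>(\<Sum>u\<in>words L. qc p f \<theta> \<omega> i u * h (fword f u i)) -
         (\<Sum>u\<in>words L. qc p f \<theta> \<omega> j u * h (fword f u j))\<bar> \<le> (1 - \<epsilon>) * D"
    and space_Past: "space (Past k) = space P" and space_Fut: "space (Fut k) = space P"
    and p_Past: "0 < j \<Longrightarrow> j \<le> k \<Longrightarrow> (\<lambda>\<omega>. p a ((\<theta> ^^ j) \<omega>) i) \<in> borel_measurable (Past k)"
    and p_Fut: "k \<le> j \<Longrightarrow> (\<lambda>\<omega>. p a ((\<theta> ^^ j) \<omega>) i) \<in> borel_measurable (Fut k)"
    and Past_Fut: "B \<in> sets (Past k) \<Longrightarrow> C \<in> sets (Fut (k + n)) \<Longrightarrow>
        \<bar>measure P (B \<inter> C) - measure P B * measure P C\<bar> \<le> \<alpha> n"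
begin

abbreviation q :: "'w \<Rightarrow> 'd \<Rightarrow> 'a list \<Rightarrow> real" where
  "q \<equiv> qc p f \<theta>"

definition ex :: "'w \<Rightarrow> nat \<Rightarrow> 'd \<Rightarrow> ('a list \<Rightarrow> real) \<Rightarrow> real" where
  "ex \<omega> n i F = (\<Sum>u\<in>words n. q \<omega> i u * F u)"

text \<open>The almost sure properties are demanded along the whole forward orbit. This makes the
  set of good environments forward invariant, so that all later estimates can be made for a single
  \<omega>.\<close>

definition good :: "'w \<Rightarrow> bool" where
  "good \<omega> \<longleftrightarrow> (\<forall>k. (\<forall>i. (\<Sum>a\<in>UNIV. p a ((\<theta> ^^ Suc k) \<omega>) i) = 1) \<and>
     (\<forall>i j h D. (\<forall>x y. \<bar>h x - h y\<bar> \<le> D) \<longrightarrow>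
        \<bar>ex ((\<theta> ^^ k) \<omega>) L i (\<lambda>u. h (fword f u i)) -
         ex ((\<theta> ^^ k) \<omega>) L j (\<lambda>u. h (fword f u j))\<bar> \<le> (1 - \<epsilon>) * D))"

lemma \<theta>_pow_measurable [measurable]: "\<theta> ^^ k \<in> P \<rightarrow>\<^sub>M P"
  by (rule measurable_funpow[OF \<theta>_measurable])

lemma distr_pow: "distr P P (\<theta> ^^ k) = P"
  by (rule distr_funpow[OF \<theta>_measurable \<theta>_preserving])

lemma AE_pow: "AE \<omega> in P. Q \<omega> \<Longrightarrow> AE \<omega> in P. Q ((\<theta> ^^ k) \<omega>)"
  by (rule AE_distrD[OF \<theta>_pow_measurable[of k]]) (simp only: distr_pow)

lemma AE_good: "AE \<omega> in P. good \<omega>"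
  unfolding good_def AE_all_countable
  using AE_pow[OF p_sum, of "Suc _"] AE_pow[OF contracting] by (auto simp: ex_def)

lemma good_pow: "good \<omega> \<Longrightarrow> good ((\<theta> ^^ k) \<omega>)"
  unfolding good_def
proof (intro allI)
  fix n assume *: "\<forall>k. (\<forall>i. (\<Sum>a\<in>UNIV. p a ((\<theta> ^^ Suc k) \<omega>) i) = 1) \<and>
     (\<forall>i j h D. (\<forall>x y. \<bar>h x - h y\<bar> \<le> D) \<longrightarrow>
        \<bar>ex ((\<theta> ^^ k) \<omega>) L i (\<lambda>u. h (fword f u i)) -
         ex ((\<theta> ^^ k) \<omega>) L j (\<lambda>u. h (fword f u j))\<bar> \<le> (1 - \<epsilon>) * D)"
  have "(\<theta> ^^ n) ((\<theta> ^^ k) \<omega>) = (\<theta> ^^ (n + k)) \<omega>" "(\<theta> ^^ Suc n) ((\<theta> ^^ k) \<omega>) = (\<theta> ^^ Suc (n + k)) \<omega>"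
    by (simp_all add: funpow_add)
  then show "(\<forall>i. (\<Sum>a\<in>UNIV. p a ((\<theta> ^^ Suc n) ((\<theta> ^^ k) \<omega>)) i) = 1) \<and>
     (\<forall>i j h D. (\<forall>x y. \<bar>h x - h y\<bar> \<le> D) \<longrightarrow>
        \<bar>ex ((\<theta> ^^ n) ((\<theta> ^^ k) \<omega>)) L i (\<lambda>u. h (fword f u i)) -
         ex ((\<theta> ^^ n) ((\<theta> ^^ k) \<omega>)) L j (\<lambda>u. h (fword f u j))\<bar> \<le> (1 - \<epsilon>) * D)"
    using *[rule_format, of "n + k"] by metis
qed

lemma q_nonneg: "0 \<le> q \<omega> i u"
  by (induction u arbitrary: \<omega> i) (simp_all add: p_nonneg)

lemma ex_cong: "(\<And>u. length u = n \<Longrightarrow> F u = G u) \<Longrightarrow> ex \<omega> n i F = ex \<omega> n i G"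
  by (simp add: ex_def)

text \<open>The Markov property: after \<open>n\<close> letters the automaton restarts from the
  state reached, in the shifted environment.\<close>

lemma ex_add:
  "ex \<omega> (n + m) i F = ex \<omega> n i (\<lambda>u. ex ((\<theta> ^^ n) \<omega>) m (fword f u i) (\<lambda>v. F (u @ v)))"
  unfolding ex_def sum_words_add sum_distrib_left
  by (intro sum.cong) (auto simp: qc_append mult.assoc)

lemma ex_mult_right: "ex \<omega> n i (\<lambda>u. F u * c) = ex \<omega> n i F * c"
  by (simp add: ex_def sum_distrib_right mult.assoc)

lemma ex_mult_left: "ex \<omega> n i (\<lambda>u. c * F u) = c * ex \<omega> n i F"
  by (simp add: ex_def sum_distrib_left mult_ac)

lemma ex_const: "good \<omega> \<Longrightarrow> ex \<omega> n i (\<lambda>_. c) = c"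
proof (induction n arbitrary: \<omega> i)
  case (Suc n)
  have "good (\<theta> \<omega>)" using good_pow[OF Suc.prems, of 1] by simp
  moreover have "ex \<omega> (Suc n) i (\<lambda>_. c) = (\<Sum>a\<in>UNIV. p a (\<theta> \<omega>) i * ex (\<theta> \<omega>) n (f a i) (\<lambda>_. c))"
    unfolding ex_def sum_words_Suc by (simp add: sum_distrib_left mult.assoc)
  moreover have "(\<Sum>a\<in>UNIV. p a (\<theta> \<omega>) i) = 1"
    using Suc.prems[unfolded good_def, rule_format, of 0] by simp
  ultimately show ?case using Suc.IH by (simp flip: sum_distrib_right)
qed (simp add: ex_def)

lemma ex_mono: "(\<And>u. length u = n \<Longrightarrow> F u \<le> G u) \<Longrightarrow> ex \<omega> n i F \<le> ex \<omega> n i G"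
  unfolding ex_def by (intro sum_mono mult_left_mono q_nonneg) auto

lemma ex_unit:
  assumes "good \<omega>" "\<And>u. 0 \<le> F u \<and> F u \<le> 1"
  shows "0 \<le> ex \<omega> n i F \<and> ex \<omega> n i F \<le> 1"
  using ex_mono[of n "\<lambda>_. 0" F \<omega> i] ex_mono[of n F "\<lambda>_. 1" \<omega> i] ex_const[OF assms(1)] assms(2) by simp

lemma ex_close:
  assumes "good \<omega>" "\<And>u. length u = n \<Longrightarrow> \<bar>F u - G u\<bar> \<le> d"
  shows "\<bar>ex \<omega> n i F - ex \<omega> n i G\<bar> \<le> d"
proof -
  have "F u \<le> G u + d" "G u \<le> F u + d" if "length u = n" for u
    using assms(2)[OF that] by auto
  then have "ex \<omega> n i F \<le> ex \<omega> n i (\<lambda>u. G u + d)" "ex \<omega> n i G \<le> ex \<omega> n i (\<lambda>u. F u + d)"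
    by (simp_all add: ex_mono)
  moreover have "ex \<omega> n i (\<lambda>u. H u + d) = ex \<omega> n i H + d" for H
    using ex_const[OF assms(1), of n i d] by (simp add: ex_def distrib_left sum.distrib)
  ultimately show ?thesis by simp
qed

text \<open>Conditioning on the first \<open>L\<close> letters turns the remaining expectation into
  a function of the state reached. By induction its oscillation is at most
  \<open>(1 - \<epsilon>) ^ k * D\<close>, and the first \<open>L\<close> letters contribute one
  more factor.\<close>

lemma contraction:
  assumes "good \<omega>" "\<And>x y. \<bar>h x - h y\<bar> \<le> D"
  shows "\<bar>ex \<omega> (L * k) i (\<lambda>u. h (fword f u i)) - ex \<omega> (L * k) j (\<lambda>u. h (fword f u j))\<bar> \<le> (1 - \<epsilon>) ^ k * D"
  using assms(1)
proof (induction k arbitrary: \<omega> i j)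
  case 0
  then show ?case using assms(2) by (simp add: ex_def)
next
  case (Suc k)
  define h' where "h' x = ex ((\<theta> ^^ L) \<omega>) (L * k) x (\<lambda>v. h (fword f v x))" for x
  have "ex \<omega> (L * Suc k) x (\<lambda>u. h (fword f u x)) = ex \<omega> L x (\<lambda>u. h' (fword f u x))" for x
    by (simp add: ex_add h'_def fword_append)
  moreover have "\<forall>x y. \<bar>h' x - h' y\<bar> \<le> (1 - \<epsilon>) ^ k * D"
    unfolding h'_def using Suc.IH[OF good_pow[OF Suc.prems]] by blast
  ultimately show ?case
    using Suc.prems[unfolded good_def, rule_format, of 0] by (simp add: mult.assoc)
qed

lemma contraction_unit:
  assumes "good \<omega>" "\<And>x. 0 \<le> h x \<and> h x \<le> 1"
  shows "\<bar>ex \<omega> (L * k) i (\<lambda>u. h (fword f u i)) - ex \<omega> (L * k) j (\<lambda>u. h (fword f u j))\<bar> \<le> (1 - \<epsilon>) ^ k"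
proof -
  have "\<bar>h x - h y\<bar> \<le> 1" for x y using assms(2)[of x] assms(2)[of y] by linarith
  then show ?thesis using contraction[OF assms(1), of h 1] by simp
qed

lemma ex_measurable:
  assumes "\<And>j a i. k < j \<Longrightarrow> j \<le> k + n \<Longrightarrow> (\<lambda>\<omega>. p a ((\<theta> ^^ j) \<omega>) i) \<in> borel_measurable N"
  shows "(\<lambda>\<omega>. ex ((\<theta> ^^ k) \<omega>) n i F) \<in> borel_measurable N"
  unfolding ex_def
  by (intro borel_measurable_sum borel_measurable_times borel_measurable_const qc_measurable) (auto intro: assms)

lemma p_pow_measurable: "(\<lambda>\<omega>. p a ((\<theta> ^^ j) \<omega>) i) \<in> borel_measurable P"
  using measurable_comp[OF \<theta>_pow_measurable p_measurable] by (simp add: comp_def)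

end

section \<open>Annealed laws of the automaton and their mixing\<close>

context random_automaton
begin

text \<open>The initial distribution may depend on the entire environment; only measurability with
  respect to \<open>P\<close> is required.\<close>

definition init :: "('w \<Rightarrow> 'd \<Rightarrow> real) \<Rightarrow> bool" where
  "init \<pi> \<longleftrightarrow> (\<forall>i. (\<lambda>\<omega>. \<pi> \<omega> i) \<in> borel_measurable P) \<and>
     (\<forall>\<omega>\<in>space P. (\<forall>i. 0 \<le> \<pi> \<omega> i) \<and> (\<Sum>i\<in>UNIV. \<pi> \<omega> i) = 1)"

definition law :: "('w \<Rightarrow> 'd \<Rightarrow> real) \<Rightarrow> 'a list \<Rightarrow> real" where
  "law \<pi> u = (\<integral>\<omega>. (\<Sum>i\<in>UNIV. \<pi> \<omega> i * q \<omega> i u) \<partial>P)"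

lemma AE_good_space: "(\<And>\<omega>. good \<omega> \<Longrightarrow> \<omega> \<in> space P \<Longrightarrow> Q \<omega>) \<Longrightarrow> AE \<omega> in P. Q \<omega>"
  using AE_good AE_space by eventually_elim blast

lemma ex_measurable_P [measurable]: "(\<lambda>\<omega>. ex \<omega> n i F) \<in> borel_measurable P"
  using ex_measurable[of 0 n P i F] p_pow_measurable by simp

lemma q_measurable [measurable]: "(\<lambda>\<omega>. q \<omega> i u) \<in> borel_measurable P"
  using qc_measurable[of 0 u p \<theta> P f i] p_pow_measurable by simp

lemma q_le_1: "good \<omega> \<Longrightarrow> q \<omega> i u \<le> 1"
  using ex_unit[of \<omega> "indicator {u}" "length u" i] by (simp add: ex_def sum.If_cases indicator_def)

context
  fixes \<pi> assumes \<pi>: "init \<pi>"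
begin

lemma \<pi>_measurable [measurable]: "(\<lambda>\<omega>. \<pi> \<omega> i) \<in> borel_measurable P"
  using \<pi> by (simp add: init_def)

lemma \<pi>_nonneg: "\<omega> \<in> space P \<Longrightarrow> 0 \<le> \<pi> \<omega> i"
  and \<pi>_sum: "\<omega> \<in> space P \<Longrightarrow> (\<Sum>i\<in>UNIV. \<pi> \<omega> i) = 1"
  using \<pi> by (auto simp: init_def)

lemma \<pi>_average_close:
  assumes "\<omega> \<in> space P" "\<And>i. \<bar>x i - y\<bar> \<le> d"
  shows "\<bar>(\<Sum>i\<in>UNIV. \<pi> \<omega> i * x i) - y\<bar> \<le> d"
proof -
  have "(\<Sum>i\<in>UNIV. \<pi> \<omega> i * x i) - y = (\<Sum>i\<in>UNIV. \<pi> \<omega> i * (x i - y))"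
    using \<pi>_sum[OF assms(1)] by (simp add: right_diff_distrib sum_subtractf flip: sum_distrib_right)
  also have "\<bar>\<dots>\<bar> \<le> (\<Sum>i\<in>UNIV. \<pi> \<omega> i * d)"
    using assms \<pi>_nonneg by (intro order_trans[OF sum_abs] sum_mono) (auto simp: abs_mult intro!: mult_left_mono)
  also have "\<dots> = d" using \<pi>_sum[OF assms(1)] by (simp flip: sum_distrib_right)
  finally show ?thesis .
qed

lemma integrable_law: "integrable P (\<lambda>\<omega>. \<Sum>i\<in>UNIV. \<pi> \<omega> i * q \<omega> i u)"
proof (rule integrable_const_bound[of _ 1])
  show "AE \<omega> in P. norm (\<Sum>i\<in>UNIV. \<pi> \<omega> i * q \<omega> i u) \<le> 1"
    using \<pi>_average_close[of _ "\<lambda>i. q _ i u" 0 1] q_le_1 q_nonneg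
    by (intro AE_good_space) (simp add: abs_of_nonneg)
qed measurable

lemma wexp_law: "wexp (law \<pi>) n F = (\<integral>\<omega>. (\<Sum>i\<in>UNIV. \<pi> \<omega> i * ex \<omega> n i F) \<partial>P)"
proof -
  have "(\<Sum>i\<in>UNIV. \<pi> \<omega> i * ex \<omega> n i F) = (\<Sum>u\<in>words n. (\<Sum>i\<in>UNIV. \<pi> \<omega> i * q \<omega> i u) * F u)" for \<omega>
    unfolding ex_def sum_distrib_left sum_distrib_right by (subst sum.swap) (simp add: mult.assoc)
  then show ?thesis
    by (simp add: wexp_def law_def integrable_law)
qed

text \<open>The estimate holds for every starting state, so it survives averaging over
  \<open>\<pi> \<omega>\<close>. Since \<open>Z\<close> does not involve the starting state, this is
  how the initial distribution gets eliminated.\<close>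

lemma wexp_law_close:
  assumes "\<And>\<omega> i. good \<omega> \<Longrightarrow> \<bar>ex \<omega> n i F - Z \<omega>\<bar> \<le> d" and "integrable P Z"
  shows "\<bar>wexp (law \<pi>) n F - (\<integral>\<omega>. Z \<omega> \<partial>P)\<bar> \<le> d"
proof -
  define Y where "Y \<omega> = (\<Sum>i\<in>UNIV. \<pi> \<omega> i * ex \<omega> n i F)" for \<omega>
  have close: "AE \<omega> in P. \<bar>Y \<omega> - Z \<omega>\<bar> \<le> d"
    unfolding Y_def using assms(1) by (intro AE_good_space \<pi>_average_close) auto
  have [measurable]: "Y \<in> borel_measurable P" unfolding Y_def[abs_def] by measurable
  have [measurable]: "Z \<in> borel_measurable P" using assms(2) by simp
  have YZ: "integrable P (\<lambda>\<omega>. Y \<omega> - Z \<omega>)"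
    by (rule integrable_const_bound[of _ d]) (use close in auto)
  have "integrable P (\<lambda>\<omega>. (Y \<omega> - Z \<omega>) + Z \<omega>)"
    by (intro Bochner_Integration.integrable_add YZ assms(2))
  then have Y: "integrable P Y" by simp
  have "wexp (law \<pi>) n F - (\<integral>\<omega>. Z \<omega> \<partial>P) = (\<integral>\<omega>. Y \<omega> - Z \<omega> \<partial>P)"
    using Y assms(2) by (simp add: wexp_law Y_def[symmetric])
  also have "\<bar>\<dots>\<bar> \<le> (\<integral>\<omega>. \<bar>Y \<omega> - Z \<omega>\<bar> \<partial>P)" by (rule integral_abs_bound)
  also have "\<dots> \<le> (\<integral>\<omega>. d \<partial>P)"
    using close YZ by (intro integral_mono_AE) auto
  finally show ?thesis by (simp add: prob_space)
qed

lemma word_law_law: "word_law (law \<pi>)"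
proof
  show "0 \<le> law \<pi> u" for u
    unfolding law_def by (intro integral_nonneg_AE AE_I2 sum_nonneg mult_nonneg_nonneg \<pi>_nonneg q_nonneg) auto
  show "law \<pi> [] = 1"
    unfolding law_def using \<pi>_sum by (simp add: prob_space cong: Bochner_Integration.integral_cong)
  fix u
  have "(\<Sum>a\<in>UNIV. law \<pi> (u @ [a])) = (\<integral>\<omega>. (\<Sum>a\<in>UNIV. \<Sum>i\<in>UNIV. \<pi> \<omega> i * q \<omega> i (u @ [a])) \<partial>P)"
    unfolding law_def by (simp add: integrable_law)
  also have "\<dots> = law \<pi> u"
    unfolding law_def
  proof (intro integral_cong_AE AE_good_space)
    fix \<omega> assume "good \<omega>"
    then have "(\<Sum>a\<in>UNIV. p a (\<theta> ((\<theta> ^^ length u) \<omega>)) i) = 1" for i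
      unfolding good_def by simp
    then have "(\<Sum>a\<in>UNIV. q \<omega> i (u @ [a])) = q \<omega> i u" for i
      by (simp add: qc_append flip: sum_distrib_left)
    then show "(\<Sum>a\<in>UNIV. \<Sum>i\<in>UNIV. \<pi> \<omega> i * q \<omega> i (u @ [a])) = (\<Sum>i\<in>UNIV. \<pi> \<omega> i * q \<omega> i u)"
      by (subst sum.swap) (simp flip: sum_distrib_left)
  qed measurable
  finally show "(\<Sum>a\<in>UNIV. law \<pi> (u @ [a])) = law \<pi> u" .
qed

text \<open>The assumption is the stationarity equation for the state distribution. It turns the sum
  over the first letter into the integrand of \<open>law \<pi> u\<close> taken at
  \<open>\<theta> \<omega>\<close>, and \<theta> preserves \<open>P\<close>.\<close>

lemma stationary_law:
  assumes "AE \<omega> in P. \<forall>j. \<pi> (\<theta> \<omega>) j = (\<Sum>a\<in>UNIV. \<Sum>i\<in>UNIV. if f a i = j then p a (\<theta> \<omega>) i * \<pi> \<omega> i else 0)"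
  shows "stationary_word_law (law \<pi>)"
proof -
  interpret word_law "law \<pi>" by (rule word_law_law)
  have "(\<Sum>a\<in>UNIV. law \<pi> (a # u)) = law \<pi> u" for u
  proof -
    have "(\<Sum>a\<in>UNIV. law \<pi> (a # u)) = (\<integral>\<omega>. (\<Sum>a\<in>UNIV. \<Sum>i\<in>UNIV. \<pi> \<omega> i * q \<omega> i (a # u)) \<partial>P)"
      unfolding law_def by (subst Bochner_Integration.integral_sum) (rule integrable_law, simp)
    also have "\<dots> = (\<integral>\<omega>. (\<Sum>j\<in>UNIV. \<pi> (\<theta> \<omega>) j * q (\<theta> \<omega>) j u) \<partial>P)"
    proof (rule integral_cong_AE)
      show "AE \<omega> in P. (\<Sum>a\<in>UNIV. \<Sum>i\<in>UNIV. \<pi> \<omega> i * q \<omega> i (a # u)) = (\<Sum>j\<in>UNIV. \<pi> (\<theta> \<omega>) j * q (\<theta> \<omega>) j u)"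
        using assms
      proof eventually_elim
        fix \<omega> assume *: "\<forall>j. \<pi> (\<theta> \<omega>) j = (\<Sum>a\<in>UNIV. \<Sum>i\<in>UNIV. if f a i = j then p a (\<theta> \<omega>) i * \<pi> \<omega> i else 0)"
        have "(\<Sum>j\<in>UNIV. \<pi> (\<theta> \<omega>) j * q (\<theta> \<omega>) j u)
          = (\<Sum>j\<in>UNIV. \<Sum>a\<in>UNIV. \<Sum>i\<in>UNIV. if f a i = j then p a (\<theta> \<omega>) i * \<pi> \<omega> i * q (\<theta> \<omega>) j u else 0)"
          unfolding *[rule_format] sum_distrib_right by (intro sum.cong refl) simp
        also have "\<dots> = (\<Sum>a\<in>UNIV. \<Sum>j\<in>UNIV. \<Sum>i\<in>UNIV. if f a i = j then p a (\<theta> \<omega>) i * \<pi> \<omega> i * q (\<theta> \<omega>) j u else 0)"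
          by (rule sum.swap)
        also have "\<dots> = (\<Sum>a\<in>UNIV. \<Sum>i\<in>UNIV. \<Sum>j\<in>UNIV. if f a i = j then p a (\<theta> \<omega>) i * \<pi> \<omega> i * q (\<theta> \<omega>) j u else 0)"
          by (rule sum.cong[OF refl], rule sum.swap)
        finally show "(\<Sum>a\<in>UNIV. \<Sum>i\<in>UNIV. \<pi> \<omega> i * q \<omega> i (a # u)) = (\<Sum>j\<in>UNIV. \<pi> (\<theta> \<omega>) j * q (\<theta> \<omega>) j u)"
          by (simp add: mult_ac)
      qed
      show "(\<lambda>\<omega>. \<Sum>j\<in>UNIV. \<pi> (\<theta> \<omega>) j * q (\<theta> \<omega>) j u) \<in> borel_measurable P"
        by (rule measurable_compose[OF \<theta>_measurable]) measurable
      show "(\<lambda>\<omega>. \<Sum>a\<in>UNIV. \<Sum>i\<in>UNIV. \<pi> \<omega> i * q \<omega> i (a # u)) \<in> borel_measurable P"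
        by measurable
    qed
    also have "\<dots> = (\<integral>\<omega>. (\<Sum>j\<in>UNIV. \<pi> \<omega> j * q \<omega> j u) \<partial>distr P P \<theta>)"
      by (subst integral_distr) (simp_all add: \<theta>_measurable)
    finally show ?thesis by (simp add: \<theta>_preserving law_def)
  qed
  then show ?thesis by unfold_locales
qed

end

lemma ex_take: "good \<omega> \<Longrightarrow> ex \<omega> (n + k) i (\<lambda>u. F (take n u)) = ex \<omega> n i F"
  unfolding ex_add by (rule ex_cong) (simp add: ex_const[OF good_pow])

text \<open>The expectation of what follows the first \<open>L * k\<close> letters is a function of
  the state then reached, with values in the unit interval, so the contraction applies to
  it.\<close>

lemma forget_start:
  assumes "good \<omega>" "\<And>u. 0 \<le> F u \<and> F u \<le> 1"
  shows "\<bar>ex \<omega> (L * k + n) i (\<lambda>u. F (drop (L * k) u)) - ex \<omega> (L * k + n) j (\<lambda>u. F (drop (L * k) u))\<bar>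
    \<le> (1 - \<epsilon>) ^ k"
proof -
  have "ex \<omega> (L * k + n) x (\<lambda>u. F (drop (L * k) u))
    = ex \<omega> (L * k) x (\<lambda>u. ex ((\<theta> ^^ (L * k)) \<omega>) n (fword f u x) F)" for x
    unfolding ex_add by (intro ex_cong) auto
  then show ?thesis
    using contraction_unit[OF assms(1), of "\<lambda>x. ex ((\<theta> ^^ (L * k)) \<omega>) n x F"] ex_unit[OF good_pow[OF assms(1)] assms(2)]
    by simp
qed

text \<open>The word consists of \<open>L * k\<close> letters that forget the start,
  \<open>n\<close> letters for \<open>F\<close>, \<open>h\<close> idle letters, \<open>L * k\<close>
  letters that forget the state reached, and \<open>l\<close> letters for \<open>G\<close>. One
  error comes from restarting the right part in \<open>j\<close>, the other from starting the left
  part in \<open>j\<close> instead of \<open>i\<close>.\<close>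

lemma factorisation:
  assumes good: "good \<omega>" and F: "\<And>u. 0 \<le> F u \<and> F u \<le> 1" and G: "\<And>u. 0 \<le> G u \<and> G u \<le> 1"
  shows "\<bar>ex \<omega> (L * k + n + h + (L * k + l)) i (\<lambda>u. F (take n (drop (L * k) u)) * G (drop (L * k + n + h + L * k) u))
     - ex \<omega> (L * k + n) j (\<lambda>u. F (drop (L * k) u))
       * ex ((\<theta> ^^ (L * k + n + h)) \<omega>) (L * k + l) j (\<lambda>u. G (drop (L * k) u))\<bar> \<le> 2 * (1 - \<epsilon>) ^ k"
proof -
  define N where "N = L * k + n + h"
  define KK where "KK x = ex ((\<theta> ^^ N) \<omega>) (L * k + l) x (\<lambda>u. G (drop (L * k) u))" for x
  define A where "A x = ex \<omega> N x (\<lambda>u. F (take n (drop (L * k) u)))" for x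
  have KK: "0 \<le> KK j" "KK j \<le> 1" unfolding KK_def using ex_unit[OF good_pow[OF good]] G by auto
  have close: "\<bar>KK x - KK j\<bar> \<le> (1 - \<epsilon>) ^ k" for x
    unfolding KK_def by (rule forget_start[OF good_pow[OF good] G])
  have "ex \<omega> (N + (L * k + l)) i (\<lambda>u. F (take n (drop (L * k) u)) * G (drop (N + L * k) u))
      = ex \<omega> N i (\<lambda>u. F (take n (drop (L * k) u)) * KK (fword f u i))"
    unfolding ex_add[of _ N] KK_def ex_mult_left[symmetric]
    by (intro ex_cong) (simp add: N_def)
  moreover have "\<bar>ex \<omega> N i (\<lambda>u. F (take n (drop (L * k) u)) * KK (fword f u i))
      - ex \<omega> N i (\<lambda>u. F (take n (drop (L * k) u)) * KK j)\<bar> \<le> (1 - \<epsilon>) ^ k"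
  proof (rule ex_close[OF good])
    fix u :: "'a list"
    have "\<bar>F (take n (drop (L * k) u)) * (KK (fword f u i) - KK j)\<bar> \<le> 1 * (1 - \<epsilon>) ^ k"
      unfolding abs_mult using F close by (intro mult_mono) auto
    then show "\<bar>F (take n (drop (L * k) u)) * KK (fword f u i) - F (take n (drop (L * k) u)) * KK j\<bar> \<le> (1 - \<epsilon>) ^ k"
      by (simp add: right_diff_distrib)
  qed
  moreover have "ex \<omega> N i (\<lambda>u. F (take n (drop (L * k) u)) * KK j) = A i * KK j"
    unfolding ex_mult_right A_def ..
  moreover have "\<bar>A i * KK j - A j * KK j\<bar> \<le> (1 - \<epsilon>) ^ k"
  proof -
    have "\<bar>A i - A j\<bar> \<le> (1 - \<epsilon>) ^ k"
      unfolding A_def N_def add.assoc by (rule forget_start[OF good]) (rule F)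
    then have "\<bar>A i - A j\<bar> * \<bar>KK j\<bar> \<le> (1 - \<epsilon>) ^ k * 1" using KK by (intro mult_mono) auto
    then show ?thesis by (simp add: left_diff_distrib flip: abs_mult)
  qed
  moreover have "A j = ex \<omega> (L * k + n) j (\<lambda>u. F (drop (L * k) u))"
    using ex_take[OF good, of "L * k + n" h j "\<lambda>u. F (drop (L * k) u)"] by (simp add: A_def N_def drop_take)
  ultimately show ?thesis by (simp add: N_def[symmetric] KK_def[symmetric])
qed

text \<open>Stationarity allows \<open>L * k\<close> letters to be prepended, so that
  \<open>\<pi> \<omega>\<close> can be replaced by a fixed state. Of the four errors
  \<open>(1 - \<epsilon>) ^ k\<close>, two come from the factorisation and one from each of the
  separate expectations.\<close>

lemma mixing_unit:
  assumes \<pi>: "init \<pi>" and stat: "stationary_word_law (law \<pi>)"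
    and F: "\<And>u. 0 \<le> F u \<and> F u \<le> 1" and G: "\<And>u. 0 \<le> G u \<and> G u \<le> 1"
    and g: "g = h + L * k"
  shows "\<bar>wexp (law \<pi>) (n + g + l) (\<lambda>u. F (take n u) * G (drop (n + g) u))
      - wexp (law \<pi>) n F * wexp (law \<pi>) l G\<bar> \<le> \<alpha> (Suc h) + 4 * (1 - \<epsilon>) ^ k"
proof -
  interpret stationary_word_law "law \<pi>" by (rule stat)
  define N where "N = L * k + n + h"
  fix j :: 'd
  define J where "J \<omega> = ex \<omega> (L * k + n) j (\<lambda>u. F (drop (L * k) u))" for \<omega>
  define KK where "KK \<omega> = ex ((\<theta> ^^ N) \<omega>) (L * k + l) j (\<lambda>u. G (drop (L * k) u))" for \<omega>
  \<comment> \<open>With the fixed start \<open>j\<close>, only the environments at times 1 to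
    \<open>L * k + n\<close> are read; a start from \<open>\<pi> \<omega>\<close> could involve all
    of them.\<close>
  have J_Past: "J \<in> borel_measurable (Past (L * k + n))"
    unfolding J_def using ex_measurable[of 0 "L * k + n" "Past (L * k + n)"] p_Past by simp
  \<comment> \<open>The first letter after position \<open>N\<close> is read at time
    \<open>N + 1\<close>, so the two stretches of environment are \<open>Suc h\<close>
    apart.\<close>
  have KK_Fut: "KK \<in> borel_measurable (Fut (L * k + n + Suc h))"
    unfolding KK_def by (rule ex_measurable) (simp add: p_Fut N_def)
  have [measurable]: "J \<in> borel_measurable P" unfolding J_def by measurable
  have [measurable]: "KK \<in> borel_measurable P"
    unfolding KK_def by (rule ex_measurable) (rule p_pow_measurable)
  have J01: "0 \<le> J \<omega> \<and> J \<omega> \<le> 1" and K01: "0 \<le> KK \<omega> \<and> KK \<omega> \<le> 1" if "good \<omega>" for \<omega>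
    unfolding J_def KK_def using ex_unit[OF that] ex_unit[OF good_pow[OF that]] F G by auto
  have JK01: "0 \<le> J \<omega> * KK \<omega> \<and> J \<omega> * KK \<omega> \<le> 1" if "good \<omega>" for \<omega>
    using J01[OF that] K01[OF that] by (simp add: mult_le_one)
  have int: "integrable P J" "integrable P KK" "integrable P (\<lambda>\<omega>. J \<omega> * KK \<omega>)"
    by (auto intro!: integrable_bounded01 AE_good_space J01 K01 JK01)
  have 1: "\<bar>wexp (law \<pi>) (n + g + l) (\<lambda>u. F (take n u) * G (drop (n + g) u)) - (\<integral>\<omega>. J \<omega> * KK \<omega> \<partial>P)\<bar> \<le> 2 * (1 - \<epsilon>) ^ k"
  proof -
    have "wexp (law \<pi>) (n + g + l) (\<lambda>u. F (take n u) * G (drop (n + g) u))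
      = wexp (law \<pi>) (L * k + (n + g + l)) (\<lambda>u. F (take n (drop (L * k) u)) * G (drop (n + g) (drop (L * k) u)))"
      by (rule wexp_drop[symmetric])
    also have "\<dots> = wexp (law \<pi>) (L * k + n + h + (L * k + l)) (\<lambda>u. F (take n (drop (L * k) u)) * G (drop (L * k + n + h + L * k) u))"
      by (simp add: g add_ac)
    finally show ?thesis
      using wexp_law_close[OF \<pi> factorisation[OF _ F G] int(3)[unfolded J_def KK_def N_def]]
      by (simp add: J_def KK_def N_def)
  qed
  have 2: "\<bar>wexp (law \<pi>) n F - (\<integral>\<omega>. J \<omega> \<partial>P)\<bar> \<le> (1 - \<epsilon>) ^ k"
    unfolding wexp_drop[symmetric, of n F "L * k"]
    by (rule wexp_law_close[OF \<pi> _ int(1)]) (unfold J_def, rule forget_start[OF _ F])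
  have 3: "\<bar>wexp (law \<pi>) l G - (\<integral>\<omega>. KK \<omega> \<partial>P)\<bar> \<le> (1 - \<epsilon>) ^ k"
    unfolding wexp_drop[symmetric, of l G "N + L * k"]
  proof (rule wexp_law_close[OF \<pi> _ int(2)])
    fix \<omega> i assume good: "good \<omega>"
    have "ex \<omega> (N + L * k + l) i (\<lambda>u. G (drop (N + L * k) u))
      = ex \<omega> N i (\<lambda>u. ex ((\<theta> ^^ N) \<omega>) (L * k + l) (fword f u i) (\<lambda>v. G (drop (L * k) v)))"
      unfolding add.assoc ex_add[of _ N] by (intro ex_cong) simp
    moreover have "\<bar>ex \<omega> N i (\<lambda>u. ex ((\<theta> ^^ N) \<omega>) (L * k + l) (fword f u i) (\<lambda>v. G (drop (L * k) v))) - ex \<omega> N i (\<lambda>_. KK \<omega>)\<bar>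
        \<le> (1 - \<epsilon>) ^ k"
      unfolding KK_def by (intro ex_close[OF good] forget_start good_pow good G)
    ultimately show "\<bar>ex \<omega> (N + L * k + l) i (\<lambda>u. G (drop (N + L * k) u)) - KK \<omega>\<bar> \<le> (1 - \<epsilon>) ^ k"
      by (simp add: ex_const[OF good])
  qed
  \<comment> \<open>The bounds on \<open>J\<close> and \<open>KK\<close> are known only at good
    environments, while \<open>covariance_le_mixing\<close> asks for them everywhere. Clipping
    preserves measurability in the past and the future and changes nothing almost surely.\<close>
  define clip where "clip x = max 0 (min 1 x)" for x :: real
  have clip_eq: "clip x = x" if "0 \<le> x \<and> x \<le> 1" for x using that by (simp add: clip_def)
  have [measurable]: "clip \<in> borel_measurable borel" unfolding clip_def by measurable
  have "\<bar>(\<integral>\<omega>. clip (J \<omega>) * clip (KK \<omega>) \<partial>P) - (\<integral>\<omega>. clip (J \<omega>) \<partial>P) * (\<integral>\<omega>. clip (KK \<omega>) \<partial>P)\<bar> \<le> \<alpha> (Suc h)"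
  proof (rule covariance_le_mixing)
    fix a b
    have "{\<omega>\<in>space (Past (L * k + n)). a \<le> clip (J \<omega>)} \<in> sets (Past (L * k + n))"
      using J_Past by measurable
    moreover have "{\<omega>\<in>space (Fut (L * k + n + Suc h)). b \<le> clip (KK \<omega>)} \<in> sets (Fut (L * k + n + Suc h))"
      using KK_Fut by measurable
    ultimately show "\<bar>measure P ({\<omega>\<in>space P. a \<le> clip (J \<omega>)} \<inter> {\<omega>\<in>space P. b \<le> clip (KK \<omega>)})
      - measure P {\<omega>\<in>space P. a \<le> clip (J \<omega>)} * measure P {\<omega>\<in>space P. b \<le> clip (KK \<omega>)}\<bar> \<le> \<alpha> (Suc h)"
      using Past_Fut unfolding space_Past space_Fut by blast
  qed (auto simp: clip_def)
  moreover have "(\<integral>\<omega>. clip (J \<omega>) * clip (KK \<omega>) \<partial>P) = (\<integral>\<omega>. J \<omega> * KK \<omega> \<partial>P)"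
    "(\<integral>\<omega>. clip (J \<omega>) \<partial>P) = (\<integral>\<omega>. J \<omega> \<partial>P)" "(\<integral>\<omega>. clip (KK \<omega>) \<partial>P) = (\<integral>\<omega>. KK \<omega> \<partial>P)"
    by (intro integral_cong_AE AE_good_space; simp add: clip_eq J01 K01)+
  ultimately have 4: "\<bar>(\<integral>\<omega>. J \<omega> * KK \<omega> \<partial>P) - (\<integral>\<omega>. J \<omega> \<partial>P) * (\<integral>\<omega>. KK \<omega> \<partial>P)\<bar> \<le> \<alpha> (Suc h)"
    by simp
  define x y x' y' where "x = wexp (law \<pi>) n F" and "y = wexp (law \<pi>) l G"
    and "x' = (\<integral>\<omega>. J \<omega> \<partial>P)" and "y' = (\<integral>\<omega>. KK \<omega> \<partial>P)"
  have "\<bar>x\<bar> \<le> 1" unfolding x_def using norm_wexp_le_const[of n F 1] F by simp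
  have "\<bar>y'\<bar> \<le> 1"
  proof -
    have "norm y' \<le> (\<integral>\<omega>. norm (KK \<omega>) \<partial>P)" unfolding y'_def by simp
    also have "\<dots> \<le> (\<integral>\<omega>. 1 \<partial>P)"
      using int(2) K01 by (intro integral_mono_AE AE_good_space) (auto simp: abs_le_iff)
    finally show ?thesis by (simp add: prob_space)
  qed
  have "x' * y' - x * y = (x' - x) * y' + x * (y' - y)" by (simp add: algebra_simps)
  then have "\<bar>x' * y' - x * y\<bar> \<le> \<bar>x' - x\<bar> * \<bar>y'\<bar> + \<bar>x\<bar> * \<bar>y' - y\<bar>"
    by (simp only: abs_mult[symmetric] abs_triangle_ineq)
  also have "\<dots> \<le> (1 - \<epsilon>) ^ k * 1 + 1 * (1 - \<epsilon>) ^ k"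
    using 2 3 \<open>\<bar>x\<bar> \<le> 1\<close> \<open>\<bar>y'\<bar> \<le> 1\<close> by (intro add_mono mult_mono) (auto simp: x_def y_def x'_def y'_def abs_minus_commute)
  finally show ?thesis using 1 4 by (simp add: x_def y_def x'_def y'_def)
qed

end

section \<open>From unit-interval observables to a summable complex mixing rate\<close>

lemma summable_div:
  fixes a :: "nat \<Rightarrow> real"
  assumes "summable a" "\<And>n. 0 \<le> a n" "0 < N"
  shows "summable (\<lambda>n. a (n div N))"
proof (rule summableI_nonneg_bounded)
  show "0 \<le> a (n div N)" for n by (rule assms)
  fix n
  have "(\<Sum>i<n. a (i div N)) \<le> (\<Sum>i<n * N. a (i div N))"
    using assms by (intro sum_mono2) auto
  also have "\<dots> = (\<Sum>m<n. \<Sum>i=m * N..<m * N + N. a (i div N))"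
    by (rule sum.nat_group[symmetric])
  also have "\<dots> = (\<Sum>m<n. \<Sum>i=m * N..<m * N + N. a m)"
  proof (intro sum.cong refl)
    fix m i assume "i \<in> {m * N..<m * N + N}"
    then have "i div N = m" by (intro div_nat_eqI) (auto simp: mult.commute)
    then show "a (i div N) = a m" by simp
  qed
  also have "\<dots> = real N * (\<Sum>m<n. a m)" by (simp add: sum_distrib_left)
  also have "\<dots> \<le> real N * suminf a"
    using assms by (intro mult_left_mono sum_le_suminf) auto
  finally show "(\<Sum>i<n. a (i div N)) \<le> real N * suminf a" .
qed

text \<open>By monotonicity \<open>n * a n\<close> is at most twice the sum of the terms with index
  between \<open>n div 2\<close> and \<open>n\<close>, a Cauchy block of the series.\<close>

lemma summable_decreasing_small:
  fixes a :: "nat \<Rightarrow> real"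
  assumes "summable a" "decseq a" "\<And>n. 0 \<le> a n"
  shows "(\<lambda>n. real n * a n) \<longlonglongrightarrow> 0"
proof -
  define S where "S n = (\<Sum>i<n. a i)" for n
  have S: "S \<longlonglongrightarrow> suminf a" unfolding S_def by (rule summable_LIMSEQ[OF assms(1)])
  have half: "filterlim (\<lambda>n::nat. n div 2) at_top sequentially"
    unfolding filterlim_at_top
  proof
    fix Z :: nat
    show "\<forall>\<^sub>F n in sequentially. Z \<le> n div 2"
      by (rule eventually_sequentiallyI[of "2 * Z"]) simp
  qed
  have "(\<lambda>n. 2 * (S n - S (n div 2))) \<longlonglongrightarrow> 2 * (suminf a - suminf a)"
    by (intro tendsto_intros S filterlim_compose[OF S half])
  then have "(\<lambda>n. 2 * (S n - S (n div 2))) \<longlonglongrightarrow> 0" by simp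
  moreover have "real n * a n \<le> 2 * (S n - S (n div 2))" for n
  proof -
    have "S n - S (n div 2) = (\<Sum>i=n div 2..<n. a i)"
      unfolding S_def using sum.atLeastLessThan_concat[of 0 "n div 2" n a] by (simp add: lessThan_atLeast0)
    also have "\<dots> \<ge> (\<Sum>i=n div 2..<n. a n)"
      using assms(2) by (intro sum_mono) (auto simp: decseq_def)
    finally have "real (n - n div 2) * a n \<le> S n - S (n div 2)" by simp
    then have "2 * (real (n - n div 2) * a n) \<le> 2 * (S n - S (n div 2))" by simp
    moreover have "real n * a n \<le> (2 * real (n - n div 2)) * a n"
      by (rule mult_right_mono[OF _ assms(3)]) linarith
    ultimately show ?thesis by (simp only: mult.assoc)
  qed
  ultimately show ?thesis
    by (intro tendsto_sandwich[of "\<lambda>_. 0" "\<lambda>n. real n * a n" sequentially "\<lambda>n. 2 * (S n - S (n div 2))"])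
      (auto simp: assms(3))
qed

context stationary_word_law
begin

text \<open>The affine map from [-1, 1] onto [0, 1] divides a covariance by 4, and the real and
  imaginary parts of a complex covariance consist of four real ones, whence 16.\<close>

lemma complex_mixing:
  fixes F G :: "'a list \<Rightarrow> complex"
  assumes unit: "\<And>X Y. (\<And>u. 0 \<le> X u \<and> X u \<le> 1) \<Longrightarrow> (\<And>u. 0 \<le> Y u \<and> Y u \<le> 1) \<Longrightarrow>
      \<bar>wexp w (n + g + l) (\<lambda>u. X (take n u) * Y (drop (n + g) u)) - wexp w n X * wexp w l Y\<bar> \<le> (b :: real)"
    and F: "\<And>u. norm (F u) \<le> 1" and G: "\<And>u. norm (G u) \<le> 1"
  shows "norm (wexp w (n + g + l) (\<lambda>u. F (take n u) * G (drop (n + g) u)) - wexp w n F * wexp w l G) \<le> 16 * b"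
proof -
  define r where "r X Y = wexp w (n + g + l) (\<lambda>u. X (take n u) * Y (drop (n + g) u)) - wexp w n X * wexp w l Y"
    for X Y :: "'a list \<Rightarrow> real"
  have r_le: "\<bar>r X Y\<bar> \<le> 4 * b" if "\<And>u. \<bar>X u\<bar> \<le> 1" "\<And>u. \<bar>Y u\<bar> \<le> 1" for X Y
  proof -
    have X: "0 \<le> 1 / 2 + 1 / 2 * X u \<and> 1 / 2 + 1 / 2 * X u \<le> 1"
      and Y: "0 \<le> 1 / 2 + 1 / 2 * Y u \<and> 1 / 2 + 1 / 2 * Y u \<le> 1" for u
      using that[of u] by (auto simp: abs_le_iff)
    have "(\<lambda>u. (1 / 2 + 1 / 2 * X (take n u)) * (1 / 2 + 1 / 2 * Y (drop (n + g) u)))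
       = (\<lambda>u. (1 / 4 + 1 / 4 * X (take n u)) + (1 / 4 * Y (drop (n + g) u) + 1 / 4 * (X (take n u) * Y (drop (n + g) u))))"
      by (simp add: algebra_simps)
    moreover have "wexp w (n + g + l) (\<lambda>u. X (take n u)) = wexp w n X"
      unfolding add.assoc by (rule wexp_take)
    moreover have "wexp w (n + g + l) (\<lambda>u. Y (drop (n + g) u)) = wexp w l Y"
      by (rule wexp_drop)
    ultimately have "r (\<lambda>u. 1 / 2 + 1 / 2 * X u) (\<lambda>u. 1 / 2 + 1 / 2 * Y u) = r X Y / 4"
      unfolding r_def by (simp only: wexp_add wexp_mult_left wexp_const) (simp add: algebra_simps)
    moreover have "\<bar>r (\<lambda>u. 1 / 2 + 1 / 2 * X u) (\<lambda>u. 1 / 2 + 1 / 2 * Y u)\<bar> \<le> b"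
      unfolding r_def by (rule unit) (rule X Y)+
    ultimately show ?thesis by simp
  qed
  have Re: "Re (wexp w k H) = wexp w k (\<lambda>u. Re (H u))" and Im: "Im (wexp w k H) = wexp w k (\<lambda>u. Im (H u))"
    for k and H :: "'a list \<Rightarrow> complex"
    by (simp_all add: wexp_def)
  have bounds: "\<bar>Re (F u)\<bar> \<le> 1" "\<bar>Im (F u)\<bar> \<le> 1" "\<bar>Re (G u)\<bar> \<le> 1" "\<bar>Im (G u)\<bar> \<le> 1" for u
    using F[of u] G[of u] abs_Re_le_cmod abs_Im_le_cmod order_trans by blast+
  let ?C = "wexp w (n + g + l) (\<lambda>u. F (take n u) * G (drop (n + g) u)) - wexp w n F * wexp w l G"
  have "Re ?C = r (\<lambda>u. Re (F u)) (\<lambda>u. Re (G u)) - r (\<lambda>u. Im (F u)) (\<lambda>u. Im (G u))"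
    and "Im ?C = r (\<lambda>u. Re (F u)) (\<lambda>u. Im (G u)) + r (\<lambda>u. Im (F u)) (\<lambda>u. Re (G u))"
    by (simp_all add: r_def Re Im wexp_diff wexp_add)
  moreover have "\<bar>r (\<lambda>u. Re (F u)) (\<lambda>u. Re (G u))\<bar> \<le> 4 * b" "\<bar>r (\<lambda>u. Im (F u)) (\<lambda>u. Im (G u))\<bar> \<le> 4 * b"
    "\<bar>r (\<lambda>u. Re (F u)) (\<lambda>u. Im (G u))\<bar> \<le> 4 * b" "\<bar>r (\<lambda>u. Im (F u)) (\<lambda>u. Re (G u))\<bar> \<le> 4 * b"
    by (intro r_le bounds)+
  ultimately have "\<bar>Re ?C\<bar> + \<bar>Im ?C\<bar> \<le> 16 * b" by linarith
  then show ?thesis using cmod_le[of ?C] by linarith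
qed

end

section \<open>Forgetting the initial distribution\<close>

context random_automaton
begin

text \<open>Both laws are compared with the same integral \<open>Z\<close>, started from a fixed
  state. This gives the factor 2; passing to signed and then to complex observables doubles it
  twice.\<close>

lemma forget_init:
  fixes F :: "'a list \<Rightarrow> complex"
  assumes \<pi>: "init \<pi>" and \<pi>': "init \<pi>'" and F: "\<And>u. norm (F u) \<le> 1"
  shows "norm (wexp (law \<pi>) (L * k + n) (\<lambda>u. F (drop (L * k) u)) - wexp (law \<pi>') (L * k + n) (\<lambda>u. F (drop (L * k) u)))
    \<le> 8 * (1 - \<epsilon>) ^ k"
proof -
  interpret \<pi>: word_law "law \<pi>" by (rule word_law_law[OF \<pi>])
  interpret \<pi>': word_law "law \<pi>'" by (rule word_law_law[OF \<pi>'])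
  define r where "r X = wexp (law \<pi>) (L * k + n) (\<lambda>u. X (drop (L * k) u)) - wexp (law \<pi>') (L * k + n) (\<lambda>u. X (drop (L * k) u))"
    for X :: "'a list \<Rightarrow> real"
  have unit: "\<bar>r X\<bar> \<le> 2 * (1 - \<epsilon>) ^ k" if X: "\<And>u. 0 \<le> X u \<and> X u \<le> 1" for X
  proof -
    fix j :: 'd
    define Z where "Z \<omega> = ex \<omega> (L * k + n) j (\<lambda>u. X (drop (L * k) u))" for \<omega>
    have int: "integrable P Z"
      unfolding Z_def by (intro integrable_bounded01 AE_good_space ex_unit X) measurable
    have "\<bar>wexp (law \<pi>) (L * k + n) (\<lambda>u. X (drop (L * k) u)) - (\<integral>\<omega>. Z \<omega> \<partial>P)\<bar> \<le> (1 - \<epsilon>) ^ k"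
      by (rule wexp_law_close[OF \<pi> _ int]) (unfold Z_def, rule forget_start[OF _ X])
    moreover have "\<bar>wexp (law \<pi>') (L * k + n) (\<lambda>u. X (drop (L * k) u)) - (\<integral>\<omega>. Z \<omega> \<partial>P)\<bar> \<le> (1 - \<epsilon>) ^ k"
      by (rule wexp_law_close[OF \<pi>' _ int]) (unfold Z_def, rule forget_start[OF _ X])
    ultimately show ?thesis unfolding r_def by linarith
  qed
  have signed: "\<bar>r X\<bar> \<le> 4 * (1 - \<epsilon>) ^ k" if X: "\<And>u. \<bar>X u\<bar> \<le> 1" for X
  proof -
    have "0 \<le> 1 / 2 + 1 / 2 * X u \<and> 1 / 2 + 1 / 2 * X u \<le> 1" for u
      using X[of u] by (auto simp: abs_le_iff)
    then have "\<bar>r (\<lambda>u. 1 / 2 + 1 / 2 * X u)\<bar> \<le> 2 * (1 - \<epsilon>) ^ k" by (rule unit)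
    then show ?thesis
      by (simp only: r_def wexp_add wexp_mult_left \<pi>.wexp_const \<pi>'.wexp_const)
  qed
  let ?C = "wexp (law \<pi>) (L * k + n) (\<lambda>u. F (drop (L * k) u)) - wexp (law \<pi>') (L * k + n) (\<lambda>u. F (drop (L * k) u))"
  have "Re ?C = r (\<lambda>u. Re (F u))" "Im ?C = r (\<lambda>u. Im (F u))"
    by (simp_all add: r_def wexp_def)
  moreover have "\<bar>Re (F u)\<bar> \<le> 1" "\<bar>Im (F u)\<bar> \<le> 1" for u
    using F[of u] abs_Re_le_cmod abs_Im_le_cmod order_trans by blast+
  ultimately have "\<bar>Re ?C\<bar> \<le> 4 * (1 - \<epsilon>) ^ k" "\<bar>Im ?C\<bar> \<le> 4 * (1 - \<epsilon>) ^ k"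
    using signed by presburger+
  then show ?thesis using cmod_le[of ?C] by linarith
qed

text \<open>With \<open>k = g div (2 * L)\<close>, forgetting uses at most half of the gap, and at
  least \<open>g div 2\<close> letters remain to separate the environments. The factor 16 is that of
  \<open>complex_mixing\<close>.\<close>

definition rate :: "nat \<Rightarrow> real" where
  "rate g = 16 * (\<alpha> (Suc (g div 2)) + 4 * (1 - \<epsilon>) ^ (g div (2 * L)))"

lemma mixing_law:
  assumes \<pi>: "init \<pi>" and stat: "stationary_word_law (law \<pi>)"
    and \<alpha>_summable: "summable (\<lambda>n. \<alpha> (Suc n))" and \<alpha>_dec: "decseq \<alpha>"
  shows "mixing_word_law (law \<pi>) rate"
proof -
  interpret stationary_word_law "law \<pi>" by (rule stat)
  have \<alpha>_nonneg: "0 \<le> \<alpha> n" for n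
  proof -
    have "(\<lambda>n. \<alpha> (Suc n)) \<longlonglongrightarrow> 0" by (rule summable_LIMSEQ_zero[OF \<alpha>_summable])
    then have "\<alpha> \<longlonglongrightarrow> 0" by (simp only: filterlim_sequentially_Suc)
    then show ?thesis using decseq_ge[OF \<alpha>_dec] by blast
  qed
  have geo: "summable (\<lambda>k. (1 - \<epsilon>) ^ k)" using \<epsilon>_pos \<epsilon>_le_1 by (intro summable_geometric) simp
  have "summable (\<lambda>g. \<alpha> (Suc (g div 2)))"
    by (rule summable_div[OF \<alpha>_summable]) (simp_all add: \<alpha>_nonneg)
  moreover have "summable (\<lambda>g. (1 - \<epsilon>) ^ (g div (2 * L)))"
    by (rule summable_div[OF geo]) (use \<epsilon>_le_1 L_pos in simp_all)
  ultimately have summable: "summable rate"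
    unfolding rate_def by (intro summable_mult summable_add)
  have dec: "decseq rate"
    unfolding decseq_def rate_def
  proof (intro allI impI mult_left_mono add_mono)
    fix m n :: nat assume "m \<le> n"
    then show "\<alpha> (Suc (n div 2)) \<le> \<alpha> (Suc (m div 2))"
      by (intro decseqD[OF \<alpha>_dec]) (simp add: div_le_mono)
    show "(1 - \<epsilon>) ^ (n div (2 * L)) \<le> (1 - \<epsilon>) ^ (m div (2 * L))"
      using \<open>m \<le> n\<close> \<epsilon>_pos \<epsilon>_le_1 by (intro power_decreasing) (auto intro: div_le_mono)
  qed auto
  have nonneg: "0 \<le> rate g" for g unfolding rate_def using \<alpha>_nonneg \<epsilon>_le_1 by simp
  show ?thesis
  proof
    fix n g l and F G :: "'a list \<Rightarrow> complex"
    assume F: "\<And>u. norm (F u) \<le> 1" and G: "\<And>u. norm (G u) \<le> 1"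
    define k where "k = g div (2 * L)"
    define h where "h = g - L * k"
    have "2 * (L * k) \<le> g" unfolding k_def by (simp add: mult.assoc[symmetric])
    then have h: "g = h + L * k" "g div 2 \<le> h" by (auto simp: h_def)
    have "\<alpha> (Suc h) \<le> \<alpha> (Suc (g div 2))" using h by (intro decseqD[OF \<alpha>_dec]) simp
    moreover have "norm (wexp (law \<pi>) (n + g + l) (\<lambda>u. F (take n u) * G (drop (n + g) u)) - wexp (law \<pi>) n F * wexp (law \<pi>) l G)
        \<le> 16 * (\<alpha> (Suc h) + 4 * (1 - \<epsilon>) ^ k)"
      by (rule complex_mixing[OF mixing_unit[OF \<pi> stat _ _ h(1)] F G])
    ultimately show "norm (wexp (law \<pi>) (n + g + l) (\<lambda>u. F (take n u) * G (drop (n + g) u)) - wexp (law \<pi>) n F * wexp (law \<pi>) l G) \<le> rate g"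
      unfolding rate_def k_def[symmetric]
      by (elim order_trans) (intro mult_left_mono add_mono order_refl, simp_all)
  qed (rule summable, rule summable_decreasing_small[OF summable dec nonneg])
qed

text \<open>Omitting the first \<open>L * k\<close> windows moves the phase by at most
  \<open>\<bar>t / sqrt n\<bar> * (L * k)\<close> under either law; the remaining windows hardly see
  the initial distribution. First \<open>k\<close> is fixed to make the second error small, then
  \<open>n\<close> grows.\<close>

lemma char_tendsto_init:
  assumes \<pi>: "init \<pi>" and \<pi>': "init \<pi>'" and obs: "window_observable (law \<pi>) rate \<psi> m"
  shows "(\<lambda>n. wexp (law \<pi>') (n + m - 1) (\<lambda>u. iexp (t / sqrt (real n) * (\<Sum>i<n. window_observable.X \<psi> m i u))))
    \<longlonglongrightarrow> of_real (exp (- (t\<^sup>2 * window_observable.sigma2 (law \<pi>) \<psi> m / 2)))"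
proof -
  interpret window_observable "law \<pi>" rate \<psi> m by (rule obs)
  interpret \<pi>': word_law "law \<pi>'" by (rule word_law_law[OF \<pi>'])
  let ?\<phi> = "\<lambda>\<pi> n. wexp (law \<pi>) (n + m - 1) (\<lambda>u. iexp (t / sqrt (real n) * (\<Sum>i<n. X i u)))"
  have bound: "norm (?\<phi> \<pi>' n - ?\<phi> \<pi> n) \<le> 2 * (\<bar>t / sqrt (real n)\<bar> * real (L * k)) + 8 * (1 - \<epsilon>) ^ k" if n: "L * k \<le> n" for n k
  proof -
    define \<xi> where "\<xi> = t / sqrt (real n)"
    define F where "F u = iexp (\<xi> * (\<Sum>i<n - L * k. X i u))" for u
    define N where "N = n - L * k + m - 1"
    have N: "n + m - 1 = L * k + N" using n m_pos by (simp add: N_def)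
    have close: "norm (iexp (\<xi> * (\<Sum>i<n. X i u)) - F (drop (L * k) u)) \<le> \<bar>\<xi>\<bar> * real (L * k)" for u
    proof -
      have "(\<Sum>i<n. X i u) = (\<Sum>i<L * k. X i u) + (\<Sum>i<n - L * k. X i (drop (L * k) u))"
        using n sum.atLeastLessThan_concat[of 0 "L * k" n "\<lambda>i. X i u"]
          sum.atLeastLessThan_shift_0[of "\<lambda>i. X i u" "L * k" n]
        by (simp add: X_drop lessThan_atLeast0 comp_def)
      then have "\<bar>\<xi> * (\<Sum>i<n. X i u) - \<xi> * (\<Sum>i<n - L * k. X i (drop (L * k) u))\<bar> = \<bar>\<xi>\<bar> * \<bar>\<Sum>i<L * k. X i u\<bar>"
        by (simp add: distrib_left abs_mult)
      also have "\<bar>\<Sum>i<L * k. X i u\<bar> \<le> (\<Sum>i<L * k. 1)"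
        by (intro order_trans[OF sum_abs] sum_mono X_bound)
      finally show ?thesis
        unfolding F_def by (intro order_trans[OF norm_iexp_diff_le]) (simp add: mult_left_mono)
    qed
    have 1: "norm (?\<phi> \<pi>' n - wexp (law \<pi>') (L * k + N) (\<lambda>u. F (drop (L * k) u))) \<le> \<bar>\<xi>\<bar> * real (L * k)"
      unfolding N wexp_diff[symmetric] \<xi>_def[symmetric] by (rule \<pi>'.norm_wexp_le_const) (rule close)
    have 2: "norm (?\<phi> \<pi> n - wexp (law \<pi>) (L * k + N) (\<lambda>u. F (drop (L * k) u))) \<le> \<bar>\<xi>\<bar> * real (L * k)"
      unfolding N wexp_diff[symmetric] \<xi>_def[symmetric] by (rule norm_wexp_le_const) (rule close)
    have 3: "norm (wexp (law \<pi>') (L * k + N) (\<lambda>u. F (drop (L * k) u)) - wexp (law \<pi>) (L * k + N) (\<lambda>u. F (drop (L * k) u)))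
        \<le> 8 * (1 - \<epsilon>) ^ k"
      by (rule forget_init[OF \<pi>' \<pi>]) (simp add: F_def)
    show ?thesis
      using norm_diff_triangle_le[OF norm_diff_triangle_le[OF 1 3] 2[unfolded norm_minus_commute[of "?\<phi> \<pi> n"]]]
      by (simp add: \<xi>_def)
  qed
  have "(\<lambda>n. ?\<phi> \<pi>' n - ?\<phi> \<pi> n) \<longlonglongrightarrow> 0"
  proof (rule LIMSEQ_I)
    fix e :: real assume e: "0 < e"
    have "(\<lambda>k. 8 * (1 - \<epsilon>) ^ k) \<longlonglongrightarrow> 8 * 0"
      using \<epsilon>_pos \<epsilon>_le_1 by (intro tendsto_intros LIMSEQ_power_zero) simp
    then have "\<forall>\<^sub>F k in sequentially. 8 * (1 - \<epsilon>) ^ k < e / 2"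
      by (rule order_tendstoD(2)) (use e in simp)
    then obtain k where k: "8 * (1 - \<epsilon>) ^ k < e / 2" by (metis eventually_happens sequentially_bot)
    have "(\<lambda>n. 2 * (\<bar>t / sqrt (real n)\<bar> * real (L * k))) \<longlonglongrightarrow> 2 * (\<bar>0\<bar> * real (L * k))"
    proof (intro tendsto_intros)
      have "(\<lambda>n. t * (1 / sqrt (real n))) \<longlonglongrightarrow> t * 0"
        by (intro tendsto_intros) real_asymp
      then show "(\<lambda>n. t / sqrt (real n)) \<longlonglongrightarrow> 0" by simp
    qed
    then have "\<forall>\<^sub>F n in sequentially. 2 * (\<bar>t / sqrt (real n)\<bar> * real (L * k)) < e / 2"
      by (rule order_tendstoD(2)) (use e in simp)
    from eventually_conj[OF this eventually_ge_at_top[of "L * k"]]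
    have "\<forall>\<^sub>F n in sequentially. norm (?\<phi> \<pi>' n - ?\<phi> \<pi> n - 0) < e"
      by (rule eventually_mono) (use bound k in force)
    then show "\<exists>no. \<forall>n\<ge>no. norm (?\<phi> \<pi>' n - ?\<phi> \<pi> n - 0) < e"
      by (simp add: eventually_sequentially)
  qed
  from tendsto_add[OF this char_tendsto[of t]] show ?thesis by simp
qed

end

subsection \<open>Strong mixing coefficients, Gaussian laws and couplings\<close>

lemma real_distribution_centered_gaussian:
  assumes "0 \<le> v"
  shows "real_distribution (centered_gaussian v)"
proof (cases "v = 0")
  case True
  have "prob_space (return borel (0::real))" by (rule prob_space_return) simp
  then show ?thesis
    by (simp add: True centered_gaussian_def real_distribution_def real_distribution_axioms_def)
next
  case False
  then have "prob_space (density lborel (normal_density 0 (sqrt v)))"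
    using assms by (intro prob_space_normal_density) simp
  then show ?thesis
    by (simp add: False centered_gaussian_def real_distribution_def real_distribution_axioms_def)
qed

lemma char_centered_gaussian:
  assumes "0 \<le> v"
  shows "char (centered_gaussian v) t = of_real (exp (- (t\<^sup>2 * v / 2)))"
proof (cases "v = 0")
  case True
  then show ?thesis by (simp add: char_def centered_gaussian_def integral_return)
next
  case False
  define \<sigma> where "\<sigma> = sqrt v"
  have \<sigma>: "0 < \<sigma>" "\<sigma>\<^sup>2 = v" using assms False by (simp_all add: \<sigma>_def)
  interpret std: real_distribution std_normal_distribution by (rule real_dist_normal_dist)
  have "distributed std_normal_distribution lborel (\<lambda>x. x) std_normal_density"
    by (simp add: distributed_def distr_id2)
  then have "distributed std_normal_distribution lborel (\<lambda>x. 0 + \<sigma> * x) (normal_density (0 + \<sigma> * 0) (\<bar>\<sigma>\<bar> * 1))"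
    using \<sigma> by (intro std.normal_density_affine) auto
  then have "distr std_normal_distribution lborel (\<lambda>x. \<sigma> * x) = centered_gaussian v"
    using \<sigma> False by (simp add: distributed_def centered_gaussian_def \<sigma>_def)
  then have "char (centered_gaussian v) t = (CLINT x|distr std_normal_distribution lborel (\<lambda>x. \<sigma> * x). iexp (t * x))"
    by (simp add: char_def)
  also have "\<dots> = char std_normal_distribution (t * \<sigma>)"
    by (subst integral_distr) (simp_all add: char_def mult_ac)
  also have "\<dots> = of_real (exp (- (t\<^sup>2 * v / 2)))"
    using \<sigma> by (simp add: char_std_normal_distribution power_mult_distrib)
  finally show ?thesis .
qed

text \<open>Under the coupling the difference is the mean of \<open>h (F u) - h (G v)\<close>, which
  vanishes where the two states meet and is at most \<open>D\<close> elsewhere.\<close>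

lemma coupling_contraction:
  fixes \<kappa> :: "('a::finite list \<times> 'a list) pmf"
  assumes fst: "\<And>u. pmf (map_pmf fst \<kappa>) u = (if length u = L then Q u else 0)"
    and snd: "\<And>v. pmf (map_pmf snd \<kappa>) v = (if length v = L then Q' v else 0)"
    and meet: "\<epsilon> \<le> measure_pmf.prob \<kappa> {(u, v). F u = G v}"
    and h: "\<And>x y. \<bar>h x - h y\<bar> \<le> (D :: real)"
  shows "\<bar>(\<Sum>u\<in>words L. Q u * h (F u)) - (\<Sum>v\<in>words L. Q' v * h (G v))\<bar> \<le> (1 - \<epsilon>) * D"
proof -
  have D: "0 \<le> D" using h[of undefined undefined] by simp
  have len1: "length u = L" if "u \<in> set_pmf (map_pmf fst \<kappa>)" for u
    using that fst[of u] by (simp add: set_pmf_iff split: if_splits del: pmf_map set_map_pmf)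
  have len2: "length u = L" if "u \<in> set_pmf (map_pmf snd \<kappa>)" for u
    using that snd[of u] by (simp add: set_pmf_iff split: if_splits del: pmf_map set_map_pmf)
  have "set_pmf \<kappa> \<subseteq> words L \<times> words L"
    using len1 len2 by (auto simp: image_iff) (metis fst_conv, metis snd_conv)
  then have fin: "finite (set_pmf \<kappa>)" by (rule finite_subset) simp
  note int = integrable_measure_pmf_finite[OF fin]
  have "(\<Sum>u\<in>words L. Q u * h (F u)) = (\<integral>u. h (F u) \<partial>measure_pmf (map_pmf fst \<kappa>))"
    by (subst integral_measure_pmf_real[of "words L"])
      (auto simp: fst mult.commute simp del: pmf_map set_map_pmf dest: len1)
  moreover have "(\<Sum>v\<in>words L. Q' v * h (G v)) = (\<integral>v. h (G v) \<partial>measure_pmf (map_pmf snd \<kappa>))"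
    by (subst integral_measure_pmf_real[of "words L"])
      (auto simp: snd mult.commute simp del: pmf_map set_map_pmf dest: len2)
  ultimately have "(\<Sum>u\<in>words L. Q u * h (F u)) - (\<Sum>v\<in>words L. Q' v * h (G v))
      = (\<integral>x. h (F (fst x)) - h (G (snd x)) \<partial>measure_pmf \<kappa>)"
    by (simp add: Bochner_Integration.integral_diff[OF int int])
  also have "\<bar>\<dots>\<bar> \<le> (\<integral>x. \<bar>h (F (fst x)) - h (G (snd x))\<bar> \<partial>measure_pmf \<kappa>)"
    by (rule integral_abs_bound)
  also have "\<dots> \<le> (\<integral>x. D * (1 - indicator {(u, v). F u = G v} x) \<partial>measure_pmf \<kappa>)"
    by (intro integral_mono int) (use h D in \<open>auto simp: indicator_def\<close>)
  also have "\<dots> = D * (1 - measure_pmf.prob \<kappa> {(u, v). F u = G v})"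
    by (simp add: Bochner_Integration.integral_diff[OF int int])
  also have "\<dots> \<le> D * (1 - \<epsilon>)" using meet D by (intro mult_left_mono) auto
  finally show ?thesis by (simp add: mult.commute)
qed

lemma F_past_subset: "F_past P V \<theta> k \<subseteq> Pow (space P)"
  unfolding F_past_def by (rule subsetI, rule PowI, erule sigma_sets_into_sp[rotated]) auto

lemma F_future_subset: "F_future P V \<theta> k \<subseteq> Pow (space P)"
  unfolding F_future_def by (rule subsetI, rule PowI, erule sigma_sets_into_sp[rotated]) auto

lemma sigma_sets_F_past: "sigma_sets (space P) (F_past P V \<theta> k) = F_past P V \<theta> k"
  unfolding F_past_def by (rule sigma_sets_sigma_sets_eq) auto

lemma sigma_sets_F_future: "sigma_sets (space P) (F_future P V \<theta> k) = F_future P V \<theta> k"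
  unfolding F_future_def by (rule sigma_sets_sigma_sets_eq) auto

lemma F_future_antimono: "k \<le> l \<Longrightarrow> F_future P V \<theta> l \<subseteq> F_future P V \<theta> k"
  unfolding F_future_def
proof (rule sigma_sets_mono'[OF subsetI])
  fix A assume "k \<le> l" "A \<in> {{\<omega> \<in> space P. Tmap V a (thetaZ P \<theta> j \<omega>) X \<in> B} |a X B j. l \<le> j \<and> B \<in> sets borel}"
  then obtain a X B j where "A = {\<omega> \<in> space P. Tmap V a (thetaZ P \<theta> j \<omega>) X \<in> B}" "l \<le> j" "B \<in> sets borel"
    by blast
  moreover have "k \<le> j" using \<open>k \<le> l\<close> \<open>l \<le> j\<close> by simp
  ultimately show "A \<in> {{\<omega> \<in> space P. Tmap V a (thetaZ P \<theta> j \<omega>) X \<in> B} |a X B j. k \<le> j \<and> B \<in> sets borel}"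
    by blast
qed

context prob_space
begin

lemma correlation_le_1: "\<bar>prob (B \<inter> C) - prob B * prob C\<bar> \<le> 1"
proof -
  have "prob B * prob C \<le> 1" by (intro mult_le_one) auto
  moreover have "0 \<le> prob B * prob C" "0 \<le> prob (B \<inter> C)" "prob (B \<inter> C) \<le> 1" by auto
  ultimately show ?thesis by (simp only: abs_le_iff) linarith
qed

text \<open>The supremum of reals in \<open>alpha_mix\<close> is informative only for a bounded
  nonempty set; nonemptiness is supplied by \<open>empty_correlation\<close>.\<close>

lemma alpha_mix_bdd: "bdd_above {\<bar>prob (B \<inter> C) - prob B * prob C\<bar> | k B C.
    B \<in> F_past M V \<theta> k \<and> C \<in> F_future M V \<theta> (k + int n)}"
  by (rule bdd_aboveI[of _ 1], clarify, rule correlation_le_1)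

lemma correlation_le_alpha_mix:
  "B \<in> F_past M V \<theta> k \<Longrightarrow> C \<in> F_future M V \<theta> (k + int n) \<Longrightarrow>
    \<bar>prob (B \<inter> C) - prob B * prob C\<bar> \<le> alpha_mix M V \<theta> n"
  unfolding alpha_mix_def by (rule cSup_upper[OF _ alpha_mix_bdd], rule CollectI, intro exI conjI, rule refl)

lemma empty_correlation:
  "0 \<in> {\<bar>prob (B \<inter> C) - prob B * prob C\<bar> | k B C.
    B \<in> F_past M V \<theta> k \<and> C \<in> F_future M V \<theta> (k + int n)}"
proof -
  have "{} \<in> F_past M V \<theta> 0" "{} \<in> F_future M V \<theta> (0 + int n)"
    by (simp_all add: F_past_def F_future_def sigma_sets.Empty)
  then show ?thesis by (intro CollectI exI[of _ 0] exI[of _ "{}"] conjI) simp_all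
qed

lemma alpha_mix_nonneg: "0 \<le> alpha_mix M V \<theta> n"
  unfolding alpha_mix_def by (rule cSup_upper[OF empty_correlation alpha_mix_bdd])

lemma alpha_mix_le_1: "alpha_mix M V \<theta> n \<le> 1"
  unfolding alpha_mix_def
proof (rule cSup_least)
  show "{\<bar>prob (B \<inter> C) - prob B * prob C\<bar> | k B C.
      B \<in> F_past M V \<theta> k \<and> C \<in> F_future M V \<theta> (k + int n)} \<noteq> {}"
    using empty_correlation by blast
qed (clarify, rule correlation_le_1)

lemma alpha_mix_decseq: "decseq (alpha_mix M V \<theta>)"
  unfolding decseq_def
proof (intro allI impI)
  fix m n :: nat assume mn: "m \<le> n"
  have sub: "F_future M V \<theta> (k + int n) \<subseteq> F_future M V \<theta> (k + int m)" for k
    by (rule F_future_antimono) (use mn in simp)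
  show "alpha_mix M V \<theta> n \<le> alpha_mix M V \<theta> m"
    unfolding alpha_mix_def[of _ _ _ n]
  proof (rule cSup_least)
    show "{\<bar>prob (B \<inter> C) - prob B * prob C\<bar> | k B C.
        B \<in> F_past M V \<theta> k \<and> C \<in> F_future M V \<theta> (k + int n)} \<noteq> {}"
      using empty_correlation by blast
  qed (clarify, rule correlation_le_alpha_mix, assumption, erule subsetD[OF sub])
qed

text \<open>A number in the unit interval is at most its power with an exponent in the unit
  interval.\<close>

lemma alpha_mix_summable:
  assumes "summable (\<lambda>n. alpha_mix M V \<theta> (Suc n) powr x)" "0 < x" "x \<le> 1"
  shows "summable (\<lambda>n. alpha_mix M V \<theta> (Suc n))"
proof (rule summable_comparison_test'[OF assms(1)])
  fix n
  have "alpha_mix M V \<theta> (Suc n) powr 1 \<le> alpha_mix M V \<theta> (Suc n) powr x"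
    using alpha_mix_nonneg alpha_mix_le_1 assms by (intro powr_mono') auto
  then show "norm (alpha_mix M V \<theta> (Suc n)) \<le> alpha_mix M V \<theta> (Suc n) powr x"
    using alpha_mix_nonneg by simp
qed

end

subsection \<open>Reduction of the instrument to an automaton\<close>

lemma cinner_sum_right: "cinner x (\<Sum>i\<in>I. y i) = (\<Sum>i\<in>I. cinner x (y i))"
  unfolding cinner_def by (simp add: sum_component sum_distrib_left) (rule sum.swap)

lemma cinner_sum_left: "cinner (\<Sum>i\<in>I. y i) x = (\<Sum>i\<in>I. cinner (y i) x)"
  unfolding cinner_def by (simp add: sum_component sum_distrib_right) (rule sum.swap)

lemma cinner_scale_right: "cinner x (k *s y) = k * cinner x y"
  by (simp add: cinner_def sum_distrib_left mult_ac)

lemma cinner_scale_left: "cinner (k *s x) y = cnj k * cinner x y"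
  by (simp add: cinner_def sum_distrib_left mult_ac)

lemma cinner_self_nonneg: "0 \<le> Re (cinner x x)"
  by (simp add: cinner_def complex_mult_cnj mult.commute[of "cnj _"] sum_nonneg)

lemma cinner_adj: "cinner (A *v x) y = cinner x (cadj A *v y)"
proof -
  have "cinner (A *v x) y = (\<Sum>i\<in>UNIV. \<Sum>j\<in>UNIV. cnj (A $ i $ j) * cnj (x $ j) * y $ i)"
    by (simp add: cinner_def matrix_vector_mult_def sum_distrib_right)
  also have "\<dots> = (\<Sum>j\<in>UNIV. \<Sum>i\<in>UNIV. cnj (A $ i $ j) * cnj (x $ j) * y $ i)"
    by (rule sum.swap)
  also have "\<dots> = cinner x (cadj A *v y)"
    by (simp add: cinner_def matrix_vector_mult_def cadj_def sum_distrib_left mult_ac)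
  finally show ?thesis .
qed

lemma matrix_mult_sum_left: "(\<Sum>i\<in>I. A i :: complex^'d^'d) *v x = (\<Sum>i\<in>I. A i *v x)"
  by (induction I rule: infinite_finite_induct) (simp_all add: matrix_vector_mult_add_rdistrib)

lemma matrix_mult_sum_right: "(A :: complex^'d^'d) *v (\<Sum>i\<in>I. x i) = (\<Sum>i\<in>I. A *v x i)"
  by (induction I rule: infinite_finite_induct) (simp_all add: matrix_vector_right_distrib)

lemma conj_ket_bra: "A ** ket_bra v ** cadj A = ket_bra (A *v v)"
  by (simp add: vec_eq_iff ket_bra_def cadj_def matrix_matrix_mult_def matrix_vector_mult_def
      sum_product sum_distrib_left sum_distrib_right mult_ac)

lemma trace_ket_bra: "trace (ket_bra v) = cinner v v"
  by (simp add: trace_def ket_bra_def cinner_def mult.commute)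

text \<open>The \<open>i\<close>-th diagonal entry of \<open>X\<close> in the basis
  \<open>e\<close>; for a density matrix, the probability of the automaton state
  \<open>i\<close>.\<close>

definition dent :: "('d::finite \<Rightarrow> complex^'d) \<Rightarrow> complex^'d^'d \<Rightarrow> 'd \<Rightarrow> complex" where
  "dent e X i = cinner (e i) (X *v e i)"

lemma dent_sum: "dent e (\<Sum>a\<in>S. X a) i = (\<Sum>a\<in>S. dent e (X a) i)"
  by (simp add: dent_def matrix_mult_sum_left cinner_sum_right)

lemma dent_entries:
  "dent e X i = (\<Sum>r\<in>UNIV. \<Sum>c\<in>UNIV. cnj (e i $ r) * e i $ c * X $ r $ c)"
  by (simp add: dent_def cinner_def matrix_vector_mult_def sum_distrib_left mult_ac)

locale orthonormal_basis =
  fixes e :: "'d::finite \<Rightarrow> complex^'d"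
  assumes onb: "cinner (e i) (e j) = (if i = j then 1 else 0)"
begin

definition U :: "complex^'d^'d" where
  "U = (\<chi> r i. e i $ r)"

lemma U_unitary: "U ** cadj U = mat 1"
proof -
  have "cadj U ** U = mat 1"
    using onb by (simp add: vec_eq_iff matrix_matrix_mult_def cadj_def U_def mat_def cinner_def)
  then show ?thesis by (simp add: matrix_left_right_inverse)
qed

lemma expand: "x = (\<Sum>i\<in>UNIV. cinner (e i) x *s e i)"
proof -
  have "x = U *v (cadj U *v x)"
    by (simp add: matrix_vector_mul_assoc U_unitary)
  also have "\<dots> = (\<Sum>i\<in>UNIV. cinner (e i) x *s e i)"
    by (simp add: vec_eq_iff matrix_vector_mult_def cadj_def U_def cinner_def sum_component mult.commute)
  finally show ?thesis .
qed

lemma trace_dent: "trace X = (\<Sum>i\<in>UNIV. dent e X i)"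
proof -
  have "trace X = trace (X ** (U ** cadj U))" by (simp add: U_unitary)
  also have "\<dots> = trace (cadj U ** (X ** U))"
    by (metis matrix_mul_assoc trace_mul_sym)
  also have "\<dots> = (\<Sum>i\<in>UNIV. dent e X i)"
    by (simp add: trace_def dent_def cinner_def matrix_matrix_mult_def matrix_vector_mult_def
        cadj_def U_def)
  finally show ?thesis .
qed

lemma dent_ket_bra: "dent e (ket_bra (e i)) j = (if i = j then 1 else 0)"
proof -
  have "ket_bra v *v x = cinner v x *s v" for v x :: "complex^'d"
    by (simp add: vec_eq_iff ket_bra_def matrix_vector_mult_def cinner_def sum_distrib_left mult_ac)
  then show ?thesis by (simp add: dent_def cinner_scale_right onb)
qed

text \<open>The vectors \<^term>\<open>A *v e i\<close> with a common value of \<^term>\<open>f i\<close> are parallel and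
  orthogonal, so at most one of them is nonzero; hence no off-diagonal entry of \<^term>\<open>X\<close>
  reaches the diagonal.\<close>

lemma dent_step:
  assumes im: "\<And>i. \<exists>c. A *v e i = c *s e (f i)"
    and orth: "\<And>i j. i \<noteq> j \<Longrightarrow> cinner (A *v e i) (A *v e j) = 0"
  shows "dent e (A ** X ** cadj A) j =
    (\<Sum>i\<in>UNIV. if f i = j then of_real (Re (trace (A ** ket_bra (e i) ** cadj A))) * dent e X i else 0)"
proof -
  obtain k where k: "\<And>i. A *v e i = k i *s e (f i)" using im by metis
  \<comment> \<open>\<open>b i\<close> is the coefficient of \<open>A *v e i\<close> along
    \<open>e j\<close>; its conjugate is the coefficient of \<open>cadj A *v e j\<close> along
    \<open>e i\<close>.\<close>
  define b where "b i = (if f i = j then k i else 0)" for i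
  have "cadj A *v e j = (\<Sum>i\<in>UNIV. cnj (b i) *s e i)"
  proof -
    have "cadj A *v e j = (\<Sum>i\<in>UNIV. cinner (A *v e i) (e j) *s e i)"
      unfolding cinner_adj by (rule expand)
    then show ?thesis
      by (simp add: k cinner_scale_left onb b_def if_distrib cong: if_cong)
  qed
  moreover have "dent e (A ** X ** cadj A) j = cinner (cadj A *v e j) (X *v (cadj A *v e j))"
  proof -
    have "cadj (cadj A) = A" by (simp add: cadj_def vec_eq_iff)
    then show ?thesis
      using cinner_adj[of "cadj A" "e j" "X *v (cadj A *v e j)"]
      by (simp add: dent_def matrix_vector_mul_assoc matrix_mul_assoc)
  qed
  ultimately have "dent e (A ** X ** cadj A) j =
      (\<Sum>i\<in>UNIV. \<Sum>i'\<in>UNIV. b i * cnj (b i') * cinner (e i) (X *v e i'))"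
    by (simp add: cinner_sum_left cinner_sum_right cinner_scale_left cinner_scale_right
        matrix_mult_sum_right vector_scalar_commute sum_distrib_left mult_ac)
      (rule sum.swap)
  also have "\<dots> = (\<Sum>i\<in>UNIV. \<Sum>i'\<in>UNIV. if i' = i then b i * cnj (b i) * dent e X i else 0)"
  proof (intro sum.cong refl)
    fix i i' :: 'd
    have "b i * cnj (b i') = 0" if "i' \<noteq> i"
      using orth[OF that] by (auto simp: k b_def cinner_scale_left cinner_scale_right onb)
    then show "b i * cnj (b i') * cinner (e i) (X *v e i') = (if i' = i then b i * cnj (b i) * dent e X i else 0)"
      by (auto simp: dent_def)
  qed
  also have "\<dots> = (\<Sum>i\<in>UNIV. b i * cnj (b i) * dent e X i)"
    by simp
  also have "\<dots> = (\<Sum>i\<in>UNIV. if f i = j then of_real (Re (trace (A ** ket_bra (e i) ** cadj A))) * dent e X i else 0)"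
    by (intro sum.cong) (auto simp: conj_ket_bra trace_ket_bra k cinner_scale_left cinner_scale_right
        onb b_def complex_mult_cnj mult.commute[of "cnj _"])
  finally show ?thesis .
qed

end

section \<open>Quenched word probabilities in the basis\<close>

text \<open>Expansion in matrix units. The instrument is measurable in \<omega> for each fixed
  matrix, and this extends it to matrices that themselves depend on \<omega>.\<close>

lemma Tmap_entries:
  "Tmap V a \<omega> X $ r $ c = (\<Sum>x\<in>UNIV. \<Sum>y\<in>UNIV. X $ x $ y *
     Tmap V a \<omega> (\<chi> i j. if i = x \<and> j = y then 1 else 0) $ r $ c)"
proof -
  have entry: "Tmap V a \<omega> X $ r $ c = (\<Sum>x\<in>UNIV. \<Sum>y\<in>UNIV. V a \<omega> $ r $ x * X $ x $ y * cnj (V a \<omega> $ c $ y))" for X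
    unfolding Tmap_def cadj_def matrix_matrix_mult_def
    by (simp add: sum_distrib_right) (rule sum.swap)
  have "Tmap V a \<omega> (\<chi> i j. if i = x \<and> j = y then 1 else 0) $ r $ c = V a \<omega> $ r $ x * cnj (V a \<omega> $ c $ y)" for x y
  proof -
    have "Tmap V a \<omega> (\<chi> i j. if i = x \<and> j = y then 1 else 0) $ r $ c =
      (\<Sum>x'\<in>UNIV. \<Sum>y'\<in>UNIV. if y' = y then (if x' = x then V a \<omega> $ r $ x * cnj (V a \<omega> $ c $ y) else 0) else 0)"
      unfolding entry by (intro sum.cong refl) auto
    then show ?thesis by simp
  qed
  then show ?thesis by (simp add: entry mult_ac)
qed

lemma evolve_shift: "evolve V \<theta> \<omega> (Suc k) u X = evolve V \<theta> (\<theta> \<omega>) k u X"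
  by (induction u arbitrary: k X) (simp_all add: funpow_swap1)

lemma qprob_Cons: "qprob V \<theta> X \<omega> (a # u) = qprob V \<theta> (Tmap V a (\<theta> \<omega>) X) (\<theta> \<omega>) u"
  by (simp add: qprob_def evolve_shift[of V \<theta> \<omega> 1, simplified])

definition kraus_compatible ::
  "('a \<Rightarrow> 'w \<Rightarrow> complex^'d^'d) \<Rightarrow> ('d \<Rightarrow> complex^'d) \<Rightarrow> ('a \<Rightarrow> 'd \<Rightarrow> 'd) \<Rightarrow> 'w \<Rightarrow> bool" where
  "kraus_compatible V e f \<omega> \<longleftrightarrow> (\<forall>a i. (\<exists>c. V a \<omega> *v e i = c *s e (f a i)) \<and>
     (\<forall>j. j \<noteq> i \<longrightarrow> cinner (V a \<omega> *v e i) (V a \<omega> *v e j) = 0))"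

text \<open>Expressed through \<open>Tmap\<close> rather than \<open>V\<close>, because the
  measurability hypothesis and the mixing sigma-algebras concern \<open>Tmap\<close>.\<close>

definition letter_prob :: "('a \<Rightarrow> 'w \<Rightarrow> complex^'d^'d) \<Rightarrow> ('d \<Rightarrow> complex^'d) \<Rightarrow> 'a \<Rightarrow> 'w \<Rightarrow> 'd \<Rightarrow> real" where
  "letter_prob V e a \<omega> i = Re (trace (Tmap V a \<omega> (ket_bra (e i))))"

lemma letter_prob_eq: "letter_prob V e a \<omega> i = Re (cinner (V a \<omega> *v e i) (V a \<omega> *v e i))"
  by (simp add: letter_prob_def Tmap_def conj_ket_bra trace_ket_bra)

context orthonormal_basis
begin

lemma dent_Tmap:
  assumes "kraus_compatible V e f \<omega>"
  shows "Re (dent e (Tmap V a \<omega> X) j) =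
    (\<Sum>i\<in>UNIV. if f a i = j then letter_prob V e a \<omega> i * Re (dent e X i) else 0)"
proof -
  have "dent e (Tmap V a \<omega> X) j = (\<Sum>i\<in>UNIV. if f a i = j then of_real (letter_prob V e a \<omega> i) * dent e X i else 0)"
    unfolding Tmap_def letter_prob_def
    by (rule dent_step) (use assms in \<open>auto simp: kraus_compatible_def\<close>)
  then show ?thesis by (simp add: Re_sum if_distrib[of Re] cong: if_cong)
qed

text \<open>By \<open>dent_Tmap\<close>, reading one letter transforms the diagonal exactly as one
  step of the automaton does, for an arbitrary matrix \<open>X\<close>. The word probability is the
  trace at the end, that is, the sum of the final diagonal.\<close>

lemma qprob_eq_qc:
  assumes "\<And>k. kraus_compatible V e f ((\<theta> ^^ Suc k) \<omega>)"
  shows "qprob V \<theta> X \<omega> u = (\<Sum>i\<in>UNIV. Re (dent e X i) * qc (letter_prob V e) f \<theta> \<omega> i u)"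
  using assms
proof (induction u arbitrary: \<omega> X)
  case Nil
  then show ?case by (simp add: qprob_def trace_dent Re_sum)
next
  case (Cons a u)
  have "qprob V \<theta> X \<omega> (a # u) = (\<Sum>j\<in>UNIV. Re (dent e (Tmap V a (\<theta> \<omega>) X) j) * qc (letter_prob V e) f \<theta> (\<theta> \<omega>) j u)"
    unfolding qprob_Cons
    by (rule Cons.IH) (use Cons.prems[of "Suc _"] in \<open>simp add: funpow_swap1\<close>)
  also have "\<dots> = (\<Sum>j\<in>UNIV. \<Sum>i\<in>UNIV. if f a i = j then
      letter_prob V e a (\<theta> \<omega>) i * Re (dent e X i) * qc (letter_prob V e) f \<theta> (\<theta> \<omega>) j u else 0)"
    using Cons.prems[of 0] by (simp add: dent_Tmap sum_distrib_right if_distrib[of "\<lambda>x. x * _"] cong: if_cong)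
  also have "\<dots> = (\<Sum>i\<in>UNIV. Re (dent e X i) * qc (letter_prob V e) f \<theta> \<omega> i (a # u))"
    by (subst sum.swap) (simp add: mult_ac)
  finally show ?case .
qed

lemma letter_prob_sum:
  assumes "(\<Sum>a\<in>UNIV. cadj (V a \<omega>) ** V a \<omega>) = mat 1"
  shows "(\<Sum>a\<in>UNIV. letter_prob V e a \<omega> i) = 1"
proof -
  have "(\<Sum>a\<in>UNIV. cinner (V a \<omega> *v e i) (V a \<omega> *v e i)) = cinner (e i) ((\<Sum>a\<in>UNIV. cadj (V a \<omega>) ** V a \<omega>) *v e i)"
    by (simp add: matrix_mult_sum_left cinner_sum_right cinner_adj matrix_vector_mul_assoc)
  also have "\<dots> = 1" by (simp add: assms onb)
  finally show ?thesis by (simp add: letter_prob_eq flip: Re_sum)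
qed

end

section \<open>Measurability of word probabilities\<close>

lemma borel_measurable_Re_trace: "(\<lambda>X :: complex^'d^'d. Re (trace X)) \<in> borel_measurable borel"
  unfolding trace_def by (intro borel_measurable_continuous_onI continuous_intros)

lemma borel_measurable_entry: "(\<lambda>X :: complex^'d^'d. X $ r $ c) \<in> borel_measurable borel"
  by (intro borel_measurable_continuous_onI continuous_intros)

lemma borel_measurable_Re_dent: "(\<lambda>X. Re (dent e X i)) \<in> borel_measurable borel"
  unfolding dent_entries by (intro borel_measurable_continuous_onI continuous_intros)

lemma evolve_measurable:
  assumes "\<And>a k X. (\<lambda>\<omega>. Tmap V a ((\<theta> ^^ k) \<omega>) X) \<in> borel_measurable M"
    and "\<And>r c. (\<lambda>\<omega>. Y \<omega> $ r $ c) \<in> borel_measurable M"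
  shows "(\<lambda>\<omega>. evolve V \<theta> \<omega> k u (Y \<omega>) $ r $ c) \<in> borel_measurable M"
  using assms(2)
proof (induction u arbitrary: k Y r c)
  case (Cons a u)
  have "(\<lambda>\<omega>. Tmap V a ((\<theta> ^^ k) \<omega>) (Y \<omega>) $ r $ c) \<in> borel_measurable M" for r c
    unfolding Tmap_entries[of V a _ "Y _"]
    by (intro borel_measurable_sum borel_measurable_times Cons.prems
        measurable_compose[OF assms(1) borel_measurable_entry])
  from Cons.IH[OF this] show ?case by simp
qed simp

lemma qprob_measurable:
  assumes "\<And>a k X. (\<lambda>\<omega>. Tmap V a ((\<theta> ^^ k) \<omega>) X) \<in> borel_measurable M"
    and "Y \<in> borel_measurable M"
  shows "(\<lambda>\<omega>. qprob V \<theta> (Y \<omega>) \<omega> u) \<in> borel_measurable M"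
  unfolding qprob_def trace_def Re_sum
  by (intro borel_measurable_sum measurable_compose[OF evolve_measurable borel_measurable_Re]
      assms(1) measurable_compose[OF assms(2) borel_measurable_entry])

section \<open>The instrument as a random automaton, and the limit theorem\<close>

theorem theorem4:
  fixes P :: "'w measure"
    and \<theta> :: "'w \<Rightarrow> 'w"
    and V :: "'a::finite \<Rightarrow> 'w \<Rightarrow> complex^'d^'d"
    and \<delta> :: real
    and s :: "'w \<Rightarrow> complex^'d^'d"
    and r :: "nat \<Rightarrow> real"
    and e :: "'d \<Rightarrow> complex^'d"
    and f :: "'a \<Rightarrow> 'd \<Rightarrow> 'd"
    and L :: nat
    and \<epsilon> :: real
    and \<kappa> :: "'d \<Rightarrow> 'd \<Rightarrow> 'w \<Rightarrow> ('a list \<times> 'a list) pmf"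
    and b :: "'a list"
    and \<tau> :: "'w \<Rightarrow> complex^'d^'d"
  assumes prob: "prob_space P"
    and instrument: "perfect_random_instrument P V"
    \<comment> \<open>(H1)\<close>
    and H1_inv: "bij_betw \<theta> (space P) (space P)"
    and H1_inv_meas: "inv_into (space P) \<theta> \<in> P \<rightarrow>\<^sub>M P"
    and H1_pres: "measure_preserving_map P \<theta>"
    and H1_erg: "ergodic_map P \<theta>"
    \<comment> \<open>(H2)\<close>
    and delta_pos: "\<delta> > 0"
    and H2: "summable (\<lambda>n. alpha_mix P V \<theta> (Suc n) powr (\<delta> / (2 + \<delta>)))"
    \<comment> \<open>(H3)\<close>
    and H3_s: "random_state P s"
    and H3_stat: "dyn_stationary P V \<theta> s"
    and H3_r_nonneg: "\<forall>n. 0 \<le> r n"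
    and H3_r_sum: "summable (\<lambda>n. r (Suc n) powr (\<delta> / (2 + \<delta>)))"
    and H3_conv: "\<forall>\<tau>'. random_state P \<tau>' \<longrightarrow> (\<forall>n\<ge>1.
        (\<integral>\<^sup>+\<omega>. ennreal (trace_norm (PhiN V \<theta> n \<omega> (\<tau>' \<omega>) - s ((\<theta> ^^ n) \<omega>))) \<partial>P) \<le> ennreal (r n))"
    \<comment> \<open>(A): orthonormal basis\<close>
    and A_onb: "\<forall>i j. cinner (e i) (e j) = (if i = j then 1 else 0)"
    \<comment> \<open>(A.1)\<close>
    and A1: "\<forall>a. AE \<omega> in P. \<forall>i. (\<exists>c. V a \<omega> *v e i = c *s e (f a i)) \<and>
        (\<forall>j. j \<noteq> i \<longrightarrow> cinner (V a \<omega> *v e i) (V a \<omega> *v e j) = 0)"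
    \<comment> \<open>(A.2)\<close>
    and A2_L: "L \<ge> 1"
    and A2_eps: "\<epsilon> > 0"
    and A2_meas: "\<forall>i j uv. (\<lambda>\<omega>. pmf (\<kappa> i j \<omega>) uv) \<in> borel_measurable P"
    and A2_coupling: "AE \<omega> in P. \<forall>i j.
        (\<forall>u. pmf (map_pmf fst (\<kappa> i j \<omega>)) u =
              (if length u = L then qprob V \<theta> (ket_bra (e i)) \<omega> u else 0)) \<and>
        (\<forall>v. pmf (map_pmf snd (\<kappa> i j \<omega>)) v =
              (if length v = L then qprob V \<theta> (ket_bra (e j)) \<omega> v else 0)) \<and>
        measure_pmf.prob (\<kappa> i j \<omega>) {(u, v). fword f u i = fword f v j} \<ge> \<epsilon>"
    \<comment> \<open>the word b and the random initial state\<close>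
    and b_nonempty: "b \<noteq> []"
    and init: "random_state P \<tau>"
  shows "summable (\<lambda>k. cov_b P V \<theta> s b (Suc k)) \<and>
    weak_conv_m
      (\<lambda>n. distr (annealed_marginal P V \<theta> \<tau> (n + length b - 1)) borel
              (\<lambda>as. (\<Sum>k=1..n. (dN b k as - mu_b P V \<theta> s b)) / sqrt (real n)))
      (centered_gaussian (Sigma2_b P V \<theta> s b))"
proof -
  interpret prob_space P by (rule prob)
  interpret orthonormal_basis e by unfold_locales (use A_onb in blast)
  define p where "p = letter_prob V e"
  define \<pi> where "\<pi> \<tau>' \<omega> i = Re (dent e (\<tau>' \<omega>) i)" for \<tau>' :: "'w \<Rightarrow> complex^'d^'d" and \<omega> i
  define Past where "Past k = sigma (space P) (F_past P V \<theta> (int k))" for k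
  define Fut where "Fut k = sigma (space P) (F_future P V \<theta> (int k))" for k
  have sets_Past: "sets (Past k) = F_past P V \<theta> (int k)" for k
    by (simp add: Past_def sets_measure_of[OF F_past_subset] sigma_sets_F_past)
  have sets_Fut: "sets (Fut k) = F_future P V \<theta> (int k)" for k
    by (simp add: Fut_def sets_measure_of[OF F_future_subset] sigma_sets_F_future)
  have space: "space (Past k) = space P" "space (Fut k) = space P" for k
    by (simp_all add: Past_def Fut_def space_measure_of[OF F_past_subset] space_measure_of[OF F_future_subset])
  have \<theta>_meas: "\<theta> \<in> P \<rightarrow>\<^sub>M P" using H1_pres by (simp add: measure_preserving_map_def)
  have \<theta>_pres: "distr P P \<theta> = P"
    by (rule measure_eqI) (use H1_pres in \<open>auto simp: measure_preserving_map_def emeasure_distr\<close>)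
  have T_meas: "(\<lambda>\<omega>. Tmap V a \<omega> X) \<in> borel_measurable P" for a X
    using instrument by (simp add: perfect_random_instrument_def)
  have AE_kraus: "AE \<omega> in P. kraus_compatible V e f \<omega>"
    unfolding kraus_compatible_def by (rule iffD2[OF AE_all_countable A1])
  have p_meas_gen: "(\<lambda>\<omega>. p a (h \<omega>) i) \<in> borel_measurable N"
    if "(\<lambda>\<omega>. Tmap V a (h \<omega>) (ket_bra (e i))) \<in> borel_measurable N" for a i h and N :: "'w measure"
    unfolding p_def letter_prob_def by (rule measurable_compose[OF that borel_measurable_Re_trace])
  \<comment> \<open>At nonnegative times \<open>thetaZ\<close> is a forward iterate of \<theta>, so
    the environments met by the automaton are among the generators of the two-sided
    sigma-algebras.\<close>
  have T_level: "{\<omega> \<in> space P. Tmap V a (thetaZ P \<theta> (int j) \<omega>) X \<in> B} =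
      (\<lambda>\<omega>. Tmap V a ((\<theta> ^^ j) \<omega>) X) -` B \<inter> space P" for a j X B
    by (auto simp: thetaZ_def)
  have T_Past: "(\<lambda>\<omega>. Tmap V a ((\<theta> ^^ j) \<omega>) X) \<in> borel_measurable (Past k)" if "j \<le> k" for a j k X
  proof (rule measurableI)
    fix B :: "(complex^'d^'d) set" assume "B \<in> sets borel"
    then show "(\<lambda>\<omega>. Tmap V a ((\<theta> ^^ j) \<omega>) X) -` B \<inter> space (Past k) \<in> sets (Past k)"
      unfolding sets_Past F_past_def using that
      by (intro sigma_sets.Basic CollectI exI[of _ a] exI[of _ X] exI[of _ B] exI[of _ "int j"])
        (simp add: T_level space)
  qed simp
  have T_Fut: "(\<lambda>\<omega>. Tmap V a ((\<theta> ^^ j) \<omega>) X) \<in> borel_measurable (Fut k)" if "k \<le> j" for a j k X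
  proof (rule measurableI)
    fix B :: "(complex^'d^'d) set" assume "B \<in> sets borel"
    then show "(\<lambda>\<omega>. Tmap V a ((\<theta> ^^ j) \<omega>) X) -` B \<inter> space (Fut k) \<in> sets (Fut k)"
      unfolding sets_Fut F_future_def using that
      by (intro sigma_sets.Basic CollectI exI[of _ a] exI[of _ X] exI[of _ B] exI[of _ "int j"])
        (simp add: T_level space)
  qed simp
  note pow_meas = measurable_funpow[OF \<theta>_meas]
  note pow_distr = distr_funpow[OF \<theta>_meas \<theta>_pres]
  have AE_kraus_pow: "AE \<omega> in P. \<forall>k. kraus_compatible V e f ((\<theta> ^^ k) \<omega>)"
    unfolding AE_all_countable
    by (intro allI AE_distrD[OF pow_meas]) (simp only: pow_distr AE_kraus)
  have q_eq: "AE \<omega> in P. \<forall>X u. qprob V \<theta> X \<omega> u = (\<Sum>i\<in>UNIV. Re (dent e X i) * qc p f \<theta> \<omega> i u)"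
    using AE_kraus_pow unfolding p_def by eventually_elim (blast intro: qprob_eq_qc)
  have \<epsilon>_le_1: "\<epsilon> \<le> 1"
  proof -
    have "AE \<omega> in P. \<epsilon> \<le> 1"
      using A2_coupling
    proof eventually_elim
      case (elim \<omega>)
      fix i
      have "\<epsilon> \<le> measure_pmf.prob (\<kappa> i i \<omega>) {(u, v). fword f u i = fword f v i}" using elim by blast
      also have "\<dots> \<le> 1" by simp
      finally show ?case .
    qed
    then show ?thesis by simp
  qed
  interpret A: random_automaton P \<theta> p f L \<epsilon> Past Fut "alpha_mix P V \<theta>"
  proof
    show "\<theta> \<in> P \<rightarrow>\<^sub>M P" "distr P P \<theta> = P" by (rule \<theta>_meas, rule \<theta>_pres)
    show "(\<lambda>\<omega>. p a \<omega> i) \<in> borel_measurable P" for a i by (rule p_meas_gen[OF T_meas])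
    show "0 \<le> p a \<omega> i" for a \<omega> i by (simp add: p_def letter_prob_eq cinner_self_nonneg)
    show "AE \<omega> in P. \<forall>i. (\<Sum>a\<in>UNIV. p a \<omega> i) = 1"
      using instrument unfolding perfect_random_instrument_def p_def
      by (auto elim!: eventually_mono simp: letter_prob_sum)
    show "0 < L" "0 < \<epsilon>" "\<epsilon> \<le> 1" using A2_L A2_eps \<epsilon>_le_1 by auto
    show "AE \<omega> in P. \<forall>i j h D. (\<forall>x y. \<bar>h x - h y\<bar> \<le> D) \<longrightarrow>
        \<bar>(\<Sum>u\<in>words L. qc p f \<theta> \<omega> i u * h (fword f u i)) -
         (\<Sum>u\<in>words L. qc p f \<theta> \<omega> j u * h (fword f u j))\<bar> \<le> (1 - \<epsilon>) * D"
      using A2_coupling q_eq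
    proof eventually_elim
      case (elim \<omega>)
      \<comment> \<open>The projection onto \<open>e i\<close> has its diagonal concentrated at
        \<open>i\<close>, so the coupled laws of (A.2) are the laws of the automaton started in
        \<open>i\<close> and \<open>j\<close>.\<close>
      have q: "qc p f \<theta> \<omega> i u = qprob V \<theta> (ket_bra (e i)) \<omega> u" for i u
        using elim(2) by (simp add: dent_ket_bra if_distrib[of Re] if_distrib[of "\<lambda>x. x * _"] cong: if_cong)
      show ?case
        unfolding q
      proof (intro allI impI)
        fix i j and h :: "'d \<Rightarrow> real" and D assume h: "\<forall>x y. \<bar>h x - h y\<bar> \<le> D"
        show "\<bar>(\<Sum>u\<in>words L. qprob V \<theta> (ket_bra (e i)) \<omega> u * h (fword f u i)) -
         (\<Sum>u\<in>words L. qprob V \<theta> (ket_bra (e j)) \<omega> u * h (fword f u j))\<bar> \<le> (1 - \<epsilon>) * D"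
          by (rule coupling_contraction[of "\<kappa> i j \<omega>"]) (use elim(1) h in blast)+
      qed
    qed
    show "space (Past k) = space P" "space (Fut k) = space P" for k by (fact space)+
    show "(\<lambda>\<omega>. p a ((\<theta> ^^ j) \<omega>) i) \<in> borel_measurable (Past k)" if "0 < j" "j \<le> k" for a i j k
      using that by (intro p_meas_gen T_Past)
    show "(\<lambda>\<omega>. p a ((\<theta> ^^ j) \<omega>) i) \<in> borel_measurable (Fut k)" if "k \<le> j" for a i j k
      using that by (intro p_meas_gen T_Fut)
    show "\<bar>measure P (B \<inter> C) - measure P B * measure P C\<bar> \<le> alpha_mix P V \<theta> n"
      if "B \<in> sets (Past k)" "C \<in> sets (Fut (k + n))" for B C k n
      using that unfolding sets_Past sets_Fut by (intro correlation_le_alpha_mix) simp_all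
  qed
  have initial: "A.init (\<pi> \<tau>')" if "random_state P \<tau>'" for \<tau>'
    unfolding A.init_def \<pi>_def
  proof (intro conjI allI ballI)
    show "(\<lambda>\<omega>. Re (dent e (\<tau>' \<omega>) i)) \<in> borel_measurable P" for i
      using that by (intro measurable_compose[OF _ borel_measurable_Re_dent]) (simp add: random_state_def)
    fix \<omega> assume "\<omega> \<in> space P"
    then have d: "density_matrix (\<tau>' \<omega>)" using that by (simp add: random_state_def)
    then show "0 \<le> Re (dent e (\<tau>' \<omega>) i)" for i
      by (simp add: density_matrix_def psd_def dent_def)
    show "(\<Sum>i\<in>UNIV. Re (dent e (\<tau>' \<omega>) i)) = 1"
      using d by (simp add: density_matrix_def trace_dent flip: Re_sum)
  qed
  have law: "(\<integral>\<omega>. qprob V \<theta> (\<tau>' \<omega>) \<omega> u \<partial>P) = A.law (\<pi> \<tau>') u" if "random_state P \<tau>'" for \<tau>' u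
    unfolding A.law_def
  proof (rule integral_cong_AE)
    show "(\<lambda>\<omega>. qprob V \<theta> (\<tau>' \<omega>) \<omega> u) \<in> borel_measurable P"
      using that by (intro qprob_measurable measurable_compose[OF pow_meas T_meas]) (simp add: random_state_def)
    show "(\<lambda>\<omega>. \<Sum>i\<in>UNIV. \<pi> \<tau>' \<omega> i * qc p f \<theta> \<omega> i u) \<in> borel_measurable P"
      using A.integrable_law[OF initial[OF that]] by (rule borel_measurable_integrable)
    show "AE \<omega> in P. qprob V \<theta> (\<tau>' \<omega>) \<omega> u = (\<Sum>i\<in>UNIV. \<pi> \<tau>' \<omega> i * qc p f \<theta> \<omega> i u)"
      using q_eq by (auto elim!: eventually_mono simp: \<pi>_def)
  qed
  have stat: "stationary_word_law (A.law (\<pi> s))"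
  proof (rule A.stationary_law[OF initial[OF H3_s]])
    \<comment> \<open>One step of dynamical stationarity, read on the diagonal, is the equation
      required by \<open>stationary_law\<close>.\<close>
    have "AE \<omega> in P. PhiN V \<theta> 1 \<omega> (s \<omega>) = s ((\<theta> ^^ 1) \<omega>)"
      using H3_stat unfolding dyn_stationary_def by blast
    then show "AE \<omega> in P. \<forall>j. \<pi> s (\<theta> \<omega>) j = (\<Sum>a\<in>UNIV. \<Sum>i\<in>UNIV. if f a i = j then p a (\<theta> \<omega>) i * \<pi> s \<omega> i else 0)"
      using AE_kraus_pow
    proof eventually_elim
      case (elim \<omega>)
      have "kraus_compatible V e f (\<theta> \<omega>)" using elim(2)[rule_format, of 1] by simp
      moreover have "s (\<theta> \<omega>) = (\<Sum>a\<in>UNIV. Tmap V a (\<theta> \<omega>) (s \<omega>))"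
        using elim(1) by (simp add: Phi1_def)
      ultimately show ?case
        unfolding \<pi>_def p_def by (simp add: dent_sum Re_sum dent_Tmap)
    qed
  qed
  have "summable (\<lambda>n. alpha_mix P V \<theta> (Suc n))"
    by (rule alpha_mix_summable[OF H2]) (use delta_pos in simp_all)
  from A.mixing_law[OF initial[OF H3_s] stat this alpha_mix_decseq]
  interpret W: mixing_word_law "A.law (\<pi> s)" A.rate .
  define m where "m = length b"
  define \<mu> where "\<mu> = mu_b P V \<theta> s b"
  have \<mu>: "\<mu> = A.law (\<pi> s) b" by (simp add: \<mu>_def mu_b_def law[OF H3_s])
  define \<psi> where "\<psi> u = (if u = b then 1 else 0) - \<mu>" for u
  have ind: "wexp (A.law (\<pi> s)) m (\<lambda>u. if u = b then 1 else 0) = \<mu>"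
    by (simp add: wexp_def \<mu> m_def if_distrib[of "\<lambda>x. _ * x"] cong: if_cong)
  have \<mu>01: "0 \<le> \<mu>" "\<mu> \<le> 1"
    using W.w_nonneg W.wexp_mono[of m "\<lambda>u. if u = b then 1 else 0" "\<lambda>_. 1"] by (auto simp: \<mu> ind[unfolded \<mu>])
  interpret O: window_observable "A.law (\<pi> s)" A.rate \<psi> m
  proof
    show "\<bar>\<psi> u\<bar> \<le> 1" for u using \<mu>01 by (simp add: \<psi>_def)
    show "wexp (A.law (\<pi> s)) m \<psi> = 0" by (simp add: \<psi>_def[abs_def] wexp_diff ind)
    show "0 < m" using b_nonempty by (simp add: m_def)
  qed
  \<comment> \<open>Positions are counted from 1 in \<open>dN\<close> and from 0 in
    \<open>O.X\<close>.\<close>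
  have X: "dN b (Suc i) u - \<mu> = O.X i u" for i u
    by (simp add: dN_def O.X_def \<psi>_def flip: m_def)
  have marginal: "annealed_marginal P V \<theta> \<tau>' N = point_measure (words N) (\<lambda>u. ennreal (A.law (\<pi> \<tau>') u))"
    if "random_state P \<tau>'" for \<tau>' N
    by (simp add: annealed_marginal_def law[OF that] words_def)
  have integral_marginal: "(\<integral>u. F u \<partial>annealed_marginal P V \<theta> \<tau>' N) = wexp (A.law (\<pi> \<tau>')) N F"
    if "random_state P \<tau>'" for \<tau>' N and F :: "'a list \<Rightarrow> 'b::{banach, second_countable_topology}"
    unfolding marginal[OF that] wexp_def
    by (intro lebesgue_integral_point_measure_finite word_law.w_nonneg A.word_law_law initial that) simp
  have cov: "cov_b P V \<theta> s b k = O.c k" for k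
    using X[of 0] X[of k] by (simp add: cov_b_def O.c_def integral_marginal[OF H3_s] flip: \<mu>_def m_def)
  have Sigma2: "Sigma2_b P V \<theta> s b = O.sigma2"
    by (simp add: Sigma2_b_def O.sigma2_def cov)
  have "weak_conv_m
      (\<lambda>n. distr (annealed_marginal P V \<theta> \<tau> (n + length b - 1)) borel
              (\<lambda>as. (\<Sum>k=1..n. (dN b k as - mu_b P V \<theta> s b)) / sqrt (real n)))
      (centered_gaussian (Sigma2_b P V \<theta> s b))"
  proof (rule levy_continuity)
    let ?M = "\<lambda>n. annealed_marginal P V \<theta> \<tau> (n + length b - 1)"
    let ?S = "\<lambda>n as. (\<Sum>k=1..n. (dN b k as - mu_b P V \<theta> s b)) / sqrt (real n)"
    have S_meas: "?S n \<in> borel_measurable (?M n)" for n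
      by (simp add: annealed_marginal_def)
    show "real_distribution (distr (?M n) borel (?S n))" for n
    proof -
      interpret word_law "A.law (\<pi> \<tau>)" by (rule A.word_law_law[OF initial[OF init]])
      have "emeasure (?M n) (space (?M n)) = ennreal (wexp (A.law (\<pi> \<tau>)) (n + length b - 1) (\<lambda>_. 1))"
        by (simp add: marginal[OF init] space_point_measure emeasure_point_measure_finite sum_ennreal w_nonneg wexp_def)
      then have "prob_space (?M n)" by (intro prob_spaceI) simp
      then show ?thesis by (rule prob_space.real_distribution_distr[OF _ S_meas])
    qed
    show "real_distribution (centered_gaussian (Sigma2_b P V \<theta> s b))"
      unfolding Sigma2 by (rule real_distribution_centered_gaussian[OF O.sigma2_nonneg])
    fix t
    have sum: "t * ?S n u = t / sqrt (real n) * (\<Sum>i<n. O.X i u)" for n u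
      by (simp add: sum.atLeast1_atMost_eq X flip: \<mu>_def)
    have "char (distr (?M n) borel (?S n)) t = wexp (A.law (\<pi> \<tau>)) (n + m - 1) (\<lambda>u. iexp (t / sqrt (real n) * (\<Sum>i<n. O.X i u)))" for n
      unfolding char_def by (subst integral_distr[OF S_meas]) (simp_all only: sum integral_marginal[OF init] m_def, simp)
    then show "(\<lambda>n. char (distr (?M n) borel (?S n)) t) \<longlonglongrightarrow> char (centered_gaussian (Sigma2_b P V \<theta> s b)) t"
      unfolding Sigma2 char_centered_gaussian[OF O.sigma2_nonneg]
      using A.char_tendsto_init[OF initial[OF H3_s] initial[OF init] O.window_observable_axioms] by simp
  qed
  then show ?thesis using O.summable_c_Suc by (simp add: cov)
qed

end
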